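(* The category $\mathit{Prolixe}$ of Penon's weak omega categories is a retract of the full subcategory $\mathit{Pen\_Omega\_Cat}$ of $\mathit{Omega\_Cat}$: there are functors $U:\mathit{Pen\_Omega\_Cat}\to\mathit{Prolixe}$ and $S:\mathit{Prolixe}\to\mathit{Pen\_Omega\_Cat}$ with $U\circ S=1_{\mathit{Prolixe}}$.
   Context: A globular set $X$ is a sequence of sets $X_i$ ($i\ge 0$; elements are called $i$-cells) with functions $dom_{i-1}^i,cod_{i-1}^i:X_i\to X_{i-1}$ ($i>0$) satisfying $dom_{i-1}^i dom_i^{i+1}=dom_{i-1}^i cod_i^{i+1}$ and $cod_{i-1}^i dom_i^{i+1}=cod_{i-1}^i cod_i^{i+1}$. For $i<j$, $dom_i^j,cod_i^j:X_j\to X_i$ are the iterated composites. An omega graph is a globular set with functions $id_i^{i-1}:X_{i-1}\to X_i$ ($i>0$) with $dom_{i-1}^i id_i^{i-1}x=x=cod_{i-1}^i id_i^{i-1}x$; $id_j^i$ denotes the iterated composite $X_i\to X_j$. An omega magma is an omega graph with, for all $0\le i<j$, a partial binary operation $a\circ_i^j b$ on $j$-cells, defined exactly when $cod_i^j a=dom_i^j b$, such that: if $i+1=j$, then $dom_i^j(a\circ_i^j b)=dom_i^j a$ and $cod_i^j(a\circ_i^j b)=cod_i^j b$; if $i+1<j$, then $dom_{j-1}^j(a\circ_i^j b)=dom_{j-1}^ja\circ_i^{j-1}dom_{j-1}^jb$ and likewise for $cod_{j-1}^j$. Morphisms of globular sets, omega graphs and omega magmas preserve all the respective structure. A strict omega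 category is an omega magma in which (whenever the composites are defined) $(a\circ_i^jb)\circ_i^jc=a\circ_i^j(b\circ_i^jc)$; $(a\circ_j^kb)\circ_i^k(c\circ_j^kd)=(a\circ_i^kc)\circ_j^k(b\circ_i^kd)$ for $i<j<k$; $a=id_j^i(dom_i^ja)\circ_i^ja=a\circ_i^jid_j^i(cod_i^ja)$; and $id_{j+1}^j(a)\circ_i^{j+1}id_{j+1}^j(b)=id_{j+1}^j(a\circ_i^jb)$ for $i<j$. Two $i$-cells $a,b$ are parallel, $a\parallel b$, if they have the same $dom_{i-1}^i$ and the same $cod_{i-1}^i$; any two $0$-cells are parallel. A bridge relation $R$ on an omega graph (or omega magma) $X$ is a sequence $R_i\subseteq X_i\times X_i\times X_{i+1}$ ($i\ge0$) such that: $(a,b,c)\in R_i$ implies $a\parallel b$, $dom_i^{i+1}c=a$, $cod_i^{i+1}c=b$; $(a,a,id_{i+1}^ia)\in R_i$ for all $a\in X_i$; $(a,b,c),(a,b,d)\in R_i$ implies $c=d$. The diagonal bridge relation $R^\Delta$ consists of all triples $(a,a,id_{i+1}^ia)$. A bridge morphism $F:(X,R^X)\to(Y,R^Y)$ is an omega magma morphism with $(a,b,c)\in R_i^X\Rightarrow(Fa,Fb,Fc)\in R_i^Y$. A categorical Penon morphism is a bridge morphism $F:(X,R^X)\to(Y,R^Y)$ such that $Y$ is a strict omega category, $R^Y=R^\Delta$; $(a,b,c)\in R_i^X$ implies $Fa=Fb$ and $Fc=id_{i+1}^i(Fa)$; and if $a,b\in X_i$, $a\parallel b$, $Fa=Fb$,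 then there is $c$ with $(a,b,c)\in R_i^X$. A weak omega category $\mathbf X$ consists of omega magmas $X_1$ (the underlying magma) and $X_2$, an omega magma morphism $\lambda^X:X_2\to X_1$, a morphism $\rho^X:X_1\to X_2$ of omega graphs with $\lambda^X\circ\rho^X=1$ (as omega graph morphisms), a bridge relation $R^X$ on $X_2$, a strict omega category $X_3$, and a categorical Penon morphism $\kappa^X:(X_2,R^X)\to(X_3,R^\Delta)$. An omega functor $\mathbf F:\mathbf X\to\mathbf Y$ is a triple of omega magma morphisms $F_i:X_i\to Y_i$ ($i=1,2,3$) with $F_2$ a bridge morphism $(X_2,R^X)\to(Y_2,R^Y)$, $F_1\lambda^X=\lambda^YF_2$, $F_3\kappa^X=\kappa^YF_2$, and $F_2\rho^X=\rho^YF_1$ (as omega graph morphisms). $\mathit{Omega\_Cat}$ is the category of small weak omega categories and omega functors. $\mathit{Pen\_Mor}$ is the category whose objects are categorical Penon morphisms (between small omega magmas) and whose morphisms are commutative squares of bridge morphisms. The forgetful functor $U_G^P:\mathit{Pen\_Mor}\to\mathit{Omega\_Graph}$ sends a categorical Penon morphism to the omega graph underlying its domain; it has a left adjoint $L_P^G$. For an omega graph $Y$ write $L_P^GY=\eta_P(Y):M_P(Y)\to C(Y)$; here $C(Y)$ is the strict omega category freely generated by $Y$. Let $\mathbb T=U_G^P\circ L_P^G$ be the resulting monad on $\mathit{Omega\_Graph}$. A prolixe is a $\mathbb T$-algebra, and $\mathit{Prolixe}$ is the category of $\mathbb T$-algebras and $\mathbb T$-algebra morphisms. $\mathit{Pen\_Omega\_Cat}$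 is the full subcategory of $\mathit{Omega\_Cat}$ on those $\mathbf X$ such that, with $Y$ the omega graph underlying $X_1$: $\kappa^X=\eta_P(Y)=L_P^GY$ (so $X_2=M_P(Y)$ with its bridge relation, and $X_3=C(Y)$), and $\rho^X$ is the component at $Y$ of the unit of the adjunction $L_P^G\dashv U_G^P$. *)

theory Defs
  imports "HOL-Library.FuncSet"
begin

section \<open>Categories, functors, adjunctions and algebras for a monad\<close>

text \<open>
  \<open>Comp C X Y Z g f\<close> is the composite of \<open>f : X \<rightarrow> Y\<close> and \<open>g : Y \<rightarrow> Z\<close>. Different hom-sets are
  allowed to overlap: a morphism always comes with its source and target, as an element of a
  particular hom-set.
\<close>

record ('o, 'm) category =
  Ob :: "'o set"
  Hom :: "'o \<Rightarrow> 'o \<Rightarrow> 'm set"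
  Ident :: "'o \<Rightarrow> 'm"
  Comp :: "'o \<Rightarrow> 'o \<Rightarrow> 'o \<Rightarrow> 'm \<Rightarrow> 'm \<Rightarrow> 'm"

locale category =
  fixes C :: "('o, 'm) category"
  assumes Id_in: "X \<in> Ob C \<Longrightarrow> Ident C X \<in> Hom C X X"
    and Comp_in: "\<lbrakk>X \<in> Ob C; Y \<in> Ob C; Z \<in> Ob C; f \<in> Hom C X Y; g \<in> Hom C Y Z\<rbrakk>
      \<Longrightarrow> Comp C X Y Z g f \<in> Hom C X Z"
    and Comp_Id_left: "\<lbrakk>X \<in> Ob C; Y \<in> Ob C; f \<in> Hom C X Y\<rbrakk> \<Longrightarrow> Comp C X Y Y (Ident C Y) f = f"
    and Comp_Id_right: "\<lbrakk>X \<in> Ob C; Y \<in> Ob C; f \<in> Hom C X Y\<rbrakk> \<Longrightarrow> Comp C X X Y f (Ident C X) = f"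
    and Comp_assoc: "\<lbrakk>W \<in> Ob C; X \<in> Ob C; Y \<in> Ob C; Z \<in> Ob C;
        f \<in> Hom C W X; g \<in> Hom C X Y; h \<in> Hom C Y Z\<rbrakk>
      \<Longrightarrow> Comp C W Y Z h (Comp C W X Y g f) = Comp C W X Z (Comp C X Y Z h g) f"

definition full_subcategory :: "('o, 'm) category \<Rightarrow> 'o set \<Rightarrow> ('o, 'm) category" where
  "full_subcategory C A = C\<lparr>Ob := Ob C \<inter> A\<rparr>"

record ('o, 'm, 'p, 'n) functor_data =
  omap :: "'o \<Rightarrow> 'p"
  amap :: "'o \<Rightarrow> 'o \<Rightarrow> 'm \<Rightarrow> 'n"

locale cat_functor =
  source: category C + target: category D
  for C :: "('o, 'm) category" and D :: "('p, 'n) category" +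
  fixes F :: "('o, 'm, 'p, 'n) functor_data"
  assumes omap_in: "X \<in> Ob C \<Longrightarrow> omap F X \<in> Ob D"
    and amap_in: "\<lbrakk>X \<in> Ob C; Y \<in> Ob C; f \<in> Hom C X Y\<rbrakk>
      \<Longrightarrow> amap F X Y f \<in> Hom D (omap F X) (omap F Y)"
    and amap_Id: "X \<in> Ob C \<Longrightarrow> amap F X X (Ident C X) = Ident D (omap F X)"
    and amap_Comp: "\<lbrakk>X \<in> Ob C; Y \<in> Ob C; Z \<in> Ob C; f \<in> Hom C X Y; g \<in> Hom C Y Z\<rbrakk>
      \<Longrightarrow> amap F X Z (Comp C X Y Z g f)
        = Comp D (omap F X) (omap F Y) (omap F Z) (amap F Y Z g) (amap F X Y f)"

definition id_functor :: "('o, 'm, 'o, 'm) functor_data" where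
  "id_functor = \<lparr>omap = (\<lambda>X. X), amap = (\<lambda>X Y f. f)\<rparr>"

definition comp_functor ::
    "('p, 'n, 'q, 'k) functor_data \<Rightarrow> ('o, 'm, 'p, 'n) functor_data \<Rightarrow> ('o, 'm, 'q, 'k) functor_data"
  where
  "comp_functor G F =
    \<lparr>omap = (\<lambda>X. omap G (omap F X)),
     amap = (\<lambda>X Y f. amap G (omap F X) (omap F Y) (amap F X Y f))\<rparr>"

text \<open>Equality of functors with source \<open>C\<close>: strict equality, on objects and on morphisms of \<open>C\<close>.\<close>

definition functor_eq ::
    "('o, 'm) category \<Rightarrow> ('o, 'm, 'p, 'n) functor_data \<Rightarrow> ('o, 'm, 'p, 'n) functor_data \<Rightarrow> bool"
  where
  "functor_eq C F G \<longleftrightarrow>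
    (\<forall>X\<in>Ob C. omap F X = omap G X) \<and>
    (\<forall>X\<in>Ob C. \<forall>Y\<in>Ob C. \<forall>f\<in>Hom C X Y. amap F X Y f = amap G X Y f)"

locale natural_transformation =
  F: cat_functor C D F + G: cat_functor C D G
  for C :: "('o, 'm) category" and D :: "('p, 'n) category"
    and F G :: "('o, 'm, 'p, 'n) functor_data" +
  fixes \<tau> :: "'o \<Rightarrow> 'n"
  assumes component_in: "X \<in> Ob C \<Longrightarrow> \<tau> X \<in> Hom D (omap F X) (omap G X)"
    and natural: "\<lbrakk>X \<in> Ob C; Y \<in> Ob C; f \<in> Hom C X Y\<rbrakk>
      \<Longrightarrow> Comp D (omap F X) (omap F Y) (omap G Y) (\<tau> Y) (amap F X Y f)
        = Comp D (omap F X) (omap G X) (omap G Y) (amap G X Y f) (\<tau> X)"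

locale adjunction =
  left: cat_functor C D L + right: cat_functor D C R +
  unit: natural_transformation C C id_functor "comp_functor R L" \<eta> +
  counit: natural_transformation D D "comp_functor L R" id_functor \<epsilon>
  for C :: "('o, 'm) category" and D :: "('p, 'n) category"
    and L :: "('o, 'm, 'p, 'n) functor_data" and R :: "('p, 'n, 'o, 'm) functor_data"
    and \<eta> :: "'o \<Rightarrow> 'm" and \<epsilon> :: "'p \<Rightarrow> 'n" +
  assumes triangle_left: "X \<in> Ob C \<Longrightarrow>
      Comp D (omap L X) (omap L (omap R (omap L X))) (omap L X)
        (\<epsilon> (omap L X)) (amap L X (omap R (omap L X)) (\<eta> X)) = Ident D (omap L X)"
    and triangle_right: "A \<in> Ob D \<Longrightarrow>
      Comp C (omap R A) (omap R (omap L (omap R A))) (omap R A)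
        (amap R (omap L (omap R A)) A (\<epsilon> A)) (\<eta> (omap R A)) = Ident C (omap R A)"

definition adjunction_mult ::
    "('o, 'm, 'p, 'n) functor_data \<Rightarrow> ('p, 'n, 'o, 'm) functor_data \<Rightarrow> ('p \<Rightarrow> 'n) \<Rightarrow> 'o \<Rightarrow> 'm" where
  "adjunction_mult L R \<epsilon> X = amap R (omap L (omap R (omap L X))) (omap L X) (\<epsilon> (omap L X))"

definition monad_algebras ::
    "('o, 'm) category \<Rightarrow> ('o, 'm, 'o, 'm) functor_data \<Rightarrow> ('o \<Rightarrow> 'm) \<Rightarrow> ('o \<Rightarrow> 'm) \<Rightarrow> ('o \<times> 'm) set"
  where
  "monad_algebras C T \<eta> \<mu> = {(A, h). A \<in> Ob C \<and> h \<in> Hom C (omap T A) A \<and>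
     Comp C A (omap T A) A h (\<eta> A) = Ident C A \<and>
     Comp C (omap T (omap T A)) (omap T A) A h (\<mu> A)
       = Comp C (omap T (omap T A)) (omap T A) A h (amap T (omap T A) A h)}"

definition algebra_category ::
    "('o, 'm) category \<Rightarrow> ('o, 'm, 'o, 'm) functor_data \<Rightarrow> ('o \<Rightarrow> 'm) \<Rightarrow> ('o \<Rightarrow> 'm)
      \<Rightarrow> ('o \<times> 'm, 'm) category" where
  "algebra_category C T \<eta> \<mu> =
    \<lparr>Ob = monad_algebras C T \<eta> \<mu>,
     Hom = (\<lambda>(A, h) (B, k). {f \<in> Hom C A B.
       Comp C (omap T A) A B f h = Comp C (omap T A) (omap T B) B k (amap T A B f)}),
     Ident = (\<lambda>(A, h). Ident C A),
     Comp = (\<lambda>(A, h) (B, k) (D, l). Comp C A B D)\<rparr>"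


section \<open>Globular sets, omega graphs, omega magmas\<close>

text \<open>
  A small set is a subset of the type \<open>'u\<close>. All structure maps are extensional, that is
  \<open>undefined\<close> outside of their domain, so that equality of records and of families of maps is
  equality of the mathematical objects.

  \<open>dm X i\<close> and \<open>cd X i\<close> are the maps \<open>dom, cod : X\<^bsub>i+1\<^esub> \<rightarrow> X\<^bsub>i\<^esub>\<close>, \<open>idt X i\<close> is
  \<open>id : X\<^bsub>i\<^esub> \<rightarrow> X\<^bsub>i+1\<^esub>\<close>, and \<open>cmp X i j a b\<close> is the composite, in diagrammatic order, of the
  \<open>j\<close>-cells \<open>a\<close>, \<open>b\<close> along \<open>i\<close>-cells.
\<close>

record 'u globular_set =
  cells :: "nat \<Rightarrow> 'u set"
  dm :: "nat \<Rightarrow> 'u \<Rightarrow> 'u"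
  cd :: "nat \<Rightarrow> 'u \<Rightarrow> 'u"

record 'u omega_graph = "'u globular_set" +
  idt :: "nat \<Rightarrow> 'u \<Rightarrow> 'u"

record 'u omega_magma = "'u omega_graph" +
  cmp :: "nat \<Rightarrow> nat \<Rightarrow> 'u \<Rightarrow> 'u \<Rightarrow> 'u"

record 'u bridge_magma = "'u omega_magma" +
  bridge :: "nat \<Rightarrow> ('u \<times> 'u \<times> 'u) set"

text \<open>The iterated maps from dimension \<open>j\<close> down to \<open>i \<le> j\<close>, and from \<open>i\<close> up to \<open>j \<ge> i\<close>.\<close>

primrec dom_iter :: "('u, 'z) globular_set_scheme \<Rightarrow> nat \<Rightarrow> nat \<Rightarrow> 'u \<Rightarrow> 'u" where
  "dom_iter X i 0 a = a"
| "dom_iter X i (Suc j) a = (if i \<le> j then dom_iter X i j (dm X j a) else a)"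

primrec cod_iter :: "('u, 'z) globular_set_scheme \<Rightarrow> nat \<Rightarrow> nat \<Rightarrow> 'u \<Rightarrow> 'u" where
  "cod_iter X i 0 a = a"
| "cod_iter X i (Suc j) a = (if i \<le> j then cod_iter X i j (cd X j a) else a)"

primrec id_iter :: "('u, 'z) omega_graph_scheme \<Rightarrow> nat \<Rightarrow> nat \<Rightarrow> 'u \<Rightarrow> 'u" where
  "id_iter X i 0 a = a"
| "id_iter X i (Suc j) a = (if i \<le> j then idt X j (id_iter X i j a) else a)"

locale globular_set =
  fixes X :: "('u, 'z) globular_set_scheme"
  assumes dm_fun: "dm X i \<in> cells X (Suc i) \<rightarrow>\<^sub>E cells X i"
    and cd_fun: "cd X i \<in> cells X (Suc i) \<rightarrow>\<^sub>E cells X i"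
    and dm_globular: "a \<in> cells X (Suc (Suc i)) \<Longrightarrow> dm X i (dm X (Suc i) a) = dm X i (cd X (Suc i) a)"
    and cd_globular: "a \<in> cells X (Suc (Suc i)) \<Longrightarrow> cd X i (dm X (Suc i) a) = cd X i (cd X (Suc i) a)"

locale omega_graph = globular_set X
  for X :: "('u, 'z) omega_graph_scheme" +
  assumes idt_fun: "idt X i \<in> cells X i \<rightarrow>\<^sub>E cells X (Suc i)"
    and dm_idt: "a \<in> cells X i \<Longrightarrow> dm X i (idt X i a) = a"
    and cd_idt: "a \<in> cells X i \<Longrightarrow> cd X i (idt X i a) = a"

definition composable :: "('u, 'z) globular_set_scheme \<Rightarrow> nat \<Rightarrow> nat \<Rightarrow> 'u \<Rightarrow> 'u \<Rightarrow> bool" where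
  "composable X i j a b \<longleftrightarrow>
    i < j \<and> a \<in> cells X j \<and> b \<in> cells X j \<and> cod_iter X i j a = dom_iter X i j b"

locale omega_magma = omega_graph X
  for X :: "('u, 'z) omega_magma_scheme" +
  assumes cmp_in: "composable X i j a b \<Longrightarrow> cmp X i j a b \<in> cells X j"
    and cmp_undefined: "\<not> composable X i j a b \<Longrightarrow> cmp X i j a b = undefined"
    and dm_cmp_eq: "composable X i (Suc i) a b \<Longrightarrow> dm X i (cmp X i (Suc i) a b) = dm X i a"
    and cd_cmp_eq: "composable X i (Suc i) a b \<Longrightarrow> cd X i (cmp X i (Suc i) a b) = cd X i b"
    and dm_cmp_less: "\<lbrakk>i < j; composable X i (Suc j) a b\<rbrakk>
      \<Longrightarrow> dm X j (cmp X i (Suc j) a b) = cmp X i j (dm X j a) (dm X j b)"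
    and cd_cmp_less: "\<lbrakk>i < j; composable X i (Suc j) a b\<rbrakk>
      \<Longrightarrow> cd X j (cmp X i (Suc j) a b) = cmp X i j (cd X j a) (cd X j b)"

locale strict_omega_category = omega_magma X
  for X :: "('u, 'z) omega_magma_scheme" +
  assumes cmp_assoc: "\<lbrakk>composable X i j a b; composable X i j (cmp X i j a b) c;
        composable X i j b c; composable X i j a (cmp X i j b c)\<rbrakk>
      \<Longrightarrow> cmp X i j (cmp X i j a b) c = cmp X i j a (cmp X i j b c)"
    and interchange: "\<lbrakk>i < j; j < k;
        composable X j k a b; composable X j k c d;
        composable X i k (cmp X j k a b) (cmp X j k c d);
        composable X i k a c; composable X i k b d;
        composable X j k (cmp X i k a c) (cmp X i k b d)\<rbrakk>
      \<Longrightarrow> cmp X i k (cmp X j k a b) (cmp X j k c d) = cmp X j k (cmp X i k a c) (cmp X i k b d)"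
    and unit_left: "\<lbrakk>i < j; a \<in> cells X j\<rbrakk> \<Longrightarrow> cmp X i j (id_iter X i j (dom_iter X i j a)) a = a"
    and unit_right: "\<lbrakk>i < j; a \<in> cells X j\<rbrakk> \<Longrightarrow> cmp X i j a (id_iter X i j (cod_iter X i j a)) = a"
    and cmp_idt: "composable X i j a b
      \<Longrightarrow> cmp X i (Suc j) (idt X j a) (idt X j b) = idt X j (cmp X i j a b)"


section \<open>Morphisms\<close>

type_synonym 'u cell_map = "nat \<Rightarrow> 'u \<Rightarrow> 'u"

definition fam_id :: "('u, 'z) globular_set_scheme \<Rightarrow> 'u cell_map" where
  "fam_id X = (\<lambda>i. \<lambda>a\<in>cells X i. a)"

definition fam_comp :: "('u, 'z) globular_set_scheme \<Rightarrow> 'u cell_map \<Rightarrow> 'u cell_map \<Rightarrow> 'u cell_map" where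
  "fam_comp X G F = (\<lambda>i. compose (cells X i) (G i) (F i))"

definition globular_hom ::
    "('u, 'y) globular_set_scheme \<Rightarrow> ('u, 'z) globular_set_scheme \<Rightarrow> 'u cell_map set" where
  "globular_hom X Y = {F.
    (\<forall>i. F i \<in> cells X i \<rightarrow>\<^sub>E cells Y i) \<and>
    (\<forall>i. \<forall>a\<in>cells X (Suc i). F i (dm X i a) = dm Y i (F (Suc i) a)) \<and>
    (\<forall>i. \<forall>a\<in>cells X (Suc i). F i (cd X i a) = cd Y i (F (Suc i) a))}"

definition graph_hom ::
    "('u, 'y) omega_graph_scheme \<Rightarrow> ('u, 'z) omega_graph_scheme \<Rightarrow> 'u cell_map set" where
  "graph_hom X Y = {F \<in> globular_hom X Y.
    \<forall>i. \<forall>a\<in>cells X i. F (Suc i) (idt X i a) = idt Y i (F i a)}"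

definition magma_hom ::
    "('u, 'y) omega_magma_scheme \<Rightarrow> ('u, 'z) omega_magma_scheme \<Rightarrow> 'u cell_map set" where
  "magma_hom X Y = {F \<in> graph_hom X Y.
    \<forall>i j a b. composable X i j a b \<longrightarrow> F j (cmp X i j a b) = cmp Y i j (F j a) (F j b)}"

definition underlying_graph :: "('u, 'z) omega_graph_scheme \<Rightarrow> 'u omega_graph" where
  "underlying_graph X = omega_graph.truncate X"

definition Omega_Graph :: "('u omega_graph, 'u cell_map) category" where
  "Omega_Graph =
    \<lparr>Ob = {X. omega_graph X}, Hom = graph_hom, Ident = fam_id, Comp = (\<lambda>X Y Z. fam_comp X)\<rparr>"


section \<open>Bridge relations and categorical Penon morphisms\<close>

definition parallel :: "('u, 'z) globular_set_scheme \<Rightarrow> nat \<Rightarrow> 'u \<Rightarrow> 'u \<Rightarrow> bool" where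
  "parallel X i a b \<longleftrightarrow> a \<in> cells X i \<and> b \<in> cells X i \<and>
    (case i of 0 \<Rightarrow> True | Suc k \<Rightarrow> dm X k a = dm X k b \<and> cd X k a = cd X k b)"

definition bridge_relation ::
    "('u, 'z) omega_graph_scheme \<Rightarrow> (nat \<Rightarrow> ('u \<times> 'u \<times> 'u) set) \<Rightarrow> bool" where
  "bridge_relation X R \<longleftrightarrow>
    (\<forall>i. R i \<subseteq> cells X i \<times> cells X i \<times> cells X (Suc i)) \<and>
    (\<forall>i a b c. (a, b, c) \<in> R i \<longrightarrow> parallel X i a b \<and> dm X i c = a \<and> cd X i c = b) \<and>
    (\<forall>i. \<forall>a\<in>cells X i. (a, a, idt X i a) \<in> R i) \<and>
    (\<forall>i a b c d. (a, b, c) \<in> R i \<longrightarrow> (a, b, d) \<in> R i \<longrightarrow> c = d)"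

definition diagonal_bridge :: "('u, 'z) omega_graph_scheme \<Rightarrow> nat \<Rightarrow> ('u \<times> 'u \<times> 'u) set" where
  "diagonal_bridge X i = {(a, a, idt X i a) | a. a \<in> cells X i}"

locale bridge_magma = omega_magma X
  for X :: "('u, 'z) bridge_magma_scheme" +
  assumes bridge_rel: "bridge_relation X (bridge X)"

definition bridge_hom ::
    "('u, 'y) bridge_magma_scheme \<Rightarrow> ('u, 'z) bridge_magma_scheme \<Rightarrow> 'u cell_map set" where
  "bridge_hom X Y = {F \<in> magma_hom X Y.
    \<forall>i a b c. (a, b, c) \<in> bridge X i \<longrightarrow> (F i a, F i b, F (Suc i) c) \<in> bridge Y i}"

record 'u penon_morphism =
  pen_dom :: "'u bridge_magma"
  pen_cod :: "'u bridge_magma"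
  pen_map :: "'u cell_map"

locale categorical_penon_morphism =
  dom: bridge_magma "pen_dom P" + cod: strict_omega_category "pen_cod P"
  for P :: "'u penon_morphism" +
  assumes cod_bridge: "bridge (pen_cod P) = diagonal_bridge (pen_cod P)"
    and map_hom: "pen_map P \<in> bridge_hom (pen_dom P) (pen_cod P)"
    and map_bridge: "(a, b, c) \<in> bridge (pen_dom P) i \<Longrightarrow>
      pen_map P i a = pen_map P i b \<and> pen_map P (Suc i) c = idt (pen_cod P) i (pen_map P i a)"
    and bridge_exists: "\<lbrakk>parallel (pen_dom P) i a b; pen_map P i a = pen_map P i b\<rbrakk>
      \<Longrightarrow> \<exists>c. (a, b, c) \<in> bridge (pen_dom P) i"

definition Pen_Mor :: "('u penon_morphism, 'u cell_map \<times> 'u cell_map) category" where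
  "Pen_Mor =
    \<lparr>Ob = {P. categorical_penon_morphism P},
     Hom = (\<lambda>P Q. {(F, G). F \<in> bridge_hom (pen_dom P) (pen_dom Q) \<and>
        G \<in> bridge_hom (pen_cod P) (pen_cod Q) \<and>
        fam_comp (pen_dom P) G (pen_map P) = fam_comp (pen_dom P) (pen_map Q) F}),
     Ident = (\<lambda>P. (fam_id (pen_dom P), fam_id (pen_cod P))),
     Comp = (\<lambda>P Q S (F', G') (F, G). (fam_comp (pen_dom P) F' F, fam_comp (pen_cod P) G' G))\<rparr>"

definition U_GP ::
    "('u penon_morphism, 'u cell_map \<times> 'u cell_map, 'u omega_graph, 'u cell_map) functor_data" where
  "U_GP = \<lparr>omap = (\<lambda>P. underlying_graph (pen_dom P)), amap = (\<lambda>P Q (F, G). F)\<rparr>"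


section \<open>Weak omega categories\<close>

text \<open>
  The data \<open>X\<^sub>2\<close>, \<open>R\<^sup>X\<close>, \<open>X\<^sub>3\<close>, \<open>\<kappa>\<^sup>X\<close> are bundled in \<open>kappa\<close>: the magma \<open>X\<^sub>2\<close> with
  its bridge relation is \<open>pen_dom (kappa X)\<close>, and \<open>X\<^sub>3\<close> with \<open>R\<^sup>\<Delta>\<close> is \<open>pen_cod (kappa X)\<close>.
\<close>

record 'u weak_omega_category =
  magma1 :: "'u omega_magma"
  lam :: "'u cell_map"
  rho :: "'u cell_map"
  kappa :: "'u penon_morphism"

abbreviation magma2 :: "'u weak_omega_category \<Rightarrow> 'u bridge_magma" where
  "magma2 X \<equiv> pen_dom (kappa X)"

abbreviation magma3 :: "'u weak_omega_category \<Rightarrow> 'u bridge_magma" where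
  "magma3 X \<equiv> pen_cod (kappa X)"

locale weak_omega_category =
  magma1: omega_magma "magma1 X" + kappa: categorical_penon_morphism "kappa X"
  for X :: "'u weak_omega_category" +
  assumes lam_hom: "lam X \<in> magma_hom (magma2 X) (magma1 X)"
    and rho_hom: "rho X \<in> graph_hom (magma1 X) (magma2 X)"
    and lam_rho: "fam_comp (magma1 X) (lam X) (rho X) = fam_id (magma1 X)"

definition Omega_Cat ::
    "('u weak_omega_category, 'u cell_map \<times> 'u cell_map \<times> 'u cell_map) category" where
  "Omega_Cat =
    \<lparr>Ob = {X. weak_omega_category X},
     Hom = (\<lambda>X Y. {(F1, F2, F3).
        F1 \<in> magma_hom (magma1 X) (magma1 Y) \<and>
        F2 \<in> bridge_hom (magma2 X) (magma2 Y) \<and>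
        F3 \<in> magma_hom (magma3 X) (magma3 Y) \<and>
        fam_comp (magma2 X) F1 (lam X) = fam_comp (magma2 X) (lam Y) F2 \<and>
        fam_comp (magma2 X) F3 (pen_map (kappa X)) = fam_comp (magma2 X) (pen_map (kappa Y)) F2 \<and>
        fam_comp (magma1 X) F2 (rho X) = fam_comp (magma1 X) (rho Y) F1}),
     Ident = (\<lambda>X. (fam_id (magma1 X), fam_id (magma2 X), fam_id (magma3 X))),
     Comp = (\<lambda>X Y Z (G1, G2, G3) (F1, F2, F3).
        (fam_comp (magma1 X) G1 F1, fam_comp (magma2 X) G2 F2, fam_comp (magma3 X) G3 F3))\<rparr>"


section \<open>Prolixes and Penon's weak omega categories\<close>

text \<open>
  A left adjoint is determined only up to isomorphism, so the chosen left adjoint \<open>L\<close> of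
  \<open>U_GP\<close>, with unit \<open>\<eta>\<close> and counit \<open>\<epsilon>\<close>, is a parameter. Both definitions depend on
  the choice: \<open>Pen_Omega_Cat\<close> asks for \<open>kappa X\<close> to be equal, not just isomorphic, to the
  value of \<open>L\<close>.
\<close>

type_synonym 'u free_penon_functor =
  "('u omega_graph, 'u cell_map, 'u penon_morphism, 'u cell_map \<times> 'u cell_map) functor_data"

definition Prolixe ::
    "'u free_penon_functor \<Rightarrow> ('u omega_graph \<Rightarrow> 'u cell_map)
      \<Rightarrow> ('u penon_morphism \<Rightarrow> 'u cell_map \<times> 'u cell_map)
      \<Rightarrow> ('u omega_graph \<times> 'u cell_map, 'u cell_map) category" where
  "Prolixe L \<eta> \<epsilon> = algebra_category Omega_Graph (comp_functor U_GP L) \<eta> (adjunction_mult L U_GP \<epsilon>)"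

definition Pen_Omega_Cat ::
    "'u free_penon_functor \<Rightarrow> ('u omega_graph \<Rightarrow> 'u cell_map)
      \<Rightarrow> ('u weak_omega_category, 'u cell_map \<times> 'u cell_map \<times> 'u cell_map) category" where
  "Pen_Omega_Cat L \<eta> = full_subcategory Omega_Cat
    {X. kappa X = omap L (underlying_graph (magma1 X)) \<and> rho X = \<eta> (underlying_graph (magma1 X))}"


section \<open>The categories and the forgetful functor are well defined\<close>

lemma underlying_graph_simps [simp]:
  "cells (underlying_graph X) = cells X" "dm (underlying_graph X) = dm X"
  "cd (underlying_graph X) = cd X" "idt (underlying_graph X) = idt X"
  by (simp_all add: underlying_graph_def omega_graph.truncate_def)

lemma underlying_graph_omega_graph:
  assumes "omega_graph X" shows "omega_graph (underlying_graph X)"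
  using assms
  by (simp add: omega_graph_def omega_graph_axioms_def globular_set_def)

lemma graph_hom_underlying [simp]:
  "graph_hom (underlying_graph X) (underlying_graph Y) = graph_hom X Y"
  by (simp add: graph_hom_def globular_hom_def)

lemma fam_underlying [simp]:
  "fam_comp (underlying_graph X) = fam_comp X" "fam_id (underlying_graph X) = fam_id X"
  by (simp_all add: fam_comp_def fam_id_def fun_eq_iff)

lemma globular_homD:
  assumes "F \<in> globular_hom X Y"
  shows "F i \<in> cells X i \<rightarrow>\<^sub>E cells Y i"
    and "a \<in> cells X i \<Longrightarrow> F i a \<in> cells Y i"
    and "a \<notin> cells X i \<Longrightarrow> F i a = undefined"
    and "a \<in> cells X (Suc i) \<Longrightarrow> F i (dm X i a) = dm Y i (F (Suc i) a)"
    and "a \<in> cells X (Suc i) \<Longrightarrow> F i (cd X i a) = cd Y i (F (Suc i) a)"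
  using assms by (auto simp: globular_hom_def PiE_iff extensional_def)

lemma graph_hom_globular: "F \<in> graph_hom X Y \<Longrightarrow> F \<in> globular_hom X Y"
  by (simp add: graph_hom_def)

lemma magma_hom_graph: "F \<in> magma_hom X Y \<Longrightarrow> F \<in> graph_hom X Y"
  by (simp add: magma_hom_def)

lemma bridge_hom_magma: "F \<in> bridge_hom X Y \<Longrightarrow> F \<in> magma_hom X Y"
  by (simp add: bridge_hom_def)

lemmas hom_globular = graph_hom_globular graph_hom_globular[OF magma_hom_graph]
  graph_hom_globular[OF magma_hom_graph[OF bridge_hom_magma]]

lemma fam_comp_apply [simp]: "a \<in> cells X i \<Longrightarrow> fam_comp X G F i a = G i (F i a)"
  by (simp add: fam_comp_def compose_def)

lemma fam_id_apply [simp]: "a \<in> cells X i \<Longrightarrow> fam_id X i a = a"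
  by (simp add: fam_id_def)

lemma fam_comp_id_left: "F \<in> globular_hom X Y \<Longrightarrow> fam_comp X (fam_id Y) F = F"
  by (rule ext, rule ext) (simp add: fam_comp_def fam_id_def compose_def globular_homD(2,3))

lemma fam_comp_id_right: "F \<in> globular_hom X Y \<Longrightarrow> fam_comp X F (fam_id X) = F"
  by (rule ext, rule ext) (simp add: fam_comp_def fam_id_def compose_def globular_homD(2,3))

lemma fam_comp_assoc:
  "F \<in> globular_hom W X \<Longrightarrow>
    fam_comp W H (fam_comp W G F) = fam_comp W (fam_comp X H G) F"
  by (rule ext, rule ext) (simp add: fam_comp_def compose_def globular_homD(2)[of F W X])

lemma (in globular_set) dm_in: "a \<in> cells X (Suc i) \<Longrightarrow> dm X i a \<in> cells X i"
  using dm_fun by blast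

lemma (in globular_set) cd_in: "a \<in> cells X (Suc i) \<Longrightarrow> cd X i a \<in> cells X i"
  using cd_fun by blast

lemma (in omega_graph) idt_in: "a \<in> cells X i \<Longrightarrow> idt X i a \<in> cells X (Suc i)"
  using idt_fun by blast

lemma hom_iter:
  assumes X: "globular_set X" and F: "F \<in> globular_hom X Y" and a: "a \<in> cells X j" and "i \<le> j"
  shows "F i (dom_iter X i j a) = dom_iter Y i j (F j a)"
    and "F i (cod_iter X i j a) = cod_iter Y i j (F j a)"
  using a \<open>i \<le> j\<close>
proof (induction j arbitrary: a)
  case (Suc j)
  interpret globular_set X by (fact X)
  {
    case 1
    then show ?case using Suc.IH(1)[OF dm_in[OF 1(1)]] globular_homD(4)[OF F 1(1)]
      by (cases "i = Suc j") auto
  next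
    case 2
    then show ?case using Suc.IH(2)[OF cd_in[OF 2(1)]] globular_homD(5)[OF F 2(1)]
      by (cases "i = Suc j") auto
  }
qed auto

lemma hom_composable:
  assumes "globular_set X" "F \<in> globular_hom X Y" "composable X i j a b"
  shows "composable Y i j (F j a) (F j b)"
proof -
  have ab: "i < j" "a \<in> cells X j" "b \<in> cells X j" "cod_iter X i j a = dom_iter X i j b"
    using assms(3) by (simp_all add: composable_def)
  then have "cod_iter Y i j (F j a) = dom_iter Y i j (F j b)"
    using hom_iter[OF assms(1,2), of _ j i] by (metis less_imp_le)
  with ab show ?thesis
    by (simp add: composable_def globular_homD(2)[OF assms(2)])
qed

lemma globular_hom_id: "globular_set X \<Longrightarrow> fam_id X \<in> globular_hom X X"
  by (auto simp: globular_hom_def fam_id_def globular_set.dm_in globular_set.cd_in)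

lemma globular_hom_comp:
  assumes "globular_set X" "F \<in> globular_hom X Y" "G \<in> globular_hom Y Z"
  shows "fam_comp X G F \<in> globular_hom X Z"
proof -
  interpret globular_set X by fact
  note F = globular_homD[OF assms(2)] and G = globular_homD[OF assms(3)]
  have "fam_comp X G F i \<in> cells X i \<rightarrow>\<^sub>E cells Z i" for i
    by (simp add: fam_comp_def compose_def F(2) G(2))
  then show ?thesis
    by (simp add: globular_hom_def[of X Z] dm_in cd_in F(2,4,5) G(4,5))
qed

lemma graph_hom_id: "omega_graph X \<Longrightarrow> fam_id X \<in> graph_hom X X"
  by (simp add: graph_hom_def globular_hom_id omega_graph.axioms(1) omega_graph.idt_in)

lemma graph_hom_comp:
  assumes "omega_graph X" "F \<in> graph_hom X Y" "G \<in> graph_hom Y Z"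
  shows "fam_comp X G F \<in> graph_hom X Z"
proof -
  interpret omega_graph X by fact
  have "fam_comp X G F \<in> globular_hom X Z"
    by (rule globular_hom_comp[OF globular_set_axioms graph_hom_globular[OF assms(2)]
          graph_hom_globular[OF assms(3)]])
  then show ?thesis
    using assms globular_homD(2)[OF graph_hom_globular[OF assms(2)]]
    by (simp add: graph_hom_def idt_in)
qed

lemma composable_in:
  "composable X i j a b \<Longrightarrow> a \<in> cells X j" "composable X i j a b \<Longrightarrow> b \<in> cells X j"
  by (simp_all add: composable_def)

lemma magma_hom_id:
  assumes "omega_magma X" shows "fam_id X \<in> magma_hom X X"
proof -
  interpret omega_magma X by fact
  have "fam_id X j (cmp X i j a b) = cmp X i j (fam_id X j a) (fam_id X j b)"
    if ab: "composable X i j a b" for i j a b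
    using cmp_in[OF ab] composable_in[OF ab] by simp
  then show ?thesis
    using graph_hom_id[OF omega_graph_axioms] by (simp add: magma_hom_def)
qed

lemma magma_hom_comp:
  assumes X: "omega_magma X" and F: "F \<in> magma_hom X Y" and G: "G \<in> magma_hom Y Z"
  shows "fam_comp X G F \<in> magma_hom X Z"
proof -
  interpret omega_magma X by fact
  have "fam_comp X G F \<in> graph_hom X Z"
    by (rule graph_hom_comp[OF omega_graph_axioms magma_hom_graph[OF F] magma_hom_graph[OF G]])
  moreover have "fam_comp X G F j (cmp X i j a b)
      = cmp Z i j (fam_comp X G F j a) (fam_comp X G F j b)" if ab: "composable X i j a b" for i j a b
  proof -
    have "composable Y i j (F j a) (F j b)"
      using hom_composable[OF globular_set_axioms hom_globular(2)[OF F] ab] .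
    then show ?thesis
      using F G ab cmp_in[OF ab] composable_in[OF ab] by (simp add: magma_hom_def)
  qed
  ultimately show ?thesis by (simp add: magma_hom_def)
qed

lemma bridge_cells:
  assumes "bridge_magma X" "(a, b, c) \<in> bridge X i"
  shows "a \<in> cells X i" "b \<in> cells X i" "c \<in> cells X (Suc i)"
  using assms bridge_magma.bridge_rel[OF assms(1)] unfolding bridge_relation_def by blast+

lemma bridge_hom_id:
  assumes "bridge_magma X" shows "fam_id X \<in> bridge_hom X X"
proof -
  have "(fam_id X i a, fam_id X i b, fam_id X (Suc i) c) \<in> bridge X i"
    if abc: "(a, b, c) \<in> bridge X i" for i a b c
    using abc bridge_cells[OF assms abc] by simp
  then show ?thesis
    using magma_hom_id[OF bridge_magma.axioms(1)[OF assms]] by (simp add: bridge_hom_def)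
qed

lemma bridge_hom_comp:
  assumes X: "bridge_magma X" and F: "F \<in> bridge_hom X Y" and G: "G \<in> bridge_hom Y Z"
  shows "fam_comp X G F \<in> bridge_hom X Z"
proof -
  have "(fam_comp X G F i a, fam_comp X G F i b, fam_comp X G F (Suc i) c) \<in> bridge Z i"
    if abc: "(a, b, c) \<in> bridge X i" for i a b c
    using F G abc bridge_cells[OF X abc] by (simp add: bridge_hom_def)
  then show ?thesis
    using magma_hom_comp[OF bridge_magma.axioms(1)[OF X] bridge_hom_magma[OF F] bridge_hom_magma[OF G]]
    by (simp add: bridge_hom_def)
qed

lemma diagonal_bridge_relation: "omega_graph X \<Longrightarrow> bridge_relation X (diagonal_bridge X)"
  by (auto simp: bridge_relation_def diagonal_bridge_def parallel_def omega_graph.idt_in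
      omega_graph.dm_idt omega_graph.cd_idt split: nat.split)

lemma categorical_penon_morphism_cod:
  assumes "categorical_penon_morphism P" shows "bridge_magma (pen_cod P)"
proof -
  interpret categorical_penon_morphism P by fact
  show ?thesis
    by unfold_locales (simp add: cod_bridge diagonal_bridge_relation cod.omega_graph_axioms)
qed

lemma category_Omega_Graph: "category Omega_Graph"
  by unfold_locales
    (auto simp: Omega_Graph_def graph_hom_id graph_hom_comp fam_comp_id_left
      intro!: fam_comp_id_left fam_comp_id_right fam_comp_assoc dest: graph_hom_globular)

lemma category_Pen_Mor: "category (Pen_Mor :: ('u penon_morphism, _) category)"
proof
  fix P Q S :: "'u penon_morphism"
  fix f g
  assume P: "P \<in> Ob Pen_Mor"
  interpret P: categorical_penon_morphism P using P by (simp add: Pen_Mor_def)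
  note Pd = P.dom.bridge_magma_axioms
  note Pc = categorical_penon_morphism_cod[OF P.categorical_penon_morphism_axioms]
  note Pm = hom_globular(3)[OF P.map_hom]
  show "Ident Pen_Mor P \<in> Hom Pen_Mor P P"
    using fam_comp_id_left[OF Pm] fam_comp_id_right[OF Pm]
    by (simp add: Pen_Mor_def bridge_hom_id[OF Pd] bridge_hom_id[OF Pc])
  assume f: "f \<in> Hom Pen_Mor P Q"
  obtain F F' where fF: "f = (F, F')" by (cases f)
  have F: "F \<in> bridge_hom (pen_dom P) (pen_dom Q)" "F' \<in> bridge_hom (pen_cod P) (pen_cod Q)"
    "fam_comp (pen_dom P) F' (pen_map P) = fam_comp (pen_dom P) (pen_map Q) F"
    using f by (auto simp: Pen_Mor_def fF)
  show "Comp Pen_Mor P Q Q (Ident Pen_Mor Q) f = f" "Comp Pen_Mor P P Q f (Ident Pen_Mor P) = f"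
    using hom_globular(3)[OF F(1)] hom_globular(3)[OF F(2)]
    by (auto simp: Pen_Mor_def fF intro: fam_comp_id_left fam_comp_id_right)
  assume g: "g \<in> Hom Pen_Mor Q S"
  obtain G G' where gG: "g = (G, G')" by (cases g)
  have G: "G \<in> bridge_hom (pen_dom Q) (pen_dom S)" "G' \<in> bridge_hom (pen_cod Q) (pen_cod S)"
    "fam_comp (pen_dom Q) G' (pen_map Q) = fam_comp (pen_dom Q) (pen_map S) G"
    using g by (auto simp: Pen_Mor_def gG)
  have "fam_comp (pen_dom P) (fam_comp (pen_cod P) G' F') (pen_map P)
      = fam_comp (pen_dom P) G' (fam_comp (pen_dom P) (pen_map Q) F)"
    by (simp add: fam_comp_assoc[OF Pm] F(3)[symmetric])
  also have "\<dots> = fam_comp (pen_dom P) (pen_map S) (fam_comp (pen_dom P) G F)"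
    by (simp add: fam_comp_assoc[OF hom_globular(3)[OF F(1)]] G(3))
  finally show "Comp Pen_Mor P Q S g f \<in> Hom Pen_Mor P S"
    using F G by (simp add: Pen_Mor_def fF gG bridge_hom_comp[OF Pd] bridge_hom_comp[OF Pc])
next
  fix P Q S T :: "'u penon_morphism"
  fix f g h :: "'u cell_map \<times> 'u cell_map"
  assume f: "f \<in> Hom Pen_Mor P Q"
  obtain F F' G G' H H' where eqs: "f = (F, F')" "g = (G, G')" "h = (H, H')"
    by (cases f, cases g, cases h)
  have F: "F \<in> bridge_hom (pen_dom P) (pen_dom Q)" "F' \<in> bridge_hom (pen_cod P) (pen_cod Q)"
    using f by (auto simp: Pen_Mor_def eqs)
  show "Comp Pen_Mor P S T h (Comp Pen_Mor P Q S g f)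
      = Comp Pen_Mor P Q T (Comp Pen_Mor Q S T h g) f"
    by (simp add: Pen_Mor_def eqs fam_comp_assoc[OF hom_globular(3)[OF F(1)]]
        fam_comp_assoc[OF hom_globular(3)[OF F(2)]])
qed

lemma cat_functor_U_GP: "cat_functor Pen_Mor Omega_Graph U_GP"
proof -
  interpret D: category Pen_Mor by (rule category_Pen_Mor)
  interpret C: category Omega_Graph by (rule category_Omega_Graph)
  show ?thesis
  proof
    fix P :: "'a penon_morphism"
    assume "P \<in> Ob Pen_Mor"
    then interpret categorical_penon_morphism P by (simp add: Pen_Mor_def)
    show "omap U_GP P \<in> Ob Omega_Graph"
      by (simp add: U_GP_def Omega_Graph_def underlying_graph_omega_graph dom.omega_graph_axioms)
  qed (auto simp: U_GP_def Omega_Graph_def Pen_Mor_def bridge_hom_magma magma_hom_graph)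
qed

lemma category_Omega_Cat: "category (Omega_Cat :: ('u weak_omega_category, _) category)"
proof
  fix X Y Z :: "'u weak_omega_category"
  fix f g
  assume X: "X \<in> Ob Omega_Cat"
  interpret X: weak_omega_category X using X by (simp add: Omega_Cat_def)
  note X1 = X.magma1.omega_magma_axioms
  note X2 = X.kappa.dom.bridge_magma_axioms
  note X3 = X.kappa.cod.omega_magma_axioms
  note l = hom_globular(2)[OF X.lam_hom]
  note r = hom_globular(1)[OF X.rho_hom]
  note k = hom_globular(3)[OF X.kappa.map_hom]
  show "Ident Omega_Cat X \<in> Hom Omega_Cat X X"
    using fam_comp_id_left[OF l] fam_comp_id_left[OF r] fam_comp_id_left[OF k]
      fam_comp_id_right[OF l] fam_comp_id_right[OF r] fam_comp_id_right[OF k]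
    by (simp add: Omega_Cat_def magma_hom_id[OF X1] bridge_hom_id[OF X2] magma_hom_id[OF X3])
  assume f: "f \<in> Hom Omega_Cat X Y"
  obtain F1 F2 F3 where fF: "f = (F1, F2, F3)" by (cases f)
  have F: "F1 \<in> magma_hom (magma1 X) (magma1 Y)" "F2 \<in> bridge_hom (magma2 X) (magma2 Y)"
    "F3 \<in> magma_hom (magma3 X) (magma3 Y)"
    "fam_comp (magma2 X) F1 (lam X) = fam_comp (magma2 X) (lam Y) F2"
    "fam_comp (magma2 X) F3 (pen_map (kappa X)) = fam_comp (magma2 X) (pen_map (kappa Y)) F2"
    "fam_comp (magma1 X) F2 (rho X) = fam_comp (magma1 X) (rho Y) F1"
    using f by (auto simp: Omega_Cat_def fF)
  note F' = hom_globular(2)[OF F(1)] hom_globular(3)[OF F(2)] hom_globular(2)[OF F(3)]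
  show "Comp Omega_Cat X Y Y (Ident Omega_Cat Y) f = f" "Comp Omega_Cat X X Y f (Ident Omega_Cat X) = f"
    using F' by (auto simp: Omega_Cat_def fF intro: fam_comp_id_left fam_comp_id_right)
  assume g: "g \<in> Hom Omega_Cat Y Z"
  obtain G1 G2 G3 where gG: "g = (G1, G2, G3)" by (cases g)
  have G: "G1 \<in> magma_hom (magma1 Y) (magma1 Z)" "G2 \<in> bridge_hom (magma2 Y) (magma2 Z)"
    "G3 \<in> magma_hom (magma3 Y) (magma3 Z)"
    "fam_comp (magma2 Y) G1 (lam Y) = fam_comp (magma2 Y) (lam Z) G2"
    "fam_comp (magma2 Y) G3 (pen_map (kappa Y)) = fam_comp (magma2 Y) (pen_map (kappa Z)) G2"
    "fam_comp (magma1 Y) G2 (rho Y) = fam_comp (magma1 Y) (rho Z) G1"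
    using g by (auto simp: Omega_Cat_def gG)
  have "fam_comp (magma2 X) (fam_comp (magma1 X) G1 F1) (lam X)
      = fam_comp (magma2 X) G1 (fam_comp (magma2 X) (lam Y) F2)"
    by (simp add: fam_comp_assoc[OF l] F(4)[symmetric])
  also have "\<dots> = fam_comp (magma2 X) (lam Z) (fam_comp (magma2 X) G2 F2)"
    by (simp add: fam_comp_assoc[OF F'(2)] G(4))
  finally have c1: "fam_comp (magma2 X) (fam_comp (magma1 X) G1 F1) (lam X)
      = fam_comp (magma2 X) (lam Z) (fam_comp (magma2 X) G2 F2)" .
  have "fam_comp (magma2 X) (fam_comp (magma3 X) G3 F3) (pen_map (kappa X))
      = fam_comp (magma2 X) G3 (fam_comp (magma2 X) (pen_map (kappa Y)) F2)"
    by (simp add: fam_comp_assoc[OF k] F(5)[symmetric])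
  also have "\<dots> = fam_comp (magma2 X) (pen_map (kappa Z)) (fam_comp (magma2 X) G2 F2)"
    by (simp add: fam_comp_assoc[OF F'(2)] G(5))
  finally have c2: "fam_comp (magma2 X) (fam_comp (magma3 X) G3 F3) (pen_map (kappa X))
      = fam_comp (magma2 X) (pen_map (kappa Z)) (fam_comp (magma2 X) G2 F2)" .
  have "fam_comp (magma1 X) (fam_comp (magma2 X) G2 F2) (rho X)
      = fam_comp (magma1 X) G2 (fam_comp (magma1 X) (rho Y) F1)"
    by (simp add: fam_comp_assoc[OF r] F(6)[symmetric])
  also have "\<dots> = fam_comp (magma1 X) (rho Z) (fam_comp (magma1 X) G1 F1)"
    by (simp add: fam_comp_assoc[OF F'(1)] G(6))
  finally have c3: "fam_comp (magma1 X) (fam_comp (magma2 X) G2 F2) (rho X)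
      = fam_comp (magma1 X) (rho Z) (fam_comp (magma1 X) G1 F1)" .
  show "Comp Omega_Cat X Y Z g f \<in> Hom Omega_Cat X Z"
    using F G c1 c2 c3
    by (simp add: Omega_Cat_def fF gG magma_hom_comp[OF X1] bridge_hom_comp[OF X2]
        magma_hom_comp[OF X3])
next
  fix W X Y Z :: "'u weak_omega_category"
  fix f g h :: "'u cell_map \<times> 'u cell_map \<times> 'u cell_map"
  assume f: "f \<in> Hom Omega_Cat W X"
  obtain F1 F2 F3 G1 G2 G3 H1 H2 H3
    where eqs: "f = (F1, F2, F3)" "g = (G1, G2, G3)" "h = (H1, H2, H3)"
    by (cases f, cases g, cases h)
  have F: "F1 \<in> magma_hom (magma1 W) (magma1 X)" "F2 \<in> bridge_hom (magma2 W) (magma2 X)"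
    "F3 \<in> magma_hom (magma3 W) (magma3 X)"
    using f by (auto simp: Omega_Cat_def eqs)
  show "Comp Omega_Cat W Y Z h (Comp Omega_Cat W X Y g f)
      = Comp Omega_Cat W X Z (Comp Omega_Cat X Y Z h g) f"
    by (simp add: Omega_Cat_def eqs fam_comp_assoc[OF hom_globular(2)[OF F(1)]]
        fam_comp_assoc[OF hom_globular(3)[OF F(2)]] fam_comp_assoc[OF hom_globular(2)[OF F(3)]])
qed

end

theory Submission
  imports Defs
begin

text \<open>
  The obvious candidate for \<open>U\<close>, sending \<open>X\<close> to \<open>\<lambda>\<^sup>X\<close> regarded as an algebra structure on the graph
  \<open>A\<close> underlying \<open>X\<^sub>1\<close>, is not available: \<open>\<lambda>\<^sup>X\<close> preserves the compositions and the unit, but its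
  values on the bridge cells of the free magma are not constrained by any associativity law. The
  prolixes are only a full subcategory of \<open>Pen_Omega_Cat\<close> (a prolixe \<open>(A, h)\<close> composes cells by
  \<open>a \<circ> b = h(\<eta> a \<circ> \<eta> b)\<close>, and \<open>\<lambda> = h\<close>), and \<open>U\<close> is a reflection onto it, chosen to be the identity
  on prolixes.

  The reflection of \<open>(A, h)\<close> is the colimit of a sequence \<open>A = A\<^sub>0 \<rightarrow> A\<^sub>1 \<rightarrow> \<dots>\<close>, in which
  \<open>A\<^bsub>n+1\<^esub>\<close> is the quotient of \<open>T A\<^sub>n\<close> that identifies cells with the same value in every algebra under
  \<open>(A, h)\<close>. The colimit is an algebra because each cell of \<open>T (colim A\<^sub>n)\<close> comes from some \<open>T A\<^sub>n\<close>;
  this in turn follows from the universal property of the free Penon morphism, once the colimit of the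
  sequence of free Penon morphisms is constructed. All cells must stay in the given type, which forces
  the colimits to be coded: their cells are codes of sequences that are eventually compatible, up to
  eventual equality.
\<close>

section \<open>Colimits of sequences of omega graphs and bridge magmas\<close>

text \<open>Up to coding, the reflection is the subalgebra generated by \<open>A\<close> in the
  product of all algebras under \<open>(A, h)\<close>. That product need not fit into the given
  type, so the subalgebra is approached from inside: every stage after \<open>A\<close> is the joint
  image of a free algebra, and its cells can be represented by cells of that free algebra. Since
  maps to algebras separate the cells of these stages, no congruence has to be generated: an
  equation in the colimit is checked in one algebra at a time, where it holds by hypothesis. Only
  the existence of the action needs another argument. A free cell over the colimit must come from a
  free cell over some stage, whose value is then available one stage later. The colimit of Penon
  morphisms is again one because each axiom concerns finitely many cells, hence holds at all late
  stages. The one existence axiom is harmless as well: bridges are unique, so bridges chosen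
  separately at each stage are automatically compatible.\<close>

definition thread :: "(nat \<Rightarrow> 'a set) \<Rightarrow> (nat \<Rightarrow> 'a \<Rightarrow> 'a) \<Rightarrow> (nat \<Rightarrow> 'a) \<Rightarrow> bool" where
  "thread S e x \<longleftrightarrow> (\<forall>\<^sub>F n in sequentially. x n \<in> S n \<and> x (Suc n) = e n (x n))"

abbreviation ev_eq :: "(nat \<Rightarrow> 'a) \<Rightarrow> (nat \<Rightarrow> 'a) \<Rightarrow> bool" where
  "ev_eq x y \<equiv> \<forall>\<^sub>F n in sequentially. x n = y n"

lemma ev_eq_sym: "ev_eq x y \<Longrightarrow> ev_eq y x"
  by (auto elim: eventually_mono)

lemma ev_eq_trans: "ev_eq x y \<Longrightarrow> ev_eq y z \<Longrightarrow> ev_eq x z"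
  by (auto elim: eventually_elim2)

lemma eventually_Suc: "(\<forall>\<^sub>F n in sequentially. P n) \<Longrightarrow> \<forall>\<^sub>F n in sequentially. P (Suc n)"
  by (simp add: eventually_sequentially_Suc)

lemma thread_ev_eq:
  assumes "thread S e x" "ev_eq x y" shows "thread S e y"
  using assms(1)[unfolded thread_def] assms(2) eventually_Suc[OF assms(2)] unfolding thread_def
  by eventually_elim auto

lemma thread_in: "thread S e x \<Longrightarrow> \<forall>\<^sub>F n in sequentially. x n \<in> S n"
  unfolding thread_def by (auto elim: eventually_mono)

text \<open>Once both sequences follow \<open>e\<close>, an agreement at a single stage propagates
  to all later ones. So for threads the alternative to eventual equality is eventual inequality,
  which lets finitely many classes be separated at one stage.\<close>

lemma threads_differ:
  assumes "thread S e x" "thread S e y" "\<not> ev_eq x y"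
  shows "\<forall>\<^sub>F n in sequentially. x n \<noteq> y n"
proof -
  obtain N where N: "\<And>n. n \<ge> N \<Longrightarrow> x (Suc n) = e n (x n) \<and> y (Suc n) = e n (y n)"
    using eventually_conj[OF assms(1,2)[unfolded thread_def]]
    by (auto simp: eventually_sequentially)
  have "x n \<noteq> y n" if "n \<ge> N" for n
  proof
    assume eq: "x n = y n"
    have "x m = y m" if "m \<ge> n" for m
      using that by (induction rule: dec_induct) (use eq N \<open>n \<ge> N\<close> in auto)
    then have "ev_eq x y" by (auto simp: eventually_sequentially)
    then show False using assms(3) by simp
  qed
  then show ?thesis by (auto simp: eventually_sequentially)
qed

text \<open>An infinite type contains a copy of \<open>nat\<close> and is equinumerous with its
  square.\<close>

lemma nat_pair_injection:
  assumes "infinite (UNIV :: 'a set)"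
  shows "\<exists>p :: nat \<times> 'a \<Rightarrow> 'a. inj p"
proof -
  obtain f :: "nat \<Rightarrow> 'a" where f: "inj f"
    using infinite_countable_subset[OF assms] by auto
  have "\<exists>g. bij_betw g ((UNIV :: 'a set) \<times> (UNIV :: 'a set)) (UNIV :: 'a set)"
    by (rule card_of_ordIso[THEN iffD2, OF card_of_Times_same_infinite[OF assms]])
  then obtain g :: "'a \<times> 'a \<Rightarrow> 'a" where g: "inj g"
    by (auto simp: bij_betw_def)
  have "inj (\<lambda>q. g (f (fst q), snd q))"
    by (rule injI) (auto dest!: injD[OF g] injD[OF f] simp: prod_eq_iff)
  then show ?thesis by - (rule exI)
qed

text \<open>For a finite type the threads of any finite number of classes are separated at a single stage,
  so there are at most as many classes as elements.\<close>

lemma exists_thread_code: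
  fixes S :: "nat \<Rightarrow> 'a set"
  shows "\<exists>c :: (nat \<Rightarrow> 'a) \<Rightarrow> 'a. \<forall>x y. thread S e x \<longrightarrow> thread S e y \<longrightarrow> (c x = c y \<longleftrightarrow> ev_eq x y)"
proof -
  \<comment> \<open>A canonical representative of each class modulo eventual equality; it then
    suffices to inject the set \<open>R\<close> of representatives of threads into the type.\<close>
  define r where "r x = (SOME y. ev_eq x y)" for x :: "nat \<Rightarrow> 'a"
  have r: "ev_eq x (r x)" for x
    unfolding r_def by (rule someI[of _ x]) simp
  have r_eq: "r x = r y \<longleftrightarrow> ev_eq x y" for x y
  proof
    assume "r x = r y"
    then show "ev_eq x y" using ev_eq_trans[OF r[of x] ev_eq_sym, of y] r[of y] by simp
  next
    assume xy: "ev_eq x y"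
    have "ev_eq x z \<longleftrightarrow> ev_eq y z" for z
      by (rule iffI; rule ev_eq_trans) (assumption | rule xy ev_eq_sym[OF xy])+
    then show "r x = r y" unfolding r_def by simp
  qed
  define R where "R = r ` {x. thread S e x}"
  have R_thread: "thread S e x" if x: "x \<in> R" for x
  proof -
    obtain y where "x = r y" "thread S e y" using x by (auto simp: R_def)
    then show ?thesis using thread_ev_eq[of S e y "r y"] r[of y] by simp
  qed
  have R_fix: "r x = x" if x: "x \<in> R" for x
  proof -
    obtain y where "x = r y" using x by (auto simp: R_def)
    then show ?thesis using r_eq[of "r y" y] ev_eq_sym[OF r[of y]] by simp
  qed
  have R_differ: "\<not> ev_eq x y" if xy: "x \<in> R" "y \<in> R" "x \<noteq> y" for x y
    using xy(3) R_fix[OF xy(1)] R_fix[OF xy(2)] r_eq[of x y] by simp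
  have separate: "\<exists>n. inj_on (\<lambda>x. x n) F" if F: "finite F" "F \<subseteq> R" for F
  proof -
    have "\<forall>\<^sub>F n in sequentially. \<forall>x\<in>F. \<forall>y\<in>F. x \<noteq> y \<longrightarrow> x n \<noteq> y n"
    proof (intro eventually_ball_finite F(1) ballI)
      fix x y assume "x \<in> F" "y \<in> F"
      then have xy: "x \<in> R" "y \<in> R" using F(2) by auto
      show "\<forall>\<^sub>F n in sequentially. x \<noteq> y \<longrightarrow> x n \<noteq> y n"
        using threads_differ[OF R_thread[OF xy(1)] R_thread[OF xy(2)]] R_differ[OF xy]
        by (cases "x = y") simp_all
    qed
    then obtain n where "\<forall>x\<in>F. \<forall>y\<in>F. x \<noteq> y \<longrightarrow> x n \<noteq> y n"
      by (auto dest: eventually_happens)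
    then show ?thesis by (auto simp: inj_on_def)
  qed
  obtain c :: "(nat \<Rightarrow> 'a) \<Rightarrow> 'a" where c: "inj_on c R"
  proof (cases "finite R")
    case True
    then show ?thesis using separate[of R] that by auto
  next
    case False
    \<comment> \<open>Otherwise finitely many representatives, one more than the type has elements,
      would take distinct values at a common stage.\<close>
    have "infinite (UNIV :: 'a set)"
    proof
      assume fin: "finite (UNIV :: 'a set)"
      obtain F where F: "F \<subseteq> R" "finite F" "card F = Suc (card (UNIV :: 'a set))"
        using infinite_arbitrarily_large[OF False] by blast
      obtain n where "inj_on (\<lambda>x. x n) F" using separate F by blast
      then have "card F \<le> card (UNIV :: 'a set)"
        using fin card_inj_on_le[of "\<lambda>x. x n" F UNIV] by auto
      then show False using F by simp
    qed
    then obtain p :: "nat \<times> 'a \<Rightarrow> 'a" where p: "inj p" using nat_pair_injection by blast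
    define s where "s x = (SOME N. \<forall>n\<ge>N. x (Suc n) = e n (x n))" for x
    have s: "x (Suc n) = e n (x n)" if "thread S e x" "n \<ge> s x" for x n
    proof -
      have "\<exists>N. \<forall>n\<ge>N. x (Suc n) = e n (x n)"
        using that(1) unfolding thread_def eventually_sequentially by blast
      then have "\<forall>n\<ge>s x. x (Suc n) = e n (x n)" unfolding s_def by (rule someI_ex)
      then show ?thesis using that(2) by blast
    qed
    \<comment> \<open>From stage \<open>s x\<close> on, a thread is determined by its value there,
      so the pair of \<open>s x\<close> and that value identifies the class.\<close>
    have "inj_on (\<lambda>x. p (s x, x (s x))) R"
    proof (rule inj_onI, rule ccontr)
      fix x y assume xy: "x \<in> R" "y \<in> R" "p (s x, x (s x)) = p (s y, y (s y))" "x \<noteq> y"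
      then have eq: "s x = s y" "x (s x) = y (s x)" using injD[OF p xy(3)] by auto
      have "x n = y n" if "n \<ge> s x" for n
        using that
      proof (induction rule: dec_induct)
        case (step n)
        then show ?case using s[OF R_thread[OF xy(1)], of n] s[OF R_thread[OF xy(2)], of n] eq by simp
      qed (rule eq(2))
      then have "ev_eq x y" by (auto simp: eventually_sequentially)
      then show False using R_differ xy by blast
    qed
    then show ?thesis using that by blast
  qed
  have "c (r x) = c (r y) \<longleftrightarrow> ev_eq x y" if xy: "thread S e x" "thread S e y" for x y
  proof -
    have "r x \<in> R" "r y \<in> R" using xy unfolding R_def by simp_all
    then show ?thesis using inj_on_eq_iff[OF c, of "r x" "r y"] r_eq[of x y] by simp
  qed
  then show ?thesis by (intro exI[of _ "\<lambda>x. c (r x)"]) blast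
qed

section \<open>Sequential colimits of omega graphs\<close>

locale graph_chain =
  fixes X :: "nat \<Rightarrow> ('u, 'z) omega_graph_scheme" and E :: "nat \<Rightarrow> 'u cell_map"
  assumes chain_graph: "omega_graph (X n)"
    and chain_map: "E n \<in> graph_hom (X n) (X (Suc n))"
begin

abbreviation cell_thread :: "nat \<Rightarrow> (nat \<Rightarrow> 'u) \<Rightarrow> bool" where
  "cell_thread i \<equiv> thread (\<lambda>n. cells (X n) i) (\<lambda>n. E n i)"

definition code :: "nat \<Rightarrow> (nat \<Rightarrow> 'u) \<Rightarrow> 'u" where
  "code i = (SOME c. \<forall>x y. cell_thread i x \<longrightarrow> cell_thread i y \<longrightarrow> (c x = c y \<longleftrightarrow> ev_eq x y))"

definition lim_cells :: "nat \<Rightarrow> 'u set" where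
  "lim_cells i = code i ` {x. cell_thread i x}"

text \<open>All structure of the colimit is computed stage by stage on this representative. The
  choice is invisible, since \<open>code\<close> depends on a thread only up to eventual
  equality.\<close>

definition rep :: "nat \<Rightarrow> 'u \<Rightarrow> nat \<Rightarrow> 'u" where
  "rep i d = (SOME x. cell_thread i x \<and> code i x = d)"

definition lim :: "'u omega_graph" where
  "lim =
    \<lparr>cells = lim_cells,
     dm = (\<lambda>i. \<lambda>d\<in>lim_cells (Suc i). code i (\<lambda>n. dm (X n) i (rep (Suc i) d n))),
     cd = (\<lambda>i. \<lambda>d\<in>lim_cells (Suc i). code i (\<lambda>n. cd (X n) i (rep (Suc i) d n))),
     idt = (\<lambda>i. \<lambda>d\<in>lim_cells i. code (Suc i) (\<lambda>n. idt (X n) i (rep i d n)))\<rparr>"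

lemma code_eq_iff: "cell_thread i x \<Longrightarrow> cell_thread i y \<Longrightarrow> code i x = code i y \<longleftrightarrow> ev_eq x y"
  using someI_ex[OF exists_thread_code[of "\<lambda>n. cells (X n) i" "\<lambda>n. E n i"]]
  unfolding code_def by blast

lemma code_in: "cell_thread i x \<Longrightarrow> code i x \<in> lim_cells i"
  by (simp add: lim_cells_def)

lemma rep_code_ex:
  assumes "d \<in> lim_cells i" shows "cell_thread i (rep i d) \<and> code i (rep i d) = d"
proof -
  have "\<exists>x. cell_thread i x \<and> code i x = d" using assms by (auto simp: lim_cells_def)
  then show ?thesis unfolding rep_def by (rule someI_ex)
qed

lemmas rep_thread = rep_code_ex[THEN conjunct1]

lemma rep_in: "d \<in> lim_cells i \<Longrightarrow> \<forall>\<^sub>F n in sequentially. rep i d n \<in> cells (X n) i"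
  by (rule thread_in[OF rep_thread])

lemma rep_code: "cell_thread i x \<Longrightarrow> ev_eq (rep i (code i x)) x"
  using code_eq_iff[of i "rep i (code i x)" x] rep_code_ex[OF code_in[of i x]] by simp

text \<open>The working principle for all laws below: an equation in the colimit follows once it
  holds for the representatives at all late stages, and there it is a law of the stage.\<close>

lemma lim_eqI: "\<lbrakk>d \<in> lim_cells i; d' \<in> lim_cells i; ev_eq (rep i d) (rep i d')\<rbrakk> \<Longrightarrow> d = d'"
  using code_eq_iff[of i "rep i d" "rep i d'"] rep_code_ex[of d i] rep_code_ex[of d' i] by simp

lemma chain_mapD:
  assumes "a \<in> cells (X n) i"
  shows "E n i a \<in> cells (X (Suc n)) i" "E n (Suc i) (idt (X n) i a) = idt (X (Suc n)) i (E n i a)"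
  using chain_map[of n] globular_homD(2)[OF graph_hom_globular[OF chain_map]] assms
  by (auto simp: graph_hom_def)

lemma chain_mapD_Suc:
  assumes "a \<in> cells (X n) (Suc i)"
  shows "E n i (dm (X n) i a) = dm (X (Suc n)) i (E n (Suc i) a)"
    "E n i (cd (X n) i a) = cd (X (Suc n)) i (E n (Suc i) a)"
  using globular_homD(4,5)[OF graph_hom_globular[OF chain_map]] assms by auto

lemmas chain_in = omega_graph.idt_in[OF chain_graph]
  globular_set.dm_in[OF omega_graph.axioms(1)[OF chain_graph]]
  globular_set.cd_in[OF omega_graph.axioms(1)[OF chain_graph]]

text \<open>The transition maps commute with the structure maps, so applying these entrywise
  preserves eventual compatibility.\<close>

lemma thread_dm: "cell_thread (Suc i) x \<Longrightarrow> cell_thread i (\<lambda>n. dm (X n) i (x n))"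
  and thread_cd: "cell_thread (Suc i) x \<Longrightarrow> cell_thread i (\<lambda>n. cd (X n) i (x n))"
  and thread_idt: "cell_thread i x \<Longrightarrow> cell_thread (Suc i) (\<lambda>n. idt (X n) i (x n))"
  unfolding thread_def
  by (auto elim!: eventually_mono simp: chain_in chain_mapD chain_mapD_Suc)

lemma lim_sel [simp]: "cells lim = lim_cells"
  by (simp add: lim_def)

lemma rep_dm: "d \<in> lim_cells (Suc i) \<Longrightarrow> ev_eq (rep i (dm lim i d)) (\<lambda>n. dm (X n) i (rep (Suc i) d n))"
  and rep_cd: "d \<in> lim_cells (Suc i) \<Longrightarrow> ev_eq (rep i (cd lim i d)) (\<lambda>n. cd (X n) i (rep (Suc i) d n))"
  and rep_idt: "d \<in> lim_cells i \<Longrightarrow> ev_eq (rep (Suc i) (idt lim i d)) (\<lambda>n. idt (X n) i (rep i d n))"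
  by (simp_all add: lim_def rep_code thread_dm thread_cd thread_idt rep_thread)

lemma lim_in:
  "d \<in> lim_cells (Suc i) \<Longrightarrow> dm lim i d \<in> lim_cells i"
  "d \<in> lim_cells (Suc i) \<Longrightarrow> cd lim i d \<in> lim_cells i"
  "d \<in> lim_cells i \<Longrightarrow> idt lim i d \<in> lim_cells (Suc i)"
  by (simp_all add: lim_def code_in thread_dm thread_cd thread_idt rep_thread)

lemma omega_graph_lim: "omega_graph lim"
proof
  show "dm lim i \<in> cells lim (Suc i) \<rightarrow>\<^sub>E cells lim i" for i
    using lim_in(1) by (auto simp: lim_def)
  show "cd lim i \<in> cells lim (Suc i) \<rightarrow>\<^sub>E cells lim i" for i
    using lim_in(2) by (auto simp: lim_def)
  show "idt lim i \<in> cells lim i \<rightarrow>\<^sub>E cells lim (Suc i)" for i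
    using lim_in(3) by (auto simp: lim_def)
next
  fix a i assume "a \<in> cells lim (Suc (Suc i))"
  then have a: "a \<in> lim_cells (Suc (Suc i))" by simp
  show "dm lim i (dm lim (Suc i) a) = dm lim i (cd lim (Suc i) a)"
    using rep_dm[OF lim_in(1)[OF a]] rep_dm[OF lim_in(2)[OF a]] rep_dm[OF a] rep_cd[OF a] rep_in[OF a]
    by (intro lim_eqI[of _ i], simp_all add: lim_in a, eventually_elim)
      (simp add: globular_set.dm_globular[OF omega_graph.axioms(1)[OF chain_graph]])
  show "cd lim i (dm lim (Suc i) a) = cd lim i (cd lim (Suc i) a)"
    using rep_cd[OF lim_in(1)[OF a]] rep_cd[OF lim_in(2)[OF a]] rep_dm[OF a] rep_cd[OF a] rep_in[OF a]
    by (intro lim_eqI[of _ i], simp_all add: lim_in a, eventually_elim)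
      (simp add: globular_set.cd_globular[OF omega_graph.axioms(1)[OF chain_graph]])
next
  fix a i assume "a \<in> cells lim i"
  then have a: "a \<in> lim_cells i" by simp
  show "dm lim i (idt lim i a) = a"
    using rep_dm[OF lim_in(3)[OF a]] rep_idt[OF a] rep_in[OF a]
    by (intro lim_eqI[of _ i], simp_all add: lim_in a, eventually_elim)
      (simp add: omega_graph.dm_idt[OF chain_graph])
  show "cd lim i (idt lim i a) = a"
    using rep_cd[OF lim_in(3)[OF a]] rep_idt[OF a] rep_in[OF a]
    by (intro lim_eqI[of _ i], simp_all add: lim_in a, eventually_elim)
      (simp add: omega_graph.cd_idt[OF chain_graph])
qed

text \<open>The thread starting with \<open>a\<close> at stage \<open>n\<close>. The entry at
  \<open>n\<close> itself is still \<open>a\<close>; the entries before it are mere filler, harmless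
  because threads are constrained only eventually.\<close>

primrec trace :: "nat \<Rightarrow> nat \<Rightarrow> 'u \<Rightarrow> nat \<Rightarrow> 'u" where
  "trace n i a 0 = a"
| "trace n i a (Suc m) = (if m < n then a else E m i (trace n i a m))"

definition iota :: "nat \<Rightarrow> 'u cell_map" where
  "iota n i = (\<lambda>a\<in>cells (X n) i. code i (trace n i a))"

lemma trace_start: "trace n i a n = a"
  by (cases n) auto

lemma trace_in: "\<lbrakk>m \<ge> n; a \<in> cells (X n) i\<rbrakk> \<Longrightarrow> trace n i a m \<in> cells (X m) i"
  by (induction rule: dec_induct) (auto simp: trace_start chain_mapD)

lemma trace_thread: "a \<in> cells (X n) i \<Longrightarrow> cell_thread i (trace n i a)"
  unfolding thread_def eventually_sequentially by (intro exI[of _ n]) (auto simp: trace_in)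

lemma iota_in: "a \<in> cells (X n) i \<Longrightarrow> iota n i a \<in> lim_cells i"
  by (simp add: iota_def code_in trace_thread)

lemma rep_iota: "a \<in> cells (X n) i \<Longrightarrow> ev_eq (rep i (iota n i a)) (trace n i a)"
  by (simp add: iota_def rep_code trace_thread)

lemma iota_eqI:
  "\<lbrakk>d \<in> lim_cells i; a \<in> cells (X n) i; ev_eq (rep i d) (trace n i a)\<rbrakk> \<Longrightarrow> iota n i a = d"
  by (rule lim_eqI[OF iota_in _ ev_eq_trans[OF rep_iota ev_eq_sym]])

lemma trace_step:
  assumes "Suc n \<le> m" shows "trace (Suc n) i (E n i a) m = trace n i a m"
  using assms by (induction rule: dec_induct) (auto simp: trace_start simp del: trace.simps(1))

lemma iota_step:
  assumes a: "a \<in> cells (X n) i" shows "iota (Suc n) i (E n i a) = iota n i a"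
proof (rule iota_eqI)
  have "ev_eq (trace n i a) (trace (Suc n) i (E n i a))"
    using trace_step unfolding eventually_sequentially by metis
  then show "ev_eq (rep i (iota n i a)) (trace (Suc n) i (E n i a))"
    by (rule ev_eq_trans[OF rep_iota[OF a]])
qed (simp_all add: a iota_in chain_mapD)

lemma trace_hom:
  assumes "m \<ge> n"
  shows "a \<in> cells (X n) (Suc i) \<Longrightarrow> trace n i (dm (X n) i a) m = dm (X m) i (trace n (Suc i) a m)"
    "a \<in> cells (X n) (Suc i) \<Longrightarrow> trace n i (cd (X n) i a) m = cd (X m) i (trace n (Suc i) a m)"
    "a \<in> cells (X n) i \<Longrightarrow> trace n (Suc i) (idt (X n) i a) m = idt (X m) i (trace n i a m)"
  using assms
  by (induction rule: dec_induct) (simp_all add: trace_start chain_mapD chain_mapD_Suc trace_in)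

lemma iota_hom: "iota n \<in> graph_hom (X n) lim"
proof -
  have ev: "\<forall>\<^sub>F m in sequentially. m \<ge> n" by (rule eventually_ge_at_top)
  have "iota n i (dm (X n) i a) = dm lim i (iota n (Suc i) a)"
    "iota n i (cd (X n) i a) = cd lim i (iota n (Suc i) a)" if a: "a \<in> cells (X n) (Suc i)" for i a
  proof -
    show "iota n i (dm (X n) i a) = dm lim i (iota n (Suc i) a)"
      using rep_dm[OF iota_in[OF a]] rep_iota[OF a] ev
      by (intro iota_eqI, simp_all add: lim_in iota_in chain_in a, eventually_elim)
        (simp add: trace_hom a)
    show "iota n i (cd (X n) i a) = cd lim i (iota n (Suc i) a)"
      using rep_cd[OF iota_in[OF a]] rep_iota[OF a] ev
      by (intro iota_eqI, simp_all add: lim_in iota_in chain_in a, eventually_elim)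
        (simp add: trace_hom a)
  qed
  moreover have "iota n (Suc i) (idt (X n) i a) = idt lim i (iota n i a)" if a: "a \<in> cells (X n) i" for i a
    using rep_idt[OF iota_in[OF a]] rep_iota[OF a] ev
    by (intro iota_eqI, simp_all add: lim_in iota_in chain_in a, eventually_elim)
      (simp add: trace_hom a)
  moreover have "iota n i a = undefined" if "a \<notin> cells (X n) i" for i a
    using that by (simp add: iota_def)
  ultimately show ?thesis
    by (simp add: graph_hom_def globular_hom_def PiE_iff extensional_def iota_in)
qed

text \<open>Past the stage from which \<open>rep i d\<close> follows the transition maps, the trace
  of its entry at stage \<open>n\<close> is the representative itself. Hence every cell of the
  colimit comes from some stage.\<close>

lemma iota_rep: "d \<in> lim_cells i \<Longrightarrow> \<forall>\<^sub>F n in sequentially. rep i d n \<in> cells (X n) i \<and> iota n i (rep i d n) = d"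
proof -
  assume d: "d \<in> lim_cells i"
  obtain N where N: "\<And>n. n \<ge> N \<Longrightarrow> rep i d n \<in> cells (X n) i \<and> rep i d (Suc n) = E n i (rep i d n)"
    using rep_thread[OF d] by (auto simp: thread_def eventually_sequentially)
  have "iota n i (rep i d n) = d" if n: "n \<ge> N" for n
  proof (rule iota_eqI[OF d])
    have "rep i d m = trace n i (rep i d n) m" if "m \<ge> n" for m
      using that by (induction rule: dec_induct) (use n N in \<open>auto simp: trace_start\<close>)
    then show "ev_eq (rep i d) (trace n i (rep i d n))" by (rule eventually_sequentiallyI)
  qed (use N n in simp)
  then show ?thesis using N by (auto simp: eventually_sequentially)
qed

lemma lim_cases:
  assumes "d \<in> lim_cells i" obtains n a where "a \<in> cells (X n) i" "d = iota n i a"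
  using eventually_happens[OF iota_rep[OF assms]] by auto

definition cocone :: "(nat \<Rightarrow> 'u cell_map) \<Rightarrow> bool" where
  "cocone g \<longleftrightarrow> (\<forall>n i. \<forall>a\<in>cells (X n) i. g (Suc n) i (E n i a) = g n i a)"

definition desc :: "(nat \<Rightarrow> 'u cell_map) \<Rightarrow> 'u cell_map" where
  "desc g i = (\<lambda>d\<in>lim_cells i. SOME b. \<forall>\<^sub>F n in sequentially. g n i (rep i d n) = b)"

text \<open>Once the representative follows the transition maps, the cocone condition makes its
  images constant; \<open>desc\<close> picks this eventual value.\<close>

lemma desc_ev:
  assumes g: "cocone g" and d: "d \<in> lim_cells i"
  shows "\<forall>\<^sub>F n in sequentially. g n i (rep i d n) = desc g i d"
proof -
  obtain N where N: "\<And>n. n \<ge> N \<Longrightarrow> rep i d n \<in> cells (X n) i \<and> rep i d (Suc n) = E n i (rep i d n)"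
    using rep_thread[OF d] by (auto simp: thread_def eventually_sequentially)
  have "g n i (rep i d n) = g N i (rep i d N)" if "n \<ge> N" for n
    using that by (induction rule: dec_induct) (use N g in \<open>auto simp: cocone_def\<close>)
  then have "\<exists>b. \<forall>\<^sub>F n in sequentially. g n i (rep i d n) = b"
    by (auto simp: eventually_sequentially)
  then have "\<forall>\<^sub>F n in sequentially. g n i (rep i d n) = (SOME b. \<forall>\<^sub>F n in sequentially. g n i (rep i d n) = b)"
    by (rule someI_ex)
  then show ?thesis using d by (simp add: desc_def)
qed

lemma desc_iota:
  assumes g: "cocone g" and a: "a \<in> cells (X n) i"
  shows "desc g i (iota n i a) = g n i a"
proof -
  have "g m i (trace n i a m) = g n i a" if "m \<ge> n" for m
    using that by (induction rule: dec_induct) (use g a trace_in in \<open>auto simp: cocone_def trace_start\<close>)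
  then have "\<forall>\<^sub>F m in sequentially. g m i (trace n i a m) = g n i a"
    by (auto simp: eventually_sequentially)
  then have "\<forall>\<^sub>F m in sequentially. desc g i (iota n i a) = g n i a"
    using desc_ev[OF g iota_in[OF a]] rep_iota[OF a] by eventually_elim simp
  then show ?thesis by simp
qed

lemma desc_hom:
  fixes Z :: "('u, 'y) omega_graph_scheme"
  assumes g: "cocone g" and hom: "\<And>n. g n \<in> graph_hom (X n) Z"
  shows "desc g \<in> graph_hom lim Z"
proof -
  note gh = globular_homD(2,4,5)[OF graph_hom_globular[OF hom]]
  have idt: "g n (Suc i) (idt (X n) i a) = idt Z i (g n i a)" if "a \<in> cells (X n) i" for n i a
    using hom[of n] that by (auto simp: graph_hom_def)
  note hD = gh(2,3) idt
  have "desc g i d \<in> cells Z i" if d: "d \<in> lim_cells i" for i d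
  proof -
    \<comment> \<open>The claim does not mention the stage, so it may be proved eventually and then
      extracted, the filter being nontrivial. The same device is used for every property of
      \<open>desc\<close>.\<close>
    have "\<forall>\<^sub>F n in sequentially. desc g i d \<in> cells Z i"
      using desc_ev[OF g d] rep_in[OF d] by eventually_elim (use gh(1) in force)
    then show ?thesis by simp
  qed
  moreover have "desc g i (dm lim i d) = dm Z i (desc g (Suc i) d)"
    "desc g i (cd lim i d) = cd Z i (desc g (Suc i) d)" if d: "d \<in> lim_cells (Suc i)" for i d
  proof -
    have "\<forall>\<^sub>F n in sequentially. desc g i (dm lim i d) = dm Z i (desc g (Suc i) d)"
      using desc_ev[OF g d] desc_ev[OF g lim_in(1)[OF d]] rep_dm[OF d] rep_in[OF d]
      by eventually_elim (simp add: hD(1))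
    then show "desc g i (dm lim i d) = dm Z i (desc g (Suc i) d)" by simp
    have "\<forall>\<^sub>F n in sequentially. desc g i (cd lim i d) = cd Z i (desc g (Suc i) d)"
      using desc_ev[OF g d] desc_ev[OF g lim_in(2)[OF d]] rep_cd[OF d] rep_in[OF d]
      by eventually_elim (simp add: hD(2))
    then show "desc g i (cd lim i d) = cd Z i (desc g (Suc i) d)" by simp
  qed
  moreover have "desc g (Suc i) (idt lim i d) = idt Z i (desc g i d)" if d: "d \<in> lim_cells i" for i d
  proof -
    have "\<forall>\<^sub>F n in sequentially. desc g (Suc i) (idt lim i d) = idt Z i (desc g i d)"
      using desc_ev[OF g d] desc_ev[OF g lim_in(3)[OF d]] rep_idt[OF d] rep_in[OF d]
      by eventually_elim (simp add: hD(3))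
    then show ?thesis by simp
  qed
  moreover have "desc g i d = undefined" if "d \<notin> lim_cells i" for i d
    using that by (simp add: desc_def)
  ultimately show ?thesis
    by (simp add: graph_hom_def globular_hom_def PiE_iff extensional_def)
qed

end

section \<open>Sequential colimits of bridge magmas\<close>

lemma dom_iter_in: "\<lbrakk>globular_set X; a \<in> cells X j; i \<le> j\<rbrakk> \<Longrightarrow> dom_iter X i j a \<in> cells X i"
  and cod_iter_in: "\<lbrakk>globular_set X; a \<in> cells X j; i \<le> j\<rbrakk> \<Longrightarrow> cod_iter X i j a \<in> cells X i"
  by (induction j arbitrary: a) (auto simp: globular_set.dm_in globular_set.cd_in le_Suc_eq)

lemma iter_id_iter:
  assumes "omega_graph X" "a \<in> cells X i" "i \<le> j"
  shows "dom_iter X i j (id_iter X i j a) = a" "cod_iter X i j (id_iter X i j a) = a"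
proof -
  interpret omega_graph X by fact
  have "id_iter X i j a \<in> cells X j \<and> dom_iter X i j (id_iter X i j a) = a
      \<and> cod_iter X i j (id_iter X i j a) = a"
    using assms(3)
  proof (induction j)
    case (Suc j)
    then show ?case using assms(2) by (cases "i \<le> j") (auto simp: idt_in dm_idt cd_idt le_Suc_eq)
  qed (use assms(2) in simp)
  then show "dom_iter X i j (id_iter X i j a) = a" "cod_iter X i j (id_iter X i j a) = a"
    by simp_all
qed

lemma bridge_magma_graph: "bridge_magma X \<Longrightarrow> omega_graph X"
  by (simp add: bridge_magma_def omega_magma_def)

lemma bridge_hom_idt: "F \<in> bridge_hom X Y \<Longrightarrow> a \<in> cells X i \<Longrightarrow> F (Suc i) (idt X i a) = idt Y i (F i a)"
  by (simp add: bridge_hom_def magma_hom_def graph_hom_def)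

lemma bridge_hom_cmp:
  "F \<in> bridge_hom X Y \<Longrightarrow> composable X i j a b \<Longrightarrow> F j (cmp X i j a b) = cmp Y i j (F j a) (F j b)"
  by (simp add: bridge_hom_def magma_hom_def)

lemma bridge_hom_bridge:
  "F \<in> bridge_hom X Y \<Longrightarrow> (a, b, c) \<in> bridge X i \<Longrightarrow> (F i a, F i b, F (Suc i) c) \<in> bridge Y i"
  by (simp add: bridge_hom_def)

lemma bridge_unique:
  "\<lbrakk>bridge_magma X; (a, b, c) \<in> bridge X i; (a, b, d) \<in> bridge X i\<rbrakk> \<Longrightarrow> c = d"
  using bridge_magma.bridge_rel[of X] by (simp add: bridge_relation_def)

text \<open>As \<open>i < j\<close>, globularity applies at level \<open>j - 1\<close>: the
  \<open>i\<close>-dimensional boundaries of a \<open>Suc j\<close>-cell are the same whether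
  computed through its \<open>dm\<close> or its \<open>cd\<close>.\<close>

lemma composable_boundary:
  assumes "globular_set Y" "i < j" "composable Y i (Suc j) a b"
  shows "composable Y i j (dm Y j a) (dm Y j b)" "composable Y i j (cd Y j a) (cd Y j b)"
proof -
  obtain k where k: "j = Suc k" using assms(2) by (cases j) auto
  have ab: "a \<in> cells Y (Suc j)" "b \<in> cells Y (Suc j)"
    "cod_iter Y i j (cd Y j a) = dom_iter Y i j (dm Y j b)"
    using assms(2,3) by (simp_all add: composable_def)
  interpret globular_set Y by fact
  have "cod_iter Y i j (dm Y j a) = cod_iter Y i j (cd Y j a)"
    "dom_iter Y i j (cd Y j b) = dom_iter Y i j (dm Y j b)"
    using ab(1,2) assms(2) cd_globular dm_globular by (simp_all add: k)
  then show "composable Y i j (dm Y j a) (dm Y j b)" "composable Y i j (cd Y j a) (cd Y j b)"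
    using ab assms(2) by (simp_all add: composable_def dm_in cd_in)
qed

locale bridge_chain =
  fixes X :: "nat \<Rightarrow> 'u bridge_magma" and E :: "nat \<Rightarrow> 'u cell_map"
  assumes chain_bridge: "bridge_magma (X n)"
    and chain_bridge_hom: "E n \<in> bridge_hom (X n) (X (Suc n))"

sublocale bridge_chain \<subseteq> graph_chain X E
proof (rule graph_chain.intro)
  show "omega_graph (X n)" for n
    by (rule bridge_magma_graph[OF chain_bridge])
  show "E n \<in> graph_hom (X n) (X (Suc n))" for n
    by (rule magma_hom_graph[OF bridge_hom_magma[OF chain_bridge_hom]])
qed

context bridge_chain
begin

text \<open>Composability and bridges are tested at late stages of the representatives. That the
  former is composability in the colimit itself is \<open>composable_lim_iff\<close>.\<close>

definition lim_magma :: "'u bridge_magma" where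
  "lim_magma =
    \<lparr>cells = lim_cells, dm = dm lim, cd = cd lim, idt = idt lim,
     cmp = (\<lambda>i j a b.
       if i < j \<and> a \<in> lim_cells j \<and> b \<in> lim_cells j \<and>
         (\<forall>\<^sub>F n in sequentially. composable (X n) i j (rep j a n) (rep j b n))
       then code j (\<lambda>n. cmp (X n) i j (rep j a n) (rep j b n)) else undefined),
     bridge = (\<lambda>i. {(a, b, c). a \<in> lim_cells i \<and> b \<in> lim_cells i \<and> c \<in> lim_cells (Suc i) \<and>
       (\<forall>\<^sub>F n in sequentially. (rep i a n, rep i b n, rep (Suc i) c n) \<in> bridge (X n) i)})\<rparr>"

lemma lim_magma_sel [simp]:
  "cells lim_magma = lim_cells" "dm lim_magma = dm lim" "cd lim_magma = cd lim"
  "idt lim_magma = idt lim"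
  by (simp_all add: lim_magma_def)

lemma omega_graph_lim_magma: "omega_graph lim_magma"
  using omega_graph_lim by (simp add: omega_graph_def omega_graph_axioms_def globular_set_def)

lemma globular_set_lim_magma: "globular_set lim_magma"
  by (rule omega_graph.axioms(1)[OF omega_graph_lim_magma])

lemma rep_dom_iter:
  "\<lbrakk>d \<in> lim_cells j; i \<le> j\<rbrakk> \<Longrightarrow>
    ev_eq (rep i (dom_iter lim_magma i j d)) (\<lambda>n. dom_iter (X n) i j (rep j d n))"
proof (induction j arbitrary: d)
  case (Suc j)
  show ?case
  proof (cases "i \<le> j")
    case True
    show ?thesis
      using Suc.IH[OF lim_in(1)[OF Suc.prems(1)] True] rep_dm[OF Suc.prems(1)]
      by eventually_elim (use True in simp)
  qed (use Suc.prems in \<open>simp add: le_Suc_eq\<close>)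
qed simp

lemma rep_cod_iter:
  "\<lbrakk>d \<in> lim_cells j; i \<le> j\<rbrakk> \<Longrightarrow>
    ev_eq (rep i (cod_iter lim_magma i j d)) (\<lambda>n. cod_iter (X n) i j (rep j d n))"
proof (induction j arbitrary: d)
  case (Suc j)
  show ?case
  proof (cases "i \<le> j")
    case True
    show ?thesis
      using Suc.IH[OF lim_in(2)[OF Suc.prems(1)] True] rep_cd[OF Suc.prems(1)]
      by eventually_elim (use True in simp)
  qed (use Suc.prems in \<open>simp add: le_Suc_eq\<close>)
qed simp

lemma id_iter_in: "\<lbrakk>d \<in> lim_cells i; i \<le> j\<rbrakk> \<Longrightarrow> id_iter lim_magma i j d \<in> lim_cells j"
  by (induction j) (auto simp: lim_in le_Suc_eq)

lemma rep_id_iter: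
  "\<lbrakk>d \<in> lim_cells i; i \<le> j\<rbrakk> \<Longrightarrow>
    ev_eq (rep j (id_iter lim_magma i j d)) (\<lambda>n. id_iter (X n) i j (rep i d n))"
proof (induction j)
  case (Suc j)
  show ?case
  proof (cases "i \<le> j")
    case True
    show ?thesis
      using Suc.IH[OF Suc.prems(1) True] rep_idt[OF id_iter_in[OF Suc.prems(1) True]]
      by eventually_elim (use True in simp)
  qed (use Suc.prems in \<open>simp add: le_Suc_eq\<close>)
qed simp

text \<open>Iterated boundaries are computed stagewise, and equality of cells of the colimit is
  eventual equality of representatives; so the matching condition of a composable pair is already
  satisfied at all late stages.\<close>

lemma composable_lim_iff:
  "composable lim_magma i j a b \<longleftrightarrow> i < j \<and> a \<in> lim_cells j \<and> b \<in> lim_cells j \<and>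
    (\<forall>\<^sub>F n in sequentially. composable (X n) i j (rep j a n) (rep j b n))"
  (is "?L \<longleftrightarrow> ?R")
proof
  assume ?L
  then have ab: "i < j" "a \<in> lim_cells j" "b \<in> lim_cells j"
    and eq: "cod_iter lim_magma i j a = dom_iter lim_magma i j b"
    by (simp_all add: composable_def)
  have "\<forall>\<^sub>F n in sequentially. composable (X n) i j (rep j a n) (rep j b n)"
    using rep_cod_iter[OF ab(2) less_imp_le[OF ab(1)]] rep_dom_iter[OF ab(3) less_imp_le[OF ab(1)]]
      rep_in[OF ab(2)] rep_in[OF ab(3)]
    by eventually_elim (use ab(1) eq in \<open>simp add: composable_def\<close>)
  with ab show ?R by simp
next
  assume R: ?R
  then have ab: "i < j" "i \<le> j" "a \<in> lim_cells j" "b \<in> lim_cells j"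
    and ev: "\<forall>\<^sub>F n in sequentially. composable (X n) i j (rep j a n) (rep j b n)"
    by simp_all
  have "cod_iter lim_magma i j a = dom_iter lim_magma i j b"
  proof (rule lim_eqI)
    show "ev_eq (rep i (cod_iter lim_magma i j a)) (rep i (dom_iter lim_magma i j b))"
      using rep_cod_iter[OF ab(3,2)] rep_dom_iter[OF ab(4,2)] ev
      by eventually_elim (simp add: composable_def)
  qed (use dom_iter_in[OF globular_set_lim_magma] cod_iter_in[OF globular_set_lim_magma] ab in simp_all)
  with ab show ?L by (simp add: composable_def)
qed

lemma composable_limD:
  assumes "composable lim_magma i j a b"
  shows "a \<in> lim_cells j" "b \<in> lim_cells j"
    "\<forall>\<^sub>F n in sequentially. composable (X n) i j (rep j a n) (rep j b n)"
  using assms by (simp_all add: composable_lim_iff)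

lemma thread_cmp:
  assumes "cell_thread j x" "cell_thread j y"
    and "\<forall>\<^sub>F n in sequentially. composable (X n) i j (x n) (y n)"
  shows "cell_thread j (\<lambda>n. cmp (X n) i j (x n) (y n))"
  using assms unfolding thread_def
  by eventually_elim
    (simp add: bridge_hom_cmp[OF chain_bridge_hom] omega_magma.cmp_in[OF bridge_magma.axioms(1)[OF chain_bridge]])

lemma cmp_lim:
  "composable lim_magma i j a b \<Longrightarrow>
    cmp lim_magma i j a b = code j (\<lambda>n. cmp (X n) i j (rep j a n) (rep j b n))"
  unfolding composable_lim_iff by (simp add: lim_magma_def)

lemma cmp_lim_in: "composable lim_magma i j a b \<Longrightarrow> cmp lim_magma i j a b \<in> lim_cells j"
  by (simp add: cmp_lim code_in thread_cmp rep_thread composable_limD)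

lemma rep_cmp:
  "composable lim_magma i j a b \<Longrightarrow>
    ev_eq (rep j (cmp lim_magma i j a b)) (\<lambda>n. cmp (X n) i j (rep j a n) (rep j b n))"
  by (simp add: cmp_lim rep_code thread_cmp rep_thread composable_limD)

lemma omega_magma_lim: "omega_magma lim_magma"
proof -
  interpret omega_graph lim_magma by (rule omega_graph_lim_magma)
  note m = bridge_magma.axioms(1)[OF chain_bridge]
  show ?thesis
  proof
    fix i j a b
    show "cmp lim_magma i j a b \<in> cells lim_magma j" if "composable lim_magma i j a b"
      using cmp_lim_in[OF that] by simp
    show "cmp lim_magma i j a b = undefined" if "\<not> composable lim_magma i j a b"
      using that unfolding composable_lim_iff by (auto simp: lim_magma_def)
  next
    fix i a b assume c: "composable lim_magma i (Suc i) a b"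
    note cD = composable_limD[OF c] and cin = cmp_lim_in[OF c]
    show "dm lim_magma i (cmp lim_magma i (Suc i) a b) = dm lim_magma i a"
      using rep_dm[OF cin] rep_dm[OF cD(1)] rep_cmp[OF c] cD(3)
      by (intro lim_eqI[of _ i], simp_all add: lim_in cD(1) cin, eventually_elim)
        (simp add: omega_magma.dm_cmp_eq[OF m])
    show "cd lim_magma i (cmp lim_magma i (Suc i) a b) = cd lim_magma i b"
      using rep_cd[OF cin] rep_cd[OF cD(2)] rep_cmp[OF c] cD(3)
      by (intro lim_eqI[of _ i], simp_all add: lim_in cD(2) cin, eventually_elim)
        (simp add: omega_magma.cd_cmp_eq[OF m])
  next
    fix i j a b assume ij: "i < j" and c: "composable lim_magma i (Suc j) a b"
    note cD = composable_limD[OF c] and cin = cmp_lim_in[OF c]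
    note c' = composable_boundary[OF globular_set_lim_magma ij c, simplified]
    show "dm lim_magma j (cmp lim_magma i (Suc j) a b)
        = cmp lim_magma i j (dm lim_magma j a) (dm lim_magma j b)"
      using rep_dm[OF cin] rep_dm[OF cD(1)] rep_dm[OF cD(2)] rep_cmp[OF c] rep_cmp[OF c'(1)] cD(3)
      by (intro lim_eqI[of _ j], simp_all add: lim_in cin cmp_lim_in c', eventually_elim)
        (simp add: omega_magma.dm_cmp_less[OF m ij])
    show "cd lim_magma j (cmp lim_magma i (Suc j) a b)
        = cmp lim_magma i j (cd lim_magma j a) (cd lim_magma j b)"
      using rep_cd[OF cin] rep_cd[OF cD(1)] rep_cd[OF cD(2)] rep_cmp[OF c] rep_cmp[OF c'(2)] cD(3)
      by (intro lim_eqI[of _ j], simp_all add: lim_in cin cmp_lim_in c', eventually_elim)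
        (simp add: omega_magma.cd_cmp_less[OF m ij])
  qed
qed

lemma bridge_lim_iff:
  "(a, b, c) \<in> bridge lim_magma i \<longleftrightarrow>
    a \<in> lim_cells i \<and> b \<in> lim_cells i \<and> c \<in> lim_cells (Suc i) \<and>
    (\<forall>\<^sub>F n in sequentially. (rep i a n, rep i b n, rep (Suc i) c n) \<in> bridge (X n) i)"
  by (simp add: lim_magma_def)

text \<open>Needed to lift a parallel pair of the colimit to the stages, where bridges are known to
  exist. Dimension 0 is separate, as it has no boundary condition.\<close>

lemma parallel_lim_iff:
  "parallel lim_magma i a b \<longleftrightarrow> a \<in> lim_cells i \<and> b \<in> lim_cells i \<and>
    (\<forall>\<^sub>F n in sequentially. parallel (X n) i (rep i a n) (rep i b n))"
proof (cases "a \<in> lim_cells i \<and> b \<in> lim_cells i")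
  case True
  then have ab: "a \<in> lim_cells i" "b \<in> lim_cells i" by simp_all
  show ?thesis
  proof (cases i)
    case 0
    have "\<forall>\<^sub>F n in sequentially. parallel (X n) i (rep i a n) (rep i b n)"
      using rep_in[OF ab(1)] rep_in[OF ab(2)] by eventually_elim (simp add: parallel_def 0)
    then show ?thesis using ab by (simp add: parallel_def 0)
  next
    case (Suc k)
    note a = ab(1)[unfolded Suc] and b = ab(2)[unfolded Suc]
    show ?thesis
    proof
      assume p: "parallel lim_magma i a b"
      then have eq: "dm lim k a = dm lim k b" "cd lim k a = cd lim k b"
        by (simp_all add: parallel_def Suc)
      have "\<forall>\<^sub>F n in sequentially. parallel (X n) i (rep i a n) (rep i b n)"
        using rep_dm[OF a] rep_dm[OF b] rep_cd[OF a] rep_cd[OF b] rep_in[OF a] rep_in[OF b]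
        by eventually_elim (simp add: parallel_def Suc eq)
      with ab show "a \<in> lim_cells i \<and> b \<in> lim_cells i \<and>
        (\<forall>\<^sub>F n in sequentially. parallel (X n) i (rep i a n) (rep i b n))" by simp
    next
      assume "a \<in> lim_cells i \<and> b \<in> lim_cells i \<and>
        (\<forall>\<^sub>F n in sequentially. parallel (X n) i (rep i a n) (rep i b n))"
      then have ev: "\<forall>\<^sub>F n in sequentially. parallel (X n) i (rep i a n) (rep i b n)" by simp
      have "dm lim k a = dm lim k b"
        using rep_dm[OF a] rep_dm[OF b] ev
        by (intro lim_eqI[of _ k], simp_all add: lim_in a b, eventually_elim)
          (simp add: parallel_def Suc)
      moreover have "cd lim k a = cd lim k b"
        using rep_cd[OF a] rep_cd[OF b] ev
        by (intro lim_eqI[of _ k], simp_all add: lim_in a b, eventually_elim)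
          (simp add: parallel_def Suc)
      ultimately show "parallel lim_magma i a b" using a b by (simp add: parallel_def Suc)
    qed
  qed
qed (auto simp: parallel_def)

lemma bridge_relation_lim: "bridge_relation lim_magma (bridge lim_magma)"
proof -
  have br: "bridge_relation (X n) (bridge (X n))" for n
    by (rule bridge_magma.bridge_rel[OF chain_bridge])
  have 1: "parallel lim_magma i a b \<and> dm lim_magma i c = a \<and> cd lim_magma i c = b"
    if abc: "(a, b, c) \<in> bridge lim_magma i" for i a b c
  proof -
    have in_lim: "a \<in> lim_cells i" "b \<in> lim_cells i" "c \<in> lim_cells (Suc i)"
      and "\<forall>\<^sub>F n in sequentially. (rep i a n, rep i b n, rep (Suc i) c n) \<in> bridge (X n) i"
      using abc by (simp_all add: bridge_lim_iff)
    from this(4) have ev: "\<forall>\<^sub>F n in sequentially. parallel (X n) i (rep i a n) (rep i b n) \<and>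
      dm (X n) i (rep (Suc i) c n) = rep i a n \<and> cd (X n) i (rep (Suc i) c n) = rep i b n"
      by (rule eventually_mono) (use br in \<open>simp add: bridge_relation_def\<close>)
    have "dm lim i c = a"
      using rep_dm[OF in_lim(3)] ev
      by (intro lim_eqI[of _ i], simp_all add: lim_in in_lim, eventually_elim) simp
    moreover have "cd lim i c = b"
      using rep_cd[OF in_lim(3)] ev
      by (intro lim_eqI[of _ i], simp_all add: lim_in in_lim, eventually_elim) simp
    moreover have "parallel lim_magma i a b"
      using in_lim ev by (auto simp: parallel_lim_iff elim: eventually_mono)
    ultimately show ?thesis by simp
  qed
  have 2: "(a, a, idt lim_magma i a) \<in> bridge lim_magma i" if a: "a \<in> lim_cells i" for i a
  proof -
    have "\<forall>\<^sub>F n in sequentially. (rep i a n, rep i a n, rep (Suc i) (idt lim i a) n) \<in> bridge (X n) i"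
      using rep_idt[OF a] rep_in[OF a] by eventually_elim (use br in \<open>simp add: bridge_relation_def\<close>)
    then show ?thesis using a by (simp add: bridge_lim_iff lim_in)
  qed
  have 3: "c = d" if c: "(a, b, c) \<in> bridge lim_magma i" and d: "(a, b, d) \<in> bridge lim_magma i" for i a b c d
  proof (rule lim_eqI[of _ "Suc i"])
    have "\<forall>\<^sub>F n in sequentially. (rep i a n, rep i b n, rep (Suc i) c n) \<in> bridge (X n) i"
      "\<forall>\<^sub>F n in sequentially. (rep i a n, rep i b n, rep (Suc i) d n) \<in> bridge (X n) i"
      using c d by (simp_all add: bridge_lim_iff)
    then show "ev_eq (rep (Suc i) c) (rep (Suc i) d)"
      by eventually_elim (rule bridge_unique[OF chain_bridge])
  qed (use c d in \<open>simp_all add: bridge_lim_iff\<close>)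
  show ?thesis
    unfolding bridge_relation_def using 1 2 3
    by (intro conjI allI ballI impI subsetI) (auto simp: bridge_lim_iff)
qed

lemma bridge_magma_lim: "bridge_magma lim_magma"
  by (rule bridge_magma.intro[OF omega_magma_lim]) (simp add: bridge_magma_axioms_def bridge_relation_lim)

lemma desc_bridge_hom:
  fixes Z :: "('u, 'y) bridge_magma_scheme"
  assumes g: "cocone g" and hom: "\<And>n. g n \<in> bridge_hom (X n) Z"
  shows "desc g \<in> bridge_hom lim_magma Z"
proof -
  have "desc g \<in> graph_hom lim Z"
    by (rule desc_hom[OF g]) (simp add: hom bridge_hom_magma magma_hom_graph)
  then have "desc g \<in> graph_hom lim_magma Z"
    by (simp add: graph_hom_def globular_hom_def)
  moreover have "desc g j (cmp lim_magma i j a b) = cmp Z i j (desc g j a) (desc g j b)"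
    if c: "composable lim_magma i j a b" for i j a b
  proof -
    note cD = composable_limD[OF c]
    have "\<forall>\<^sub>F n in sequentially. desc g j (cmp lim_magma i j a b) = cmp Z i j (desc g j a) (desc g j b)"
      using desc_ev[OF g cD(1)] desc_ev[OF g cD(2)] desc_ev[OF g cmp_lim_in[OF c]] rep_cmp[OF c] cD(3)
      by eventually_elim (simp add: bridge_hom_cmp[OF hom])
    then show ?thesis by simp
  qed
  moreover have "(desc g i a, desc g i b, desc g (Suc i) c) \<in> bridge Z i"
    if abc: "(a, b, c) \<in> bridge lim_magma i" for i a b c
  proof -
    have in_lim: "a \<in> lim_cells i" "b \<in> lim_cells i" "c \<in> lim_cells (Suc i)"
      and ev: "\<forall>\<^sub>F n in sequentially. (rep i a n, rep i b n, rep (Suc i) c n) \<in> bridge (X n) i"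
      using abc by (simp_all add: bridge_lim_iff)
    have "\<forall>\<^sub>F n in sequentially. (desc g i a, desc g i b, desc g (Suc i) c) \<in> bridge Z i"
      using desc_ev[OF g in_lim(1)] desc_ev[OF g in_lim(2)] desc_ev[OF g in_lim(3)] ev
      by eventually_elim (use bridge_hom_bridge[OF hom] in force)
    then show ?thesis by simp
  qed
  ultimately show ?thesis by (simp add: bridge_hom_def magma_hom_def)
qed

text \<open>Each axiom involves finitely many cells and composability hypotheses, all of which hold
  simultaneously at late stages; there it is the axiom of a strict omega category.\<close>

lemma strict_lim:
  assumes strict: "\<And>n. strict_omega_category (X n)"
  shows "strict_omega_category lim_magma"
proof -
  interpret omega_magma lim_magma by (rule omega_magma_lim)
  show ?thesis
  proof
    fix i j :: nat and a b c :: 'u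
    assume h: "composable lim_magma i j a b" "composable lim_magma i j (cmp lim_magma i j a b) c"
      "composable lim_magma i j b c" "composable lim_magma i j a (cmp lim_magma i j b c)"
    show "cmp lim_magma i j (cmp lim_magma i j a b) c = cmp lim_magma i j a (cmp lim_magma i j b c)"
    proof (rule lim_eqI[OF cmp_lim_in[OF h(2)] cmp_lim_in[OF h(4)]])
      show "ev_eq (rep j (cmp lim_magma i j (cmp lim_magma i j a b) c))
          (rep j (cmp lim_magma i j a (cmp lim_magma i j b c)))"
        using h[THEN rep_cmp] h[THEN composable_limD(3)]
        by eventually_elim (simp add: strict_omega_category.cmp_assoc[OF strict])
    qed
  next
    fix i j k :: nat and a b c d :: 'u
    assume ij: "i < j" "j < k"
    assume h: "composable lim_magma j k a b" "composable lim_magma j k c d"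
      "composable lim_magma i k (cmp lim_magma j k a b) (cmp lim_magma j k c d)"
      "composable lim_magma i k a c" "composable lim_magma i k b d"
      "composable lim_magma j k (cmp lim_magma i k a c) (cmp lim_magma i k b d)"
    show "cmp lim_magma i k (cmp lim_magma j k a b) (cmp lim_magma j k c d)
        = cmp lim_magma j k (cmp lim_magma i k a c) (cmp lim_magma i k b d)"
    proof (rule lim_eqI[OF cmp_lim_in[OF h(3)] cmp_lim_in[OF h(6)]])
      show "ev_eq (rep k (cmp lim_magma i k (cmp lim_magma j k a b) (cmp lim_magma j k c d)))
          (rep k (cmp lim_magma j k (cmp lim_magma i k a c) (cmp lim_magma i k b d)))"
        using h[THEN rep_cmp] h[THEN composable_limD(3)]
        by eventually_elim (simp add: strict_omega_category.interchange[OF strict ij])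
    qed
  next
    fix i j a assume ij: "i < j" and "a \<in> cells lim_magma j"
    then have a: "a \<in> lim_cells j" by simp
    note gl = globular_set_lim_magma
    note le = less_imp_le[OF ij]
    have iters: "dom_iter lim_magma i j a \<in> lim_cells i" "cod_iter lim_magma i j a \<in> lim_cells i"
      using dom_iter_in[OF gl _ le] cod_iter_in[OF gl _ le] a by simp_all
    note ids = id_iter_in[OF iters(1) le] id_iter_in[OF iters(2) le]
    have ev: "\<forall>\<^sub>F n in sequentially. rep j a n \<in> cells (X n) j \<and>
      rep j (id_iter lim_magma i j (dom_iter lim_magma i j a)) n = id_iter (X n) i j (dom_iter (X n) i j (rep j a n)) \<and>
      rep j (id_iter lim_magma i j (cod_iter lim_magma i j a)) n = id_iter (X n) i j (cod_iter (X n) i j (rep j a n))"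
      using rep_in[OF a] rep_id_iter[OF iters(1) le] rep_id_iter[OF iters(2) le]
        rep_dom_iter[OF a le] rep_cod_iter[OF a le]
      by eventually_elim simp
    have comp: "composable lim_magma i j (id_iter lim_magma i j (dom_iter lim_magma i j a)) a"
      "composable lim_magma i j a (id_iter lim_magma i j (cod_iter lim_magma i j a))"
      using a ij ids iter_id_iter[OF omega_graph_lim_magma _ le] iters
      by (simp_all add: composable_def)
    show "cmp lim_magma i j (id_iter lim_magma i j (dom_iter lim_magma i j a)) a = a"
      using rep_cmp[OF comp(1)] ev
      by (intro lim_eqI[OF cmp_lim_in[OF comp(1)] a], eventually_elim)
        (simp add: strict_omega_category.unit_left[OF strict ij])
    show "cmp lim_magma i j a (id_iter lim_magma i j (cod_iter lim_magma i j a)) = a"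
      using rep_cmp[OF comp(2)] ev
      by (intro lim_eqI[OF cmp_lim_in[OF comp(2)] a], eventually_elim)
        (simp add: strict_omega_category.unit_right[OF strict ij])
  next
    fix i j a b assume c: "composable lim_magma i j a b"
    note cD = composable_limD[OF c]
    have c': "composable lim_magma i (Suc j) (idt lim_magma j a) (idt lim_magma j b)"
      using c cD omega_graph.dm_idt[OF omega_graph_lim] omega_graph.cd_idt[OF omega_graph_lim]
      by (simp add: composable_def lim_in)
    show "cmp lim_magma i (Suc j) (idt lim_magma j a) (idt lim_magma j b)
        = idt lim_magma j (cmp lim_magma i j a b)"
      using rep_cmp[OF c'] rep_cmp[OF c] rep_idt[OF cD(1)] rep_idt[OF cD(2)]
        rep_idt[OF cmp_lim_in[OF c]] cD(3)
      by (intro lim_eqI[of _ "Suc j"], simp_all add: lim_in cmp_lim_in[OF c] cmp_lim_in[OF c', simplified], eventually_elim)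
        (simp add: strict_omega_category.cmp_idt[OF strict])
  qed
qed

end


section \<open>Sequential colimits of categorical Penon morphisms\<close>

lemma fam_comp_eq_iff:
  "fam_comp X G F = fam_comp X G' F' \<longleftrightarrow> (\<forall>i. \<forall>a\<in>cells X i. G i (F i a) = G' i (F' i a))"
proof
  assume eq: "fam_comp X G F = fam_comp X G' F'"
  show "\<forall>i. \<forall>a\<in>cells X i. G i (F i a) = G' i (F' i a)"
  proof (intro allI ballI)
    fix i a assume "a \<in> cells X i"
    then show "G i (F i a) = G' i (F' i a)"
      using fun_cong[OF fun_cong[OF eq, of i], of a] by simp
  qed
qed (auto simp: fam_comp_def compose_def fun_eq_iff)

lemma Hom_Pen_Mor_iff:
  "(F, G) \<in> Hom Pen_Mor P Q \<longleftrightarrow> F \<in> bridge_hom (pen_dom P) (pen_dom Q) \<and>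
    G \<in> bridge_hom (pen_cod P) (pen_cod Q) \<and>
    (\<forall>i. \<forall>a\<in>cells (pen_dom P) i. G i (pen_map P i a) = pen_map Q i (F i a))"
  by (simp add: Pen_Mor_def fam_comp_eq_iff)

lemma bridge_hom_in: "F \<in> bridge_hom X Y \<Longrightarrow> a \<in> cells X i \<Longrightarrow> F i a \<in> cells Y i"
  by (rule globular_homD(2)[OF hom_globular(3)])

locale penon_chain =
  fixes P :: "nat \<Rightarrow> 'u penon_morphism" and E E' :: "nat \<Rightarrow> 'u cell_map"
  assumes chain_penon: "categorical_penon_morphism (P n)"
    and chain_square: "(E n, E' n) \<in> Hom Pen_Mor (P n) (P (Suc n))"

lemma penon_bridge_magma:
  "categorical_penon_morphism P \<Longrightarrow> bridge_magma (pen_dom P)"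
  by (rule categorical_penon_morphism.axioms(1))

sublocale penon_chain \<subseteq> dom: bridge_chain "\<lambda>n. pen_dom (P n)" E
proof (rule bridge_chain.intro)
  show "bridge_magma (pen_dom (P n))" for n
    by (rule penon_bridge_magma[OF chain_penon])
  show "E n \<in> bridge_hom (pen_dom (P n)) (pen_dom (P (Suc n)))" for n
    using chain_square by (simp add: Hom_Pen_Mor_iff)
qed

sublocale penon_chain \<subseteq> cod: bridge_chain "\<lambda>n. pen_cod (P n)" E'
proof (rule bridge_chain.intro)
  show "bridge_magma (pen_cod (P n))" for n
    by (rule categorical_penon_morphism_cod[OF chain_penon])
  show "E' n \<in> bridge_hom (pen_cod (P n)) (pen_cod (P (Suc n)))" for n
    using chain_square by (simp add: Hom_Pen_Mor_iff)
qed

context penon_chain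
begin

definition lim_map :: "'u cell_map" where
  "lim_map i = (\<lambda>d\<in>dom.lim_cells i. cod.code i (\<lambda>n. pen_map (P n) i (dom.rep i d n)))"

definition lim_penon :: "'u penon_morphism" where
  "lim_penon = \<lparr>pen_dom = dom.lim_magma, pen_cod = cod.lim_magma, pen_map = lim_map\<rparr>"

lemma lim_penon_sel [simp]:
  "pen_dom lim_penon = dom.lim_magma" "pen_cod lim_penon = cod.lim_magma" "pen_map lim_penon = lim_map"
  by (simp_all add: lim_penon_def)

lemma pen_map_hom: "pen_map (P n) \<in> bridge_hom (pen_dom (P n)) (pen_cod (P n))"
  by (rule categorical_penon_morphism.map_hom[OF chain_penon])

lemma pen_map_square:
  "a \<in> cells (pen_dom (P n)) i \<Longrightarrow> E' n i (pen_map (P n) i a) = pen_map (P (Suc n)) i (E n i a)"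
  using chain_square by (simp add: Hom_Pen_Mor_iff)

lemma thread_pen_map:
  "dom.cell_thread i x \<Longrightarrow> cod.cell_thread i (\<lambda>n. pen_map (P n) i (x n))"
  unfolding thread_def
  by (erule eventually_mono) (simp add: bridge_hom_in[OF pen_map_hom] pen_map_square)

lemma lim_map_in: "d \<in> dom.lim_cells i \<Longrightarrow> lim_map i d \<in> cod.lim_cells i"
  by (simp add: lim_map_def cod.code_in thread_pen_map dom.rep_thread)

lemma rep_lim_map:
  "d \<in> dom.lim_cells i \<Longrightarrow> ev_eq (cod.rep i (lim_map i d)) (\<lambda>n. pen_map (P n) i (dom.rep i d n))"
  by (simp add: lim_map_def cod.rep_code thread_pen_map dom.rep_thread)

lemma lim_map_hom: "lim_map \<in> bridge_hom dom.lim_magma cod.lim_magma"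
proof -
  note in_lim = dom.lim_in cod.lim_in lim_map_in
  note hD = globular_homD(4,5)[OF hom_globular(3)[OF pen_map_hom]] bridge_hom_idt[OF pen_map_hom]
  have "lim_map i (dm dom.lim i d) = dm cod.lim i (lim_map (Suc i) d)"
    "lim_map i (cd dom.lim i d) = cd cod.lim i (lim_map (Suc i) d)" if d: "d \<in> dom.lim_cells (Suc i)" for i d
  proof -
    show "lim_map i (dm dom.lim i d) = dm cod.lim i (lim_map (Suc i) d)"
      using rep_lim_map[OF d] rep_lim_map[OF dom.lim_in(1)[OF d]] cod.rep_dm[OF lim_map_in[OF d]]
        dom.rep_dm[OF d] dom.rep_in[OF d]
      by (intro cod.lim_eqI[of _ i], simp_all add: in_lim d, eventually_elim) (simp add: hD)
    show "lim_map i (cd dom.lim i d) = cd cod.lim i (lim_map (Suc i) d)"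
      using rep_lim_map[OF d] rep_lim_map[OF dom.lim_in(2)[OF d]] cod.rep_cd[OF lim_map_in[OF d]]
        dom.rep_cd[OF d] dom.rep_in[OF d]
      by (intro cod.lim_eqI[of _ i], simp_all add: in_lim d, eventually_elim) (simp add: hD)
  qed
  moreover have "lim_map (Suc i) (idt dom.lim i d) = idt cod.lim i (lim_map i d)"
    if d: "d \<in> dom.lim_cells i" for i d
    using rep_lim_map[OF d] rep_lim_map[OF dom.lim_in(3)[OF d]] cod.rep_idt[OF lim_map_in[OF d]]
      dom.rep_idt[OF d] dom.rep_in[OF d]
    by (intro cod.lim_eqI[of _ "Suc i"], simp_all add: in_lim d, eventually_elim) (simp add: hD)
  moreover have "lim_map i d = undefined" if "d \<notin> dom.lim_cells i" for i d
    using that by (simp add: lim_map_def)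
  ultimately have graph: "lim_map \<in> graph_hom dom.lim_magma cod.lim_magma"
    by (simp add: graph_hom_def globular_hom_def PiE_iff extensional_def lim_map_in)
  have "lim_map j (cmp dom.lim_magma i j a b) = cmp cod.lim_magma i j (lim_map j a) (lim_map j b)"
    if c: "composable dom.lim_magma i j a b" for i j a b
  proof -
    note cD = dom.composable_limD[OF c]
    note c' = hom_composable[OF dom.globular_set_lim_magma graph_hom_globular[OF graph] c]
    show ?thesis
      using rep_lim_map[OF cD(1)] rep_lim_map[OF cD(2)] rep_lim_map[OF dom.cmp_lim_in[OF c]]
        dom.rep_cmp[OF c] cod.rep_cmp[OF c'] cD(3)
      by (intro cod.lim_eqI[OF lim_map_in[OF dom.cmp_lim_in[OF c]] cod.cmp_lim_in[OF c']], eventually_elim)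
        (simp add: bridge_hom_cmp[OF pen_map_hom])
  qed
  moreover have "(lim_map i a, lim_map i b, lim_map (Suc i) c) \<in> bridge cod.lim_magma i"
    if abc: "(a, b, c) \<in> bridge dom.lim_magma i" for i a b c
  proof -
    have in_lim: "a \<in> dom.lim_cells i" "b \<in> dom.lim_cells i" "c \<in> dom.lim_cells (Suc i)"
      and ev: "\<forall>\<^sub>F n in sequentially.
        (dom.rep i a n, dom.rep i b n, dom.rep (Suc i) c n) \<in> bridge (pen_dom (P n)) i"
      using abc by (simp_all add: dom.bridge_lim_iff)
    have "\<forall>\<^sub>F n in sequentially. (cod.rep i (lim_map i a) n, cod.rep i (lim_map i b) n,
        cod.rep (Suc i) (lim_map (Suc i) c) n) \<in> bridge (pen_cod (P n)) i"
      using rep_lim_map[OF in_lim(1)] rep_lim_map[OF in_lim(2)] rep_lim_map[OF in_lim(3)] ev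
      by eventually_elim (simp add: bridge_hom_bridge[OF pen_map_hom])
    then show ?thesis by (simp add: cod.bridge_lim_iff lim_map_in in_lim)
  qed
  ultimately show ?thesis using graph by (simp add: bridge_hom_def magma_hom_def)
qed

text \<open>A bridge of the colimit is a bridge at late stages, where the relation is diagonal; so
  its two ends agree eventually and its third cell is eventually an identity.\<close>

lemma lim_cod_bridge: "bridge cod.lim_magma = diagonal_bridge cod.lim_magma"
proof (rule ext)
  fix i
  have diag: "bridge (pen_cod (P n)) i = diagonal_bridge (pen_cod (P n)) i" for n
    by (simp add: categorical_penon_morphism.cod_bridge[OF chain_penon])
  show "bridge cod.lim_magma i = diagonal_bridge cod.lim_magma i"
  proof
    show "diagonal_bridge cod.lim_magma i \<subseteq> bridge cod.lim_magma i"
      using cod.bridge_relation_lim by (auto simp: diagonal_bridge_def bridge_relation_def)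
    show "bridge cod.lim_magma i \<subseteq> diagonal_bridge cod.lim_magma i"
    proof
      fix t assume t: "t \<in> bridge cod.lim_magma i"
      obtain a b c where abc: "t = (a, b, c)" by (cases t)
      have in_lim: "a \<in> cod.lim_cells i" "b \<in> cod.lim_cells i" "c \<in> cod.lim_cells (Suc i)"
        and ev: "\<forall>\<^sub>F n in sequentially.
          (cod.rep i a n, cod.rep i b n, cod.rep (Suc i) c n) \<in> bridge (pen_cod (P n)) i"
        using t by (simp_all add: abc cod.bridge_lim_iff)
      from ev have ev': "\<forall>\<^sub>F n in sequentially. cod.rep i a n = cod.rep i b n \<and>
          cod.rep (Suc i) c n = idt (pen_cod (P n)) i (cod.rep i a n)"
        by (rule eventually_mono) (simp add: diag diagonal_bridge_def)
      have "a = b"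
        using ev' by (intro cod.lim_eqI[OF in_lim(1,2)]) (auto elim: eventually_mono)
      moreover have "c = idt cod.lim i a"
        using ev' cod.rep_idt[OF in_lim(1)]
        by (intro cod.lim_eqI[OF in_lim(3) cod.lim_in(3)[OF in_lim(1)]], eventually_elim) simp
      ultimately show "t \<in> diagonal_bridge cod.lim_magma i"
        using in_lim by (simp add: abc diagonal_bridge_def)
    qed
  qed
qed

theorem categorical_penon_morphism_lim: "categorical_penon_morphism lim_penon"
proof -
  interpret d: bridge_magma "pen_dom lim_penon" using dom.bridge_magma_lim by simp
  interpret c: strict_omega_category "pen_cod lim_penon"
    using cod.strict_lim[OF categorical_penon_morphism.axioms(2)[OF chain_penon]] by simp
  show ?thesis
  proof
    show "bridge (pen_cod lim_penon) = diagonal_bridge (pen_cod lim_penon)"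
      using lim_cod_bridge by simp
    show "pen_map lim_penon \<in> bridge_hom (pen_dom lim_penon) (pen_cod lim_penon)"
      using lim_map_hom by simp
  next
    fix a b c i assume "(a, b, c) \<in> bridge (pen_dom lim_penon) i"
    then have "(lim_map i a, lim_map i b, lim_map (Suc i) c) \<in> diagonal_bridge cod.lim_magma i"
      using bridge_hom_bridge[OF lim_map_hom] lim_cod_bridge by simp
    then show "pen_map lim_penon i a = pen_map lim_penon i b \<and>
        pen_map lim_penon (Suc i) c = idt (pen_cod lim_penon) i (pen_map lim_penon i a)"
      by (simp add: diagonal_bridge_def)
  next
    fix i a b
    assume "parallel (pen_dom lim_penon) i a b" and eq: "pen_map lim_penon i a = pen_map lim_penon i b"
    then have in_lim: "a \<in> dom.lim_cells i" "b \<in> dom.lim_cells i"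
      and par: "\<forall>\<^sub>F n in sequentially. parallel (pen_dom (P n)) i (dom.rep i a n) (dom.rep i b n)"
      by (simp_all add: dom.parallel_lim_iff)
    \<comment> \<open>Candidate for the bridge: at every late stage the representatives are parallel
      with equal images, so a bridge exists there and one is chosen.\<close>
    define z where "z n = (SOME c. (dom.rep i a n, dom.rep i b n, c) \<in> bridge (pen_dom (P n)) i)" for n
    have "\<forall>\<^sub>F n in sequentially. pen_map (P n) i (dom.rep i a n) = pen_map (P n) i (dom.rep i b n)"
      using rep_lim_map[OF in_lim(1)] rep_lim_map[OF in_lim(2)] by eventually_elim (use eq in simp)
    with par have br: "\<forall>\<^sub>F n in sequentially.
      (dom.rep i a n, dom.rep i b n, z n) \<in> bridge (pen_dom (P n)) i"
    proof eventually_elim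
      case (elim n)
      show ?case unfolding z_def
        by (rule someI_ex) (rule categorical_penon_morphism.bridge_exists[OF chain_penon elim])
    qed
    have th: "dom.cell_thread (Suc i) z"
      using br eventually_Suc[OF br] dom.rep_thread[OF in_lim(1), unfolded thread_def]
        dom.rep_thread[OF in_lim(2), unfolded thread_def]
      unfolding thread_def
    proof eventually_elim
      case (elim n)
      \<comment> \<open>The transition map sends the bridge at stage \<open>n\<close> to a bridge
        between the same cells as the one chosen at the next stage. Bridges being unique, the two
        coincide, so the independent choices form a thread.\<close>
      have "(dom.rep i a (Suc n), dom.rep i b (Suc n), E n (Suc i) (z n)) \<in> bridge (pen_dom (P (Suc n))) i"
        using bridge_hom_bridge[OF dom.chain_bridge_hom elim(1)] elim(3,4) by simp
      then show ?case
        using bridge_unique[OF dom.chain_bridge elim(2)] bridge_cells(3)[OF dom.chain_bridge elim(1)]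
        by simp
    qed
    have "\<forall>\<^sub>F n in sequentially. (dom.rep i a n, dom.rep i b n, dom.rep (Suc i) (dom.code (Suc i) z) n)
        \<in> bridge (pen_dom (P n)) i"
      using br dom.rep_code[OF th] by eventually_elim simp
    then show "\<exists>c. (a, b, c) \<in> bridge (pen_dom lim_penon) i"
      using in_lim dom.code_in[OF th] by (auto simp: dom.bridge_lim_iff)
  qed
qed

lemma desc_square:
  assumes "dom.cocone F" "cod.cocone G" and sq: "\<And>n. (F n, G n) \<in> Hom Pen_Mor (P n) Q"
  shows "(dom.desc F, cod.desc G) \<in> Hom Pen_Mor lim_penon Q"
proof -
  have hom: "F n \<in> bridge_hom (pen_dom (P n)) (pen_dom Q)" "G n \<in> bridge_hom (pen_cod (P n)) (pen_cod Q)"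
    "a \<in> cells (pen_dom (P n)) i \<Longrightarrow> G n i (pen_map (P n) i a) = pen_map Q i (F n i a)" for n i a
    using sq[of n] by (simp_all add: Hom_Pen_Mor_iff)
  have "cod.desc G i (lim_map i d) = pen_map Q i (dom.desc F i d)" if d: "d \<in> dom.lim_cells i" for i d
  proof -
    have "\<forall>\<^sub>F n in sequentially. cod.desc G i (lim_map i d) = pen_map Q i (dom.desc F i d)"
      using dom.desc_ev[OF assms(1) d] cod.desc_ev[OF assms(2) lim_map_in[OF d]] rep_lim_map[OF d]
        dom.rep_in[OF d]
      by eventually_elim (use hom(3) in force)
    then show ?thesis by simp
  qed
  then show ?thesis
    using dom.desc_bridge_hom[OF assms(1) hom(1)] cod.desc_bridge_hom[OF assms(2) hom(2)]
    by (simp add: Hom_Pen_Mor_iff)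
qed

end

section \<open>The free Penon morphism and its monad\<close>

context adjunction
begin

text \<open>Naturality of the counit moves \<open>f\<close> past \<open>\<epsilon>\<close>, and
  \<open>triangle_left\<close> removes what remains. Consequently a morphism out of a free object is
  determined by its restriction along the unit.\<close>

lemma transpose_recover:
  assumes X: "X \<in> Ob C" and A: "A \<in> Ob D" and f: "f \<in> Hom D (omap L X) A"
  shows "Comp D (omap L X) (omap L (omap R A)) A (\<epsilon> A)
    (amap L X (omap R A) (Comp C X (omap R (omap L X)) (omap R A) (amap R (omap L X) A f) (\<eta> X))) = f"
proof -
  let ?LX = "omap L X" and ?RLX = "omap R (omap L X)" and ?RA = "omap R A"
  have ob: "?LX \<in> Ob D" "?RLX \<in> Ob C" "?RA \<in> Ob C" "omap L ?RLX \<in> Ob D" "omap L ?RA \<in> Ob D"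
    using X A by (simp_all add: left.omap_in right.omap_in)
  have \<eta>: "\<eta> X \<in> Hom C X ?RLX"
    using unit.component_in[OF X] by (simp add: id_functor_def comp_functor_def)
  have \<epsilon>: "\<epsilon> A \<in> Hom D (omap L ?RA) A" "\<epsilon> ?LX \<in> Hom D (omap L ?RLX) ?LX"
    using counit.component_in[OF A] counit.component_in[OF ob(1)]
    by (simp_all add: id_functor_def comp_functor_def)
  note Rf = right.amap_in[OF ob(1) A f]
  note LRf = left.amap_in[OF ob(2,3) Rf] and L\<eta> = left.amap_in[OF X ob(2) \<eta>]
  have "Comp D ?LX (omap L ?RA) A (\<epsilon> A) (amap L X ?RA (Comp C X ?RLX ?RA (amap R ?LX A f) (\<eta> X)))
      = Comp D ?LX (omap L ?RLX) A
          (Comp D (omap L ?RLX) (omap L ?RA) A (\<epsilon> A) (amap L ?RLX ?RA (amap R ?LX A f)))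
          (amap L X ?RLX (\<eta> X))"
    by (simp add: left.amap_Comp[OF X ob(2,3) \<eta> Rf] left.target.Comp_assoc[OF ob(1,4,5) A L\<eta> LRf \<epsilon>(1)])
  also have "Comp D (omap L ?RLX) (omap L ?RA) A (\<epsilon> A) (amap L ?RLX ?RA (amap R ?LX A f))
      = Comp D (omap L ?RLX) ?LX A f (\<epsilon> ?LX)"
    using counit.natural[OF ob(1) A f] by (simp add: id_functor_def comp_functor_def)
  also have "Comp D ?LX (omap L ?RLX) A (Comp D (omap L ?RLX) ?LX A f (\<epsilon> ?LX)) (amap L X ?RLX (\<eta> X))
      = Comp D ?LX ?LX A f (Comp D ?LX (omap L ?RLX) ?LX (\<epsilon> ?LX) (amap L X ?RLX (\<eta> X)))"
    by (simp add: left.target.Comp_assoc[OF ob(1,4,1) A L\<eta> \<epsilon>(2) f])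
  also have "\<dots> = f"
    by (simp add: triangle_left[OF X] left.target.Comp_Id_right[OF ob(1) A f])
  finally show ?thesis .
qed

text \<open>The witness is \<open>L h\<close> followed by the counit; naturality of the unit and
  \<open>triangle_right\<close> give back \<open>h\<close>.\<close>

lemma transpose_exists:
  assumes X: "X \<in> Ob C" and A: "A \<in> Ob D" and h: "h \<in> Hom C X (omap R A)"
  shows "\<exists>f\<in>Hom D (omap L X) A.
    Comp C X (omap R (omap L X)) (omap R A) (amap R (omap L X) A f) (\<eta> X) = h"
proof
  let ?LX = "omap L X" and ?RLX = "omap R (omap L X)" and ?RA = "omap R A"
  let ?LRA = "omap L (omap R A)"
  let ?f = "Comp D ?LX ?LRA A (\<epsilon> A) (amap L X ?RA h)"
  have ob: "?LX \<in> Ob D" "?RLX \<in> Ob C" "?RA \<in> Ob C" "?LRA \<in> Ob D" "omap R ?LRA \<in> Ob C"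
    using X A by (simp_all add: left.omap_in right.omap_in)
  have \<eta>: "\<eta> X \<in> Hom C X ?RLX" "\<eta> ?RA \<in> Hom C ?RA (omap R ?LRA)"
    using unit.component_in[OF X] unit.component_in[OF ob(3)]
    by (simp_all add: id_functor_def comp_functor_def)
  have \<epsilon>: "\<epsilon> A \<in> Hom D ?LRA A"
    using counit.component_in[OF A] by (simp add: id_functor_def comp_functor_def)
  note Lh = left.amap_in[OF X ob(3) h]
  note RLh = right.amap_in[OF ob(1,4) Lh] and R\<epsilon> = right.amap_in[OF ob(4) A \<epsilon>]
  show "?f \<in> Hom D ?LX A"
    by (rule left.target.Comp_in[OF ob(1,4) A Lh \<epsilon>])
  have "Comp C X ?RLX ?RA (amap R ?LX A ?f) (\<eta> X)
      = Comp C X (omap R ?LRA) ?RA (amap R ?LRA A (\<epsilon> A))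
          (Comp C X ?RLX (omap R ?LRA) (amap R ?LX ?LRA (amap L X ?RA h)) (\<eta> X))"
    by (simp add: right.amap_Comp[OF ob(1,4) A Lh \<epsilon>] left.source.Comp_assoc[OF X ob(2,5,3) \<eta>(1) RLh R\<epsilon>])
  also have "Comp C X ?RLX (omap R ?LRA) (amap R ?LX ?LRA (amap L X ?RA h)) (\<eta> X)
      = Comp C X ?RA (omap R ?LRA) (\<eta> ?RA) h"
    using unit.natural[OF X ob(3) h] by (simp add: id_functor_def comp_functor_def)
  also have "Comp C X (omap R ?LRA) ?RA (amap R ?LRA A (\<epsilon> A)) \<dots> = h"
    by (simp add: left.source.Comp_assoc[OF X ob(3,5,3) h \<eta>(2) R\<epsilon>] triangle_right[OF A]
        left.source.Comp_Id_left[OF X ob(3) h])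
  finally show "Comp C X ?RLX ?RA (amap R ?LX A ?f) (\<eta> X) = h" .
qed

end

lemma graph_hom_underlying_left [simp]: "graph_hom (underlying_graph X) Y = graph_hom X Y"
  and graph_hom_underlying_right [simp]: "graph_hom X (underlying_graph Y) = graph_hom X Y"
  by (simp_all add: graph_hom_def globular_hom_def)

lemma Omega_Graph_sel [simp]:
  "X \<in> Ob Omega_Graph \<longleftrightarrow> omega_graph X" "Hom Omega_Graph = graph_hom"
  "Ident Omega_Graph = fam_id" "Comp Omega_Graph X Y Z = fam_comp X"
  by (simp_all add: Omega_Graph_def)

lemma U_GP_sel [simp]:
  "omap U_GP P = underlying_graph (pen_dom P)" "amap U_GP P Q f = fst f"
  by (simp_all add: U_GP_def split_beta)

lemma Ob_Pen_Mor_iff [simp]: "P \<in> Ob Pen_Mor \<longleftrightarrow> categorical_penon_morphism P"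
  by (simp add: Pen_Mor_def)

lemma Comp_Pen_Mor:
  "Comp Pen_Mor P Q S g f =
    (fam_comp (pen_dom P) (fst g) (fst f), fam_comp (pen_cod P) (snd g) (snd f))"
  by (simp add: Pen_Mor_def split_beta)

lemma Ident_Pen_Mor: "Ident Pen_Mor P = (fam_id (pen_dom P), fam_id (pen_cod P))"
  by (simp add: Pen_Mor_def)

lemma graph_hom_in: "F \<in> graph_hom X Y \<Longrightarrow> a \<in> cells X i \<Longrightarrow> F i a \<in> cells Y i"
  by (rule globular_homD(2)[OF graph_hom_globular])

lemma graph_homD:
  assumes "F \<in> graph_hom X Y"
  shows "a \<in> cells X (Suc i) \<Longrightarrow> F i (dm X i a) = dm Y i (F (Suc i) a)"
    and "a \<in> cells X (Suc i) \<Longrightarrow> F i (cd X i a) = cd Y i (F (Suc i) a)"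
    and "a \<in> cells X i \<Longrightarrow> F (Suc i) (idt X i a) = idt Y i (F i a)"
  using globular_homD(4,5)[OF graph_hom_globular[OF assms]] assms by (auto simp: graph_hom_def)

lemma graph_hom_eqI:
  assumes "F \<in> graph_hom X Y" "G \<in> graph_hom X Z"
    and "\<And>i a. a \<in> cells X i \<Longrightarrow> F i a = G i a"
  shows "F = G"
proof (intro ext)
  show "F i a = G i a" for i a
    using assms(3) globular_homD(3)[OF graph_hom_globular[OF assms(1)]]
      globular_homD(3)[OF graph_hom_globular[OF assms(2)]] by (cases "a \<in> cells X i") simp_all
qed

locale free_penon = adjunction Omega_Graph Pen_Mor L U_GP \<eta> \<epsilon>
  for L :: "'u free_penon_functor" and \<eta> :: "'u omega_graph \<Rightarrow> 'u cell_map"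
    and \<epsilon> :: "'u penon_morphism \<Rightarrow> 'u cell_map \<times> 'u cell_map"
begin

abbreviation M :: "'u omega_graph \<Rightarrow> 'u bridge_magma" where
  "M Y \<equiv> pen_dom (omap L Y)"

abbreviation TG :: "'u omega_graph \<Rightarrow> 'u omega_graph" where
  "TG Y \<equiv> underlying_graph (M Y)"

definition T :: "'u omega_graph \<Rightarrow> 'u omega_graph \<Rightarrow> 'u cell_map \<Rightarrow> 'u cell_map" where
  "T Y Z f = fst (amap L Y Z f)"

text \<open>The multiplication of the monad: \<open>U_GP\<close> keeps the first component of the
  counit. It is moreover a bridge morphism, so it respects composites and not only the graph
  structure.\<close>

definition mult :: "'u omega_graph \<Rightarrow> 'u cell_map" where
  "mult Y = fst (\<epsilon> (omap L Y))"

lemma penon_free: "omega_graph Y \<Longrightarrow> categorical_penon_morphism (omap L Y)"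
  using left.omap_in[of Y] by simp

lemma M_bridge_magma: "omega_graph Y \<Longrightarrow> bridge_magma (M Y)"
  by (rule penon_bridge_magma[OF penon_free])

lemma M_graph: "omega_graph Y \<Longrightarrow> omega_graph (M Y)"
  by (rule bridge_magma_graph[OF M_bridge_magma])

lemma TG_graph: "omega_graph Y \<Longrightarrow> omega_graph (TG Y)"
  by (rule underlying_graph_omega_graph[OF M_graph])

lemma free_square:
  "\<lbrakk>omega_graph Y; omega_graph Z; f \<in> graph_hom Y Z\<rbrakk> \<Longrightarrow>
    (T Y Z f, snd (amap L Y Z f)) \<in> Hom Pen_Mor (omap L Y) (omap L Z)"
  using left.amap_in[of Y Z f] by (simp add: T_def)

lemma T_bridge_hom:
  "\<lbrakk>omega_graph Y; omega_graph Z; f \<in> graph_hom Y Z\<rbrakk> \<Longrightarrow> T Y Z f \<in> bridge_hom (M Y) (M Z)"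
  using free_square[of Y Z f] by (simp add: Hom_Pen_Mor_iff)

lemma T_hom:
  "\<lbrakk>omega_graph Y; omega_graph Z; f \<in> graph_hom Y Z\<rbrakk> \<Longrightarrow> T Y Z f \<in> graph_hom (M Y) (M Z)"
  by (rule magma_hom_graph[OF bridge_hom_magma[OF T_bridge_hom]])

lemma T_id: "omega_graph Y \<Longrightarrow> T Y Y (fam_id Y) = fam_id (M Y)"
  using left.amap_Id[of Y] by (simp add: T_def Ident_Pen_Mor)

lemma T_comp:
  assumes "omega_graph X" "omega_graph Y" "omega_graph Z" "f \<in> graph_hom X Y" "g \<in> graph_hom Y Z"
  shows "T X Z (fam_comp X g f) = fam_comp (M X) (T Y Z g) (T X Y f)"
  using left.amap_Comp[of X Y Z f g] assms by (simp add: T_def Comp_Pen_Mor)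

lemma T_comp_apply:
  assumes "omega_graph X" "omega_graph Y" "omega_graph Z" "f \<in> graph_hom X Y" "g \<in> graph_hom Y Z"
    and "z \<in> cells (M X) i"
  shows "T Y Z g i (T X Y f i z) = T X Z (fam_comp X g f) i z"
  using T_comp[OF assms(1-5)] assms(6) by simp

lemma \<eta>_hom: "omega_graph Y \<Longrightarrow> \<eta> Y \<in> graph_hom Y (M Y)"
  using unit.component_in[of Y] by (simp add: id_functor_def comp_functor_def)

lemma \<eta>_natural:
  assumes "omega_graph Y" "omega_graph Z" "f \<in> graph_hom Y Z" "a \<in> cells Y i"
  shows "T Y Z f i (\<eta> Y i a) = \<eta> Z i (f i a)"
proof -
  have "fam_comp Y (\<eta> Z) f = fam_comp Y (T Y Z f) (\<eta> Y)"
    using unit.natural[of Y Z f] assms by (simp add: id_functor_def comp_functor_def T_def)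
  then show ?thesis using assms(4) by (simp add: fam_comp_eq_iff)
qed

lemma mult_bridge_hom: "omega_graph Y \<Longrightarrow> mult Y \<in> bridge_hom (M (TG Y)) (M Y)"
  using counit.component_in[of "omap L Y"] penon_free[of Y] prod.collapse[of "\<epsilon> (omap L Y)"]
    Hom_Pen_Mor_iff[of "fst (\<epsilon> (omap L Y))" "snd (\<epsilon> (omap L Y))"]
  by (simp add: id_functor_def comp_functor_def mult_def)

lemma mult_hom: "omega_graph Y \<Longrightarrow> mult Y \<in> graph_hom (M (TG Y)) (M Y)"
  by (rule magma_hom_graph[OF bridge_hom_magma[OF mult_bridge_hom]])

lemma mult_\<eta>:
  assumes "omega_graph Y" "z \<in> cells (M Y) i" shows "mult Y i (\<eta> (TG Y) i z) = z"
proof -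
  have "fam_comp (M Y) (mult Y) (\<eta> (TG Y)) = fam_id (M Y)"
    using triangle_right[of "omap L Y"] penon_free[OF assms(1)] by (simp add: mult_def)
  then have "fam_comp (M Y) (mult Y) (\<eta> (TG Y)) i z = fam_id (M Y) i z" by simp
  then show ?thesis using assms(2) by simp
qed

lemma mult_natural:
  assumes "omega_graph Y" "omega_graph Z" "f \<in> graph_hom Y Z" "z \<in> cells (M (TG Y)) i"
  shows "T Y Z f i (mult Y i z) = mult Z i (T (TG Y) (TG Z) (T Y Z f) i z)"
proof -
  have "fam_comp (M (TG Y)) (T Y Z f) (mult Y) = fam_comp (M (TG Y)) (mult Z) (T (TG Y) (TG Z) (T Y Z f))"
    using counit.natural[of "omap L Y" "omap L Z" "amap L Y Z f"] assms penon_free left.amap_in[of Y Z f]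
    by (simp add: id_functor_def comp_functor_def mult_def T_def Comp_Pen_Mor)
  then show ?thesis using assms(4) by (simp add: fam_comp_eq_iff)
qed

lemma extend_exists:
  assumes Y: "omega_graph Y" and P: "categorical_penon_morphism P" and f: "f \<in> graph_hom Y (pen_dom P)"
  obtains F G where "(F, G) \<in> Hom Pen_Mor (omap L Y) P"
    and "\<And>i a. a \<in> cells Y i \<Longrightarrow> F i (\<eta> Y i a) = f i a"
proof -
  obtain g where g: "g \<in> Hom Pen_Mor (omap L Y) P" "fam_comp Y (fst g) (\<eta> Y) = f"
    using transpose_exists[of Y P f] Y P f by auto
  show ?thesis
  proof (rule that)
    show "(fst g, snd g) \<in> Hom Pen_Mor (omap L Y) P" using g(1) by simp
    show "fst g i (\<eta> Y i a) = f i a" if "a \<in> cells Y i" for i a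
      using that g(2) by (metis fam_comp_apply)
  qed
qed

text \<open>Agreement of the domain components on generators forces equality of whole squares,
  codomain components included, because the transpose only sees the former.\<close>

lemma extend_unique:
  assumes Y: "omega_graph Y" and P: "categorical_penon_morphism P"
    and g: "g \<in> Hom Pen_Mor (omap L Y) P" and g': "g' \<in> Hom Pen_Mor (omap L Y) P"
    and eq: "\<And>i a. a \<in> cells Y i \<Longrightarrow> fst g i (\<eta> Y i a) = fst g' i (\<eta> Y i a)"
  shows "g = g'"
proof -
  have "fam_comp Y (fst g) (\<eta> Y) = fam_comp Y (fst g') (\<eta> Y)"
    using eq by (simp add: fam_comp_eq_iff)
  then show ?thesis
    using transpose_recover[of Y P g] transpose_recover[of Y P g'] Y P g g' by simp
qed

text \<open>The colimit of the free Penon morphisms on the graphs of the sequence is a retract of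
  (in fact isomorphic to) the one on the colimit graph.\<close>

theorem free_finitary:
  fixes X :: "nat \<Rightarrow> 'u omega_graph"
  assumes "graph_chain X E" and z: "z \<in> cells (M (graph_chain.lim X E)) i"
  obtains n y where "y \<in> cells (M (X n)) i"
    and "z = T (X n) (graph_chain.lim X E) (graph_chain.iota X E n) i y"
proof -
  interpret graph_chain X E by fact
  note gX = chain_graph and gl = omega_graph_lim
  interpret c: penon_chain "\<lambda>n. omap L (X n)" "\<lambda>n. T (X n) (X (Suc n)) (E n)"
      "\<lambda>n. snd (amap L (X n) (X (Suc n)) (E n))"
    by (rule penon_chain.intro) (simp_all add: penon_free gX free_square chain_map)
  define F G where "F n = T (X n) lim (iota n)" and "G n = snd (amap L (X n) lim (iota n))" for n
  have step: "iota n = fam_comp (X n) (iota (Suc n)) (E n)" for n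
    by (rule graph_hom_eqI[OF iota_hom graph_hom_comp[OF gX chain_map iota_hom]]) (simp add: iota_step)
  have L_step: "amap L (X n) lim (iota n) = Comp Pen_Mor (omap L (X n)) (omap L (X (Suc n))) (omap L lim)
      (amap L (X (Suc n)) lim (iota (Suc n))) (amap L (X n) (X (Suc n)) (E n))" for n
    using left.amap_Comp[of "X n" "X (Suc n)" lim "E n" "iota (Suc n)"] step[of n]
    by (simp add: gX gl chain_map iota_hom)
  have "F n = fam_comp (M (X n)) (F (Suc n)) (T (X n) (X (Suc n)) (E n))"
    "G n = fam_comp (pen_cod (omap L (X n))) (G (Suc n)) (snd (amap L (X n) (X (Suc n)) (E n)))" for n
    using arg_cong[OF L_step[of n], of fst] arg_cong[OF L_step[of n], of snd]
    by (simp_all add: F_def G_def T_def Comp_Pen_Mor)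
  then have FG_step: "a \<in> cells (M (X n)) j \<Longrightarrow> F (Suc n) j (T (X n) (X (Suc n)) (E n) j a) = F n j a"
    "b \<in> cells (pen_cod (omap L (X n))) j
      \<Longrightarrow> G (Suc n) j (snd (amap L (X n) (X (Suc n)) (E n)) j b) = G n j b" for n j a b
    by (metis fam_comp_apply)+
  have cF: "c.dom.cocone F" and cG: "c.cod.cocone G"
    by (simp_all add: c.dom.cocone_def c.cod.cocone_def FG_step)
  \<comment> \<open>The comparison from the colimit of the free Penon morphisms to the free one on
    the colimit graph; it remains to show that it hits every cell of \<open>M lim\<close>.\<close>
  have \<psi>: "(c.dom.desc F, c.cod.desc G) \<in> Hom Pen_Mor c.lim_penon (omap L lim)"
    unfolding F_def G_def
    by (rule c.desc_square[OF cF[unfolded F_def] cG[unfolded G_def] free_square[OF gX gl iota_hom]])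
  \<comment> \<open>Generators of each stage, placed in the colimit of the free magmas. The induced
    graph map on \<open>lim\<close> extends, by freeness, to a square
    \<open>(\<phi>1, \<phi>2)\<close> in the opposite direction.\<close>
  define g where "g n = fam_comp (X n) (c.dom.iota n) (\<eta> (X n))" for n
  have g_apply: "g n j a = c.dom.iota n j (\<eta> (X n) j a)" if "a \<in> cells (X n) j" for n j a
    using that by (simp add: g_def)
  have cg: "cocone g"
    unfolding cocone_def
  proof (intro allI ballI)
    fix n j a assume a: "a \<in> cells (X n) j"
    show "g (Suc n) j (E n j a) = g n j a"
      using c.dom.iota_step[OF graph_hom_in[OF \<eta>_hom[OF gX] a]]
        \<eta>_natural[OF gX gX chain_map a]
      by (simp add: g_apply a chain_mapD)
  qed
  have "desc g \<in> graph_hom lim c.dom.lim"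
    by (rule desc_hom[OF cg]) (simp add: g_def graph_hom_comp[OF gX \<eta>_hom[OF gX] c.dom.iota_hom])
  then have "desc g \<in> graph_hom lim (pen_dom c.lim_penon)"
    by (simp add: graph_hom_def globular_hom_def)
  then obtain \<phi>1 \<phi>2 where \<phi>: "(\<phi>1, \<phi>2) \<in> Hom Pen_Mor (omap L lim) c.lim_penon"
    and \<phi>_\<eta>: "\<And>j d. d \<in> cells lim j \<Longrightarrow> \<phi>1 j (\<eta> lim j d) = desc g j d"
    using extend_exists[OF gl c.categorical_penon_morphism_lim] by blast
  \<comment> \<open>The composite fixes all generators, hence is the identity. So \<open>z\<close>
    is the image of \<open>\<phi>1 i z\<close>, and that cell, lying in a sequential colimit, comes
    from a single stage.\<close>
  have "Comp Pen_Mor (omap L lim) c.lim_penon (omap L lim) (c.dom.desc F, c.cod.desc G) (\<phi>1, \<phi>2)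
      = Ident Pen_Mor (omap L lim)"
  proof (rule extend_unique[OF gl penon_free[OF gl]])
    show "Comp Pen_Mor (omap L lim) c.lim_penon (omap L lim) (c.dom.desc F, c.cod.desc G) (\<phi>1, \<phi>2)
        \<in> Hom Pen_Mor (omap L lim) (omap L lim)"
      using \<phi> \<psi> c.categorical_penon_morphism_lim penon_free[OF gl]
      by (intro left.target.Comp_in) simp_all
    show "Ident Pen_Mor (omap L lim) \<in> Hom Pen_Mor (omap L lim) (omap L lim)"
      using penon_free[OF gl] by (intro left.target.Id_in) simp
    fix j d assume d: "d \<in> cells lim j"
    then have "d \<in> lim_cells j" by simp
    then obtain n a where a: "a \<in> cells (X n) j" "d = iota n j a"
      by (rule lim_cases)
    have "c.dom.desc F j (desc g j d) = \<eta> lim j d"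
      using desc_iota[OF cg a(1)] c.dom.desc_iota[OF cF graph_hom_in[OF \<eta>_hom[OF gX] a(1)]]
        \<eta>_natural[OF gX gl iota_hom a(1)]
      by (simp add: a(2) g_apply[OF a(1)] F_def)
    then show "fst (Comp Pen_Mor (omap L lim) c.lim_penon (omap L lim) (c.dom.desc F, c.cod.desc G) (\<phi>1, \<phi>2))
        j (\<eta> lim j d) = fst (Ident Pen_Mor (omap L lim)) j (\<eta> lim j d)"
      using graph_hom_in[OF \<eta>_hom[OF gl] d] \<phi>_\<eta>[OF d] by (simp add: Comp_Pen_Mor Ident_Pen_Mor)
  qed
  then have "fam_comp (M lim) (c.dom.desc F) \<phi>1 = fam_id (M lim)"
    by (simp add: Comp_Pen_Mor Ident_Pen_Mor)
  then have "c.dom.desc F i (\<phi>1 i z) = z"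
    using z fam_comp_apply[OF z, of "c.dom.desc F" \<phi>1] by simp
  moreover have "\<phi>1 i z \<in> c.dom.lim_cells i"
    using \<phi> bridge_hom_in[of \<phi>1 "M lim" c.dom.lim_magma z i] z by (simp add: Hom_Pen_Mor_iff)
  then obtain n y where "y \<in> cells (M (X n)) i" "\<phi>1 i z = c.dom.iota n i y"
    by (rule c.dom.lim_cases)
  ultimately show ?thesis
    using that[of y n] c.dom.desc_iota[OF cF] by (simp add: F_def)
qed

end

section \<open>The quotient by a joint kernel\<close>

locale joint_kernel =
  fixes G :: "('u, 'z) omega_graph_scheme" and I :: "'s set" and \<psi> :: "'s \<Rightarrow> 'u cell_map"
    and B :: "'s \<Rightarrow> 'u omega_graph"
  assumes G_graph: "omega_graph G" and \<psi>_hom: "s \<in> I \<Longrightarrow> \<psi> s \<in> graph_hom G (B s)"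

text \<open>The classes are represented by chosen cells of \<open>G\<close>, so that the quotient lives in the same type.\<close>

definition joint_rep ::
    "('u, 'z) omega_graph_scheme \<Rightarrow> 's set \<Rightarrow> ('s \<Rightarrow> 'u cell_map) \<Rightarrow> 'u cell_map" where
  "joint_rep G I \<psi> i = (\<lambda>z\<in>cells G i. SOME z'. z' \<in> cells G i \<and> (\<forall>s\<in>I. \<psi> s i z' = \<psi> s i z))"

definition joint_quotient ::
    "('u, 'z) omega_graph_scheme \<Rightarrow> 's set \<Rightarrow> ('s \<Rightarrow> 'u cell_map) \<Rightarrow> 'u omega_graph" where
  "joint_quotient G I \<psi> =
    \<lparr>cells = (\<lambda>i. joint_rep G I \<psi> i ` cells G i),
     dm = (\<lambda>i. \<lambda>z\<in>joint_rep G I \<psi> (Suc i) ` cells G (Suc i). joint_rep G I \<psi> i (dm G i z)),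
     cd = (\<lambda>i. \<lambda>z\<in>joint_rep G I \<psi> (Suc i) ` cells G (Suc i). joint_rep G I \<psi> i (cd G i z)),
     idt = (\<lambda>i. \<lambda>z\<in>joint_rep G I \<psi> i ` cells G i. joint_rep G I \<psi> (Suc i) (idt G i z))\<rparr>"

text \<open>Cells of the quotient are themselves cells of \<open>G\<close>, so the induced map is a
  plain restriction.\<close>

definition joint_induced ::
    "('u, 'z) omega_graph_scheme \<Rightarrow> 's set \<Rightarrow> ('s \<Rightarrow> 'u cell_map) \<Rightarrow> 's \<Rightarrow> 'u cell_map" where
  "joint_induced G I \<psi> s i = (\<lambda>a\<in>cells (joint_quotient G I \<psi>) i. \<psi> s i a)"

context joint_kernel
begin

abbreviation q :: "'u cell_map" where "q \<equiv> joint_rep G I \<psi>"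
abbreviation Q :: "'u omega_graph" where "Q \<equiv> joint_quotient G I \<psi>"

lemma q_spec:
  assumes "z \<in> cells G i"
  shows "q i z \<in> cells G i" "s \<in> I \<Longrightarrow> \<psi> s i (q i z) = \<psi> s i z"
proof -
  have "\<exists>z'. z' \<in> cells G i \<and> (\<forall>s\<in>I. \<psi> s i z' = \<psi> s i z)" using assms by blast
  then have "q i z \<in> cells G i \<and> (\<forall>s\<in>I. \<psi> s i (q i z) = \<psi> s i z)"
    unfolding joint_rep_def using someI_ex[of "\<lambda>z'. z' \<in> cells G i \<and> (\<forall>s\<in>I. \<psi> s i z' = \<psi> s i z)"] assms
    by simp
  then show "q i z \<in> cells G i" "s \<in> I \<Longrightarrow> \<psi> s i (q i z) = \<psi> s i z" by simp_all
qed

text \<open>The predicate from which the representative is chosen depends on a cell only through its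
  values under all \<open>\<psi> s\<close>; for related cells it is the same predicate, hence the
  same choice.\<close>

lemma q_eqI:
  assumes "z \<in> cells G i" "z' \<in> cells G i" "\<And>s. s \<in> I \<Longrightarrow> \<psi> s i z = \<psi> s i z'"
  shows "q i z = q i z'"
proof -
  have "(\<lambda>y. y \<in> cells G i \<and> (\<forall>s\<in>I. \<psi> s i y = \<psi> s i z)) = (\<lambda>y. y \<in> cells G i \<and> (\<forall>s\<in>I. \<psi> s i y = \<psi> s i z'))"
    using assms(3) by auto
  then show ?thesis using assms(1,2) by (simp add: joint_rep_def)
qed

lemma Q_cells: "cells Q i = q i ` cells G i"
  by (simp add: joint_quotient_def)

lemma q_in: "z \<in> cells G i \<Longrightarrow> q i z \<in> cells Q i"
  by (simp add: Q_cells)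

lemma Q_eqI:
  assumes "a \<in> cells Q i" "b \<in> cells Q i" "\<And>s. s \<in> I \<Longrightarrow> \<psi> s i a = \<psi> s i b"
  shows "a = b"
proof -
  obtain z z' where z: "z \<in> cells G i" "a = q i z" "z' \<in> cells G i" "b = q i z'"
    using assms(1,2) by (auto simp: Q_cells)
  then have "\<psi> s i z = \<psi> s i z'" if "s \<in> I" for s
    using assms(3)[OF that] q_spec(2)[OF _ that] by simp
  then show ?thesis using q_eqI[OF z(1,3)] z by simp
qed

text \<open>The quotient operations act on chosen representatives. Replacing a cell by its
  representative does not change its values under any \<open>\<psi> s\<close>, and these commute
  with the structure maps, so the class of the result is unaffected.\<close>

lemma q_hom_eqs:
  "z \<in> cells G (Suc i) \<Longrightarrow> dm Q i (q (Suc i) z) = q i (dm G i z)"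
  "z \<in> cells G (Suc i) \<Longrightarrow> cd Q i (q (Suc i) z) = q i (cd G i z)"
  "z \<in> cells G i \<Longrightarrow> idt Q i (q i z) = q (Suc i) (idt G i z)"
proof -
  interpret omega_graph G by (rule G_graph)
  note \<psi>D = graph_homD[OF \<psi>_hom]
  show "dm Q i (q (Suc i) z) = q i (dm G i z)" if z: "z \<in> cells G (Suc i)"
    using z q_spec[OF z] by (simp add: joint_quotient_def, intro q_eqI) (simp_all add: dm_in \<psi>D)
  show "cd Q i (q (Suc i) z) = q i (cd G i z)" if z: "z \<in> cells G (Suc i)"
    using z q_spec[OF z] by (simp add: joint_quotient_def, intro q_eqI) (simp_all add: cd_in \<psi>D)
  show "idt Q i (q i z) = q (Suc i) (idt G i z)" if z: "z \<in> cells G i"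
    using z q_spec[OF z] by (simp add: joint_quotient_def, intro q_eqI) (simp_all add: idt_in \<psi>D)
qed

lemma Q_graph: "omega_graph Q"
proof -
  interpret omega_graph G by (rule G_graph)
  show ?thesis
  proof
    show "dm Q i \<in> cells Q (Suc i) \<rightarrow>\<^sub>E cells Q i" for i
      using q_hom_eqs(1) by (auto simp: Q_cells dm_in) (simp add: joint_quotient_def)
    show "cd Q i \<in> cells Q (Suc i) \<rightarrow>\<^sub>E cells Q i" for i
      using q_hom_eqs(2) by (auto simp: Q_cells cd_in) (simp add: joint_quotient_def)
    show "idt Q i \<in> cells Q i \<rightarrow>\<^sub>E cells Q (Suc i)" for i
      using q_hom_eqs(3) by (auto simp: Q_cells idt_in) (simp add: joint_quotient_def)
  qed (auto simp: Q_cells q_hom_eqs dm_in cd_in idt_in dm_globular cd_globular dm_idt cd_idt)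
qed

lemma q_hom: "q \<in> graph_hom G Q"
  using q_hom_eqs q_in
  by (simp add: graph_hom_def globular_hom_def PiE_iff extensional_def) (simp add: joint_rep_def)

abbreviation induced :: "'s \<Rightarrow> 'u cell_map" where "induced \<equiv> joint_induced G I \<psi>"

lemma induced_q: "\<lbrakk>s \<in> I; z \<in> cells G i\<rbrakk> \<Longrightarrow> induced s i (q i z) = \<psi> s i z"
  by (simp add: joint_induced_def q_in q_spec)

lemma induced_separates:
  "\<lbrakk>a \<in> cells Q i; b \<in> cells Q i; \<And>s. s \<in> I \<Longrightarrow> induced s i a = induced s i b\<rbrakk> \<Longrightarrow> a = b"
  by (rule Q_eqI) (simp_all add: joint_induced_def)

lemma induced_hom:
  assumes s: "s \<in> I" shows "induced s \<in> graph_hom Q (B s)"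
proof -
  interpret omega_graph G by (rule G_graph)
  note \<psi>D = graph_homD[OF \<psi>_hom[OF s]] graph_hom_in[OF \<psi>_hom[OF s]]
  have "induced s i a \<in> cells (B s) i" if "a \<in> cells Q i" for i a
    using that by (auto simp: Q_cells induced_q s \<psi>D)
  moreover have "induced s i (dm Q i a) = dm (B s) i (induced s (Suc i) a)"
    "induced s i (cd Q i a) = cd (B s) i (induced s (Suc i) a)" if "a \<in> cells Q (Suc i)" for i a
    using that by (auto simp: Q_cells induced_q s \<psi>D q_hom_eqs dm_in cd_in)
  moreover have "induced s (Suc i) (idt Q i a) = idt (B s) i (induced s i a)" if "a \<in> cells Q i" for i a
    using that by (auto simp: Q_cells induced_q s \<psi>D q_hom_eqs idt_in)
  ultimately show ?thesis
    by (simp add: graph_hom_def globular_hom_def PiE_iff extensional_def) (simp add: joint_induced_def)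
qed

end

section \<open>Reflection into algebras\<close>

context free_penon
begin

definition algebra :: "'u omega_graph \<Rightarrow> 'u cell_map \<Rightarrow> bool" where
  "algebra B k \<longleftrightarrow> omega_graph B \<and> k \<in> graph_hom (M B) B \<and>
    (\<forall>i. \<forall>a\<in>cells B i. k i (\<eta> B i a) = a) \<and>
    (\<forall>i. \<forall>z\<in>cells (M (TG B)) i. k i (mult B i z) = k i (T (TG B) B k i z))"

definition algebra_hom ::
    "'u omega_graph \<Rightarrow> 'u cell_map \<Rightarrow> 'u omega_graph \<Rightarrow> 'u cell_map \<Rightarrow> 'u cell_map set" where
  "algebra_hom A h B k =
    {f \<in> graph_hom A B. \<forall>i. \<forall>z\<in>cells (M A) i. f i (h i z) = k i (T A B f i z)}"

text \<open>A universal arrow from \<open>(A, h)\<close> to the algebras, stated so that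
  \<open>(A, h)\<close> itself may violate the algebra laws.\<close>

definition reflection ::
    "'u omega_graph \<Rightarrow> 'u cell_map \<Rightarrow> 'u omega_graph \<Rightarrow> 'u cell_map \<Rightarrow> 'u cell_map \<Rightarrow> bool" where
  "reflection A h B k u \<longleftrightarrow> algebra B k \<and> u \<in> algebra_hom A h B k \<and>
    (\<forall>C l. \<forall>f\<in>algebra_hom A h C l. algebra C l \<longrightarrow>
      (\<exists>!g. g \<in> algebra_hom B k C l \<and> fam_comp A g u = f))"

lemma algebraD:
  assumes "algebra B k"
  shows "omega_graph B" "k \<in> graph_hom (M B) B"
    "a \<in> cells B i \<Longrightarrow> k i (\<eta> B i a) = a"
    "z \<in> cells (M (TG B)) i \<Longrightarrow> k i (mult B i z) = k i (T (TG B) B k i z)"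
  using assms by (simp_all add: algebra_def)

lemma algebra_homD:
  assumes "f \<in> algebra_hom A h B k"
  shows "f \<in> graph_hom A B" "z \<in> cells (M A) i \<Longrightarrow> f i (h i z) = k i (T A B f i z)"
  using assms by (simp_all add: algebra_hom_def)

end

locale prealgebra = free_penon +
  fixes A :: "'a omega_graph" and h :: "'a cell_map"
  assumes A_graph: "omega_graph A" and h_hom: "h \<in> graph_hom (M A) A"
begin

text \<open>The algebras under \<open>(A, h)\<close>. As they are all carried by one type they form
  a set, which can index a joint kernel.\<close>

definition tests :: "('a omega_graph \<times> 'a cell_map \<times> 'a cell_map) set" where
  "tests = {(B, k, f). algebra B k \<and> f \<in> algebra_hom A h B k}"

text \<open>The extension of the comparison map \<open>\<phi> s\<close> to the free algebra on
  \<open>Y\<close>: apply the monad, then the action of the test algebra.\<close>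

definition apply_T :: "'a omega_graph \<Rightarrow> ('a omega_graph \<times> 'a cell_map \<times> 'a cell_map \<Rightarrow> 'a cell_map)
    \<Rightarrow> 'a omega_graph \<times> 'a cell_map \<times> 'a cell_map \<Rightarrow> 'a cell_map" where
  "apply_T Y \<phi> s = fam_comp (M Y) (fst (snd s)) (T Y (fst s) (\<phi> s))"

text \<open>Stage \<open>n\<close> carries its comparison map to every algebra under \<open>(A, h)\<close>; the next stage is the
  joint image of the free algebra on it.\<close>

primrec stage :: "nat \<Rightarrow> 'a omega_graph \<times> ('a omega_graph \<times> 'a cell_map \<times> 'a cell_map \<Rightarrow> 'a cell_map)" where
  "stage 0 = (A, \<lambda>s. snd (snd s))"
| "stage (Suc n) = (let \<psi> = apply_T (fst (stage n)) (snd (stage n)); G = M (fst (stage n)) in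
    (joint_quotient G tests \<psi>, joint_induced G tests \<psi>))"

definition X :: "nat \<Rightarrow> 'a omega_graph" where "X n = fst (stage n)"
definition \<phi> :: "nat \<Rightarrow> 'a omega_graph \<times> 'a cell_map \<times> 'a cell_map \<Rightarrow> 'a cell_map" where
  "\<phi> n = snd (stage n)"
abbreviation \<psi> :: "nat \<Rightarrow> 'a omega_graph \<times> 'a cell_map \<times> 'a cell_map \<Rightarrow> 'a cell_map" where
  "\<psi> n \<equiv> apply_T (X n) (\<phi> n)"
abbreviation p :: "nat \<Rightarrow> 'a cell_map" where "p n \<equiv> joint_rep (M (X n)) tests (\<psi> n)"
definition E :: "nat \<Rightarrow> 'a cell_map" where "E n = fam_comp (X n) (p n) (\<eta> (X n))"

lemma X_Suc: "X (Suc n) = joint_quotient (M (X n)) tests (\<psi> n)"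
  by (simp add: X_def \<phi>_def Let_def)

lemma testsD:
  assumes "s \<in> tests"
  shows "algebra (fst s) (fst (snd s))" "snd (snd s) \<in> algebra_hom A h (fst s) (fst (snd s))"
  using assms by (auto simp: tests_def)

lemma test_graph: "s \<in> tests \<Longrightarrow> omega_graph (fst s)"
  by (rule algebraD(1)[OF testsD(1)])

lemma apply_T_hom:
  assumes "omega_graph Y" "s \<in> tests" "\<theta> s \<in> graph_hom Y (fst s)"
  shows "apply_T Y \<theta> s \<in> graph_hom (M Y) (fst s)"
  unfolding apply_T_def
  by (rule graph_hom_comp[OF M_graph[OF assms(1)] T_hom[OF assms(1) test_graph[OF assms(2)] assms(3)]
        algebraD(2)[OF testsD(1)[OF assms(2)]]])

text \<open>Both claims go through one induction, because the quotient forming the next stage is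
  well behaved only when the comparison maps of the present stage are graph morphisms.\<close>

lemma stage_invariant: "omega_graph (X n) \<and> (\<forall>s\<in>tests. \<phi> n s \<in> graph_hom (X n) (fst s))"
proof (induction n)
  case 0
  show ?case using A_graph algebra_homD(1)[OF testsD(2)] by (simp add: X_def \<phi>_def)
next
  case (Suc n)
  interpret j: joint_kernel "M (X n)" tests "\<psi> n" fst
    by (rule joint_kernel.intro) (use Suc apply_T_hom M_graph in auto)
  have "\<phi> (Suc n) = j.induced"
    by (simp add: \<phi>_def X_def Let_def)
  then show ?case using j.Q_graph j.induced_hom by (simp add: X_Suc)
qed

lemma X_graph: "omega_graph (X n)"
  and \<phi>_hom: "s \<in> tests \<Longrightarrow> \<phi> n s \<in> graph_hom (X n) (fst s)"
  using stage_invariant by auto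

sublocale j: joint_kernel "M (X n)" tests "\<psi> n" fst for n
  by (rule joint_kernel.intro) (use X_graph \<phi>_hom apply_T_hom M_graph in auto)

lemma \<phi>_Suc: "\<phi> (Suc n) = j.induced n"
  by (simp add: \<phi>_def X_def Let_def)

text \<open>Restricted to positive stages: stage 0 is \<open>A\<close> itself, and every test may
  identify some of its cells.\<close>

lemma \<phi>_separates:
  "\<lbrakk>a \<in> cells (X (Suc n)) i; b \<in> cells (X (Suc n)) i;
    \<And>s. s \<in> tests \<Longrightarrow> \<phi> (Suc n) s i a = \<phi> (Suc n) s i b\<rbrakk> \<Longrightarrow> a = b"
  unfolding X_Suc \<phi>_Suc by (rule j.induced_separates)

lemma p_hom: "p n \<in> graph_hom (M (X n)) (X (Suc n))"
  using j.q_hom by (simp add: X_Suc)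

lemma \<phi>_p: "\<lbrakk>s \<in> tests; z \<in> cells (M (X n)) i\<rbrakk> \<Longrightarrow>
    \<phi> (Suc n) s i (p n i z) = fst (snd s) i (T (X n) (fst s) (\<phi> n s) i z)"
  using j.induced_q[of s z n i] by (simp add: \<phi>_Suc apply_T_def)

sublocale graph_chain X E
proof (rule graph_chain.intro[OF X_graph])
  show "E n \<in> graph_hom (X n) (X (Suc n))" for n
    unfolding E_def by (rule graph_hom_comp[OF X_graph \<eta>_hom[OF X_graph] p_hom])
qed

definition to_test :: "'a omega_graph \<times> 'a cell_map \<times> 'a cell_map \<Rightarrow> 'a cell_map" where
  "to_test s = desc (\<lambda>n. \<phi> n s)"

text \<open>This is the unit law of the test algebra: passing to the next stage inserts a generator,
  which the action evaluates back.\<close>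

lemma cocone_\<phi>:
  assumes s: "s \<in> tests" shows "cocone (\<lambda>n. \<phi> n s)"
  unfolding cocone_def
proof (intro allI ballI)
  fix n i a assume a: "a \<in> cells (X n) i"
  have "\<phi> (Suc n) s i (E n i a) = fst (snd s) i (\<eta> (fst s) i (\<phi> n s i a))"
    using \<phi>_p[OF s graph_hom_in[OF \<eta>_hom[OF X_graph] a]]
      \<eta>_natural[OF X_graph test_graph[OF s] \<phi>_hom[OF s] a] a by (simp add: E_def)
  also have "\<dots> = \<phi> n s i a"
    by (rule algebraD(3)[OF testsD(1)[OF s] graph_hom_in[OF \<phi>_hom[OF s] a]])
  finally show "\<phi> (Suc n) s i (E n i a) = \<phi> n s i a" .
qed

lemma to_test_hom: "s \<in> tests \<Longrightarrow> to_test s \<in> graph_hom lim (fst s)"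
  unfolding to_test_def by (rule desc_hom[OF cocone_\<phi> \<phi>_hom])

lemma to_test_iota: "\<lbrakk>s \<in> tests; a \<in> cells (X n) i\<rbrakk> \<Longrightarrow> to_test s i (iota n i a) = \<phi> n s i a"
  unfolding to_test_def by (rule desc_iota[OF cocone_\<phi>])

text \<open>Late entries of the representatives are separated by the comparison maps. This reduces
  every equation in \<open>lim\<close> to one in each test algebra.\<close>

lemma to_test_separates:
  assumes d: "d \<in> lim_cells i" and d': "d' \<in> lim_cells i"
    and eq: "\<And>s. s \<in> tests \<Longrightarrow> to_test s i d = to_test s i d'"
  shows "d = d'"
proof (rule lim_eqI[OF d d'])
  show "ev_eq (rep i d) (rep i d')"
    using iota_rep[OF d] iota_rep[OF d'] eventually_ge_at_top[of 1]
  proof eventually_elim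
    case (elim n)
    then obtain m where m: "n = Suc m" by (cases n) auto
    have same: "\<phi> n s i (rep i d n) = \<phi> n s i (rep i d' n)" if s: "s \<in> tests" for s
      using eq[OF s] to_test_iota[OF s, of "rep i d n" n i] to_test_iota[OF s, of "rep i d' n" n i] elim
      by simp
    show ?case
      using same elim(1,2) unfolding m by (intro \<phi>_separates[of "rep i d (Suc m)" m i]) blast+
  qed
qed

text \<open>The action is specified by the demand that all \<open>to_test s\<close> become algebra
  morphisms. By separation at most one value qualifies, so the laws of \<open>act\<close> can be
  read off in the tests through \<open>act_eqI\<close>.\<close>

definition act :: "'a cell_map" where
  "act i = (\<lambda>z\<in>cells (M lim) i. SOME d. d \<in> lim_cells i \<and>
    (\<forall>s\<in>tests. to_test s i d = fst (snd s) i (T lim (fst s) (to_test s) i z)))"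

lemma T_to_test_iota:
  assumes s: "s \<in> tests" and y: "y \<in> cells (M (X n)) i"
  shows "T lim (fst s) (to_test s) i (T (X n) lim (iota n) i y) = T (X n) (fst s) (\<phi> n s) i y"
proof -
  have "fam_comp (X n) (to_test s) (iota n) = \<phi> n s"
    by (rule graph_hom_eqI[OF graph_hom_comp[OF X_graph iota_hom to_test_hom[OF s]] \<phi>_hom[OF s]])
      (simp add: to_test_iota s)
  then show ?thesis
    using T_comp_apply[OF X_graph omega_graph_lim test_graph[OF s] iota_hom to_test_hom[OF s] y] by simp
qed

lemma act_spec:
  assumes z: "z \<in> cells (M lim) i"
  shows "act i z \<in> lim_cells i"
    and "s \<in> tests \<Longrightarrow> to_test s i (act i z) = fst (snd s) i (T lim (fst s) (to_test s) i z)"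
proof -
  obtain n y where y: "y \<in> cells (M (X n)) i" "z = T (X n) lim (iota n) i y"
    by (rule free_finitary[OF graph_chain_axioms z])
  have py: "p n i y \<in> cells (X (Suc n)) i" by (rule graph_hom_in[OF p_hom y(1)])
  \<comment> \<open>Here finitariness is used: \<open>z\<close> comes from a free cell
    \<open>y\<close> over stage \<open>n\<close>, and the class of \<open>y\<close>, a cell of stage
    \<open>Suc n\<close>, has the required value in every test.\<close>
  have "\<exists>d. d \<in> lim_cells i \<and> (\<forall>s\<in>tests. to_test s i d = fst (snd s) i (T lim (fst s) (to_test s) i z))"
    using iota_in[OF py] to_test_iota[OF _ py] \<phi>_p[OF _ y(1)] T_to_test_iota[OF _ y(1)] y(2)
    by (intro exI[of _ "iota (Suc n) i (p n i y)"]) simp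
  then have "act i z \<in> lim_cells i \<and>
      (\<forall>s\<in>tests. to_test s i (act i z) = fst (snd s) i (T lim (fst s) (to_test s) i z))"
    unfolding act_def using z someI_ex[of "\<lambda>d. d \<in> lim_cells i \<and>
      (\<forall>s\<in>tests. to_test s i d = fst (snd s) i (T lim (fst s) (to_test s) i z))"] by simp
  then show "act i z \<in> lim_cells i"
    "s \<in> tests \<Longrightarrow> to_test s i (act i z) = fst (snd s) i (T lim (fst s) (to_test s) i z)"
    by simp_all
qed

lemma act_eqI:
  assumes "z \<in> cells (M lim) i" "d \<in> lim_cells i"
    and "\<And>s. s \<in> tests \<Longrightarrow> to_test s i d = fst (snd s) i (T lim (fst s) (to_test s) i z)"
  shows "act i z = d"
  by (rule to_test_separates[OF act_spec(1)[OF assms(1)] assms(2)])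
    (simp add: act_spec(2)[OF assms(1)] assms(3))

lemma act_hom: "act \<in> graph_hom (M lim) lim"
proof -
  note gM = M_graph[OF omega_graph_lim]
  interpret M: omega_graph "M lim" by (rule gM)
  note tD = graph_homD[OF to_test_hom] and TD = graph_homD[OF T_hom[OF omega_graph_lim test_graph to_test_hom]]
    and kD = graph_homD[OF algebraD(2)[OF testsD(1)]]
    and Tin = graph_hom_in[OF T_hom[OF omega_graph_lim test_graph to_test_hom]]
  have "act i (dm (M lim) i z) = dm lim i (act (Suc i) z)"
    "act i (cd (M lim) i z) = cd lim i (act (Suc i) z)" if z: "z \<in> cells (M lim) (Suc i)" for i z
    by (rule act_eqI, simp_all add: z M.dm_in M.cd_in lim_in act_spec tD TD kD Tin)+
  moreover have "act (Suc i) (idt (M lim) i z) = idt lim i (act i z)" if z: "z \<in> cells (M lim) i" for i z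
    by (rule act_eqI, simp_all add: z M.idt_in lim_in act_spec tD TD kD Tin)
  ultimately show ?thesis
    using act_spec(1)
    by (simp add: graph_hom_def globular_hom_def PiE_iff extensional_def) (simp add: act_def)
qed

lemma to_test_algebra_hom: "s \<in> tests \<Longrightarrow> to_test s \<in> algebra_hom lim act (fst s) (fst (snd s))"
  by (simp add: algebra_hom_def to_test_hom act_spec)

text \<open>Both sides of each law have the same image in every test algebra, where the law holds;
  \<open>to_test_separates\<close> then gives the law in \<open>lim\<close>.\<close>

lemma algebra_lim: "algebra lim act"
proof -
  note gl = omega_graph_lim
  note gT = TG_graph[OF gl]
  have "act i (\<eta> lim i d) = d" if d: "d \<in> lim_cells i" for i d
  proof (rule act_eqI[OF graph_hom_in[OF \<eta>_hom[OF gl]] d])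
    show "d \<in> cells lim i" using d by simp
    fix s assume s: "s \<in> tests"
    show "to_test s i d = fst (snd s) i (T lim (fst s) (to_test s) i (\<eta> lim i d))"
      using \<eta>_natural[OF gl test_graph[OF s] to_test_hom[OF s]]
        algebraD(3)[OF testsD(1)[OF s] graph_hom_in[OF to_test_hom[OF s]]] d by simp
  qed
  moreover have "act i (mult lim i z) = act i (T (TG lim) lim act i z)"
    if z: "z \<in> cells (M (TG lim)) i" for i z
  proof -
    have act_T: "act \<in> graph_hom (TG lim) lim" using act_hom by simp
    have Tz: "T (TG lim) lim act i z \<in> cells (M lim) i"
      by (rule graph_hom_in[OF T_hom[OF gT gl act_T] z])
    show ?thesis
    proof (rule act_eqI[OF graph_hom_in[OF mult_hom[OF gl] z] act_spec(1)[OF Tz]])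
      fix s assume s: "s \<in> tests"
      let ?B = "fst s" and ?k = "fst (snd s)" and ?t = "to_test s"
      note gB = test_graph[OF s] and t = to_test_hom[OF s] and k = algebraD(2)[OF testsD(1)[OF s]]
      have Tt: "T lim ?B ?t \<in> graph_hom (TG lim) (TG ?B)" using T_hom[OF gl gB t] by simp
      have k': "?k \<in> graph_hom (TG ?B) ?B" using k by simp
      \<comment> \<open>The specification of \<open>act\<close> as an equality of morphisms, so that
        \<open>T\<close> can be applied to it. The chain below then uses associativity in the test
        algebra and naturality of the multiplication.\<close>
      have comp: "fam_comp (TG lim) ?t act = fam_comp (TG lim) ?k (T lim ?B ?t)"
        using act_spec(2)[OF _ s] by (simp add: fam_comp_eq_iff)
      have "?t i (act i (T (TG lim) lim act i z)) = ?k i (T lim ?B ?t i (T (TG lim) lim act i z))"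
        by (rule act_spec(2)[OF Tz s])
      also have "\<dots> = ?k i (T (TG lim) ?B (fam_comp (TG lim) ?t act) i z)"
        by (simp only: T_comp_apply[OF gT gl gB act_T t z])
      also have "\<dots> = ?k i (T (TG ?B) ?B ?k i (T (TG lim) (TG ?B) (T lim ?B ?t) i z))"
        by (simp only: comp T_comp_apply[OF gT TG_graph[OF gB] gB Tt k' z])
      also have "\<dots> = ?k i (mult ?B i (T (TG lim) (TG ?B) (T lim ?B ?t) i z))"
        using algebraD(4)[OF testsD(1)[OF s] graph_hom_in[OF T_hom[OF gT TG_graph[OF gB] Tt] z]] by simp
      also have "\<dots> = ?k i (T lim ?B ?t i (mult lim i z))"
        by (simp only: mult_natural[OF gl gB t z])
      finally show "?t i (act i (T (TG lim) lim act i z)) = ?k i (T lim ?B ?t i (mult lim i z))" .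
    qed
  qed
  ultimately show ?thesis using gl act_hom by (simp add: algebra_def)
qed

lemma X_0: "X 0 = A"
  by (simp add: X_def)

lemma \<phi>_0: "\<phi> 0 s = snd (snd s)"
  by (simp add: \<phi>_def)

lemma iota_0_hom: "iota 0 \<in> graph_hom A lim"
  using iota_hom[of 0] by (simp add: X_0)

text \<open>Compatibility with \<open>h\<close> is not visible in the stages; it holds because the
  structure map of every test is compatible with \<open>h\<close> and the tests separate.\<close>

lemma iota_0_algebra_hom: "iota 0 \<in> algebra_hom A h lim act"
proof -
  have "act i (T A lim (iota 0) i z) = iota 0 i (h i z)" if z: "z \<in> cells (M A) i" for i z
  proof (rule act_eqI[OF graph_hom_in[OF T_hom[OF A_graph omega_graph_lim iota_0_hom] z]])
    have hz: "h i z \<in> cells (X 0) i" using graph_hom_in[OF h_hom z] by (simp add: X_0)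
    show "iota 0 i (h i z) \<in> lim_cells i" by (rule iota_in[OF hz])
    show "to_test s i (iota 0 i (h i z)) = fst (snd s) i (T lim (fst s) (to_test s) i (T A lim (iota 0) i z))"
      if s: "s \<in> tests" for s
      using to_test_iota[OF s hz] T_to_test_iota[OF s, of z 0] algebra_homD(2)[OF testsD(2)[OF s] z] z
      by (simp add: X_0 \<phi>_0)
  qed
  then show ?thesis by (simp add: algebra_hom_def iota_0_hom)
qed

text \<open>The colimit is generated by \<open>A\<close>: a cell of stage \<open>n + 1\<close> is
  the action applied to a free cell over stage \<open>n\<close>, so the values of an algebra
  morphism there are forced by those on stage \<open>n\<close>.\<close>

lemma algebra_hom_lim_unique:
  assumes "omega_graph C" and u: "u \<in> algebra_hom lim act C l" and v: "v \<in> algebra_hom lim act C l"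
    and eq: "fam_comp A u (iota 0) = fam_comp A v (iota 0)"
  shows "u = v"
proof -
  note gl = omega_graph_lim
  note uh = algebra_homD(1)[OF u] and vh = algebra_homD(1)[OF v]
  have uv: "u i (iota n i a) = v i (iota n i a)" if "a \<in> cells (X n) i" for n i a
    using that
  proof (induction n arbitrary: i a)
    case 0
    then show ?case using eq by (simp add: fam_comp_eq_iff X_0)
  next
    case (Suc n)
    then obtain y where y: "y \<in> cells (M (X n)) i" "a = p n i y"
      by (auto simp: X_Suc joint_quotient_def)
    have Ty: "T (X n) lim (iota n) i y \<in> cells (M lim) i"
      by (rule graph_hom_in[OF T_hom[OF X_graph gl iota_hom] y(1)])
    have iota_a: "iota (Suc n) i a = act i (T (X n) lim (iota n) i y)"
      using to_test_iota[OF _ Suc.prems] \<phi>_p[OF _ y(1)] T_to_test_iota[OF _ y(1)] y(2)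
      by (intro act_eqI[OF Ty iota_in[OF Suc.prems], symmetric]) simp
    have "fam_comp (X n) u (iota n) = fam_comp (X n) v (iota n)"
      using Suc.IH by (simp add: fam_comp_eq_iff)
    then have "T lim C u i (T (X n) lim (iota n) i y) = T lim C v i (T (X n) lim (iota n) i y)"
      by (simp add: T_comp_apply[OF X_graph gl assms(1) iota_hom _ y(1)] uh vh)
    then show ?case
      by (simp add: iota_a algebra_homD(2)[OF u Ty] algebra_homD(2)[OF v Ty])
  qed
  show ?thesis
  proof (rule graph_hom_eqI[OF uh vh])
    fix i d assume "d \<in> cells lim i"
    then have "d \<in> lim_cells i" by simp
    then obtain n a where "a \<in> cells (X n) i" "d = iota n i a" by (rule lim_cases)
    then show "u i d = v i d" using uv by simp
  qed
qed

text \<open>Any map \<open>f\<close> from \<open>(A, h)\<close> to an algebra is itself one of the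
  tests, and its \<open>to_test\<close> is the required factorisation.\<close>

theorem reflection_lim: "reflection A h lim act (iota 0)"
  unfolding reflection_def
proof (intro conjI allI ballI impI ex_ex1I)
  fix C l f assume f: "f \<in> algebra_hom A h C l" and C: "algebra C l"
  then have s: "(C, l, f) \<in> tests" by (simp add: tests_def)
  have "fam_comp A (to_test (C, l, f)) (iota 0) = f"
    using to_test_iota[OF s, of _ 0]
    by (intro graph_hom_eqI[OF graph_hom_comp[OF A_graph iota_0_hom to_test_hom[OF s]] algebra_homD(1)[OF f]])
      (simp add: X_0 \<phi>_0)
  then show "\<exists>g. g \<in> algebra_hom lim act C l \<and> fam_comp A g (iota 0) = f"
    using to_test_algebra_hom[OF s] by auto
  fix u v assume u: "u \<in> algebra_hom lim act C l \<and> fam_comp A u (iota 0) = f"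
    and v: "v \<in> algebra_hom lim act C l \<and> fam_comp A v (iota 0) = f"
  show "u = v"
    by (rule algebra_hom_lim_unique[OF algebraD(1)[OF C] u[THEN conjunct1] v[THEN conjunct1]])
      (simp add: u v)
qed (rule algebra_lim iota_0_algebra_hom)+

end

section \<open>The functors\<close>

lemma dom_iter_underlying [simp]: "dom_iter (underlying_graph X) i j a = dom_iter X i j a"
  by (induction j arbitrary: a) simp_all

lemma cod_iter_underlying [simp]: "cod_iter (underlying_graph X) i j a = cod_iter X i j a"
  by (induction j arbitrary: a) simp_all

lemma composable_underlying [simp]: "composable (underlying_graph X) = composable X"
  by (intro ext) (simp add: composable_def)

lemma category_full_subcategory:
  assumes "category C" shows "category (full_subcategory C S)"
proof -
  interpret category C by fact
  show ?thesis
    by unfold_locales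
      (auto simp: full_subcategory_def Id_in Comp_in Comp_Id_left Comp_Id_right Comp_assoc)
qed

context free_penon
begin

lemma Ob_Prolixe_iff: "(A, h) \<in> Ob (Prolixe L \<eta> \<epsilon>) \<longleftrightarrow> algebra A h"
proof -
  have "fam_comp A h (\<eta> A) = fam_id A \<longleftrightarrow> (\<forall>i. \<forall>a\<in>cells A i. h i (\<eta> A i a) = a)"
  proof
    assume eq: "fam_comp A h (\<eta> A) = fam_id A"
    then show "\<forall>i. \<forall>a\<in>cells A i. h i (\<eta> A i a) = a"
      by (metis fam_comp_apply fam_id_apply)
  qed (auto simp: fam_comp_def fam_id_def compose_def fun_eq_iff)
  then show ?thesis
    by (auto simp: Prolixe_def algebra_category_def monad_algebras_def comp_functor_def
        adjunction_mult_def algebra_def mult_def T_def fam_comp_eq_iff)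
qed

lemma Prolixe_sel [simp]:
  "X \<in> Ob (Prolixe L \<eta> \<epsilon>) \<longleftrightarrow> algebra (fst X) (snd X)"
  "Hom (Prolixe L \<eta> \<epsilon>) X Y = algebra_hom (fst X) (snd X) (fst Y) (snd Y)"
  "Ident (Prolixe L \<eta> \<epsilon>) X = fam_id (fst X)"
  "Comp (Prolixe L \<eta> \<epsilon>) X Y Z = fam_comp (fst X)"
  using Ob_Prolixe_iff[of "fst X" "snd X"]
  by (auto simp: Prolixe_def algebra_category_def comp_functor_def algebra_hom_def T_def fam_comp_eq_iff
      split_beta)

lemma algebra_hom_id:
  assumes "omega_graph A" "h \<in> graph_hom (M A) A" shows "fam_id A \<in> algebra_hom A h A h"
  using assms graph_hom_in[OF assms(2)] by (simp add: algebra_hom_def graph_hom_id T_id)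

lemma algebra_hom_comp:
  assumes A: "omega_graph A" and B: "omega_graph B" and C: "omega_graph C"
    and h: "h \<in> graph_hom (M A) A"
    and f: "f \<in> algebra_hom A h B k" and g: "g \<in> algebra_hom B k C l"
  shows "fam_comp A g f \<in> algebra_hom A h C l"
proof -
  note fD = algebra_homD[OF f] and gD = algebra_homD[OF g]
  have "fam_comp A g f i (h i z) = l i (T A C (fam_comp A g f) i z)" if z: "z \<in> cells (M A) i" for i z
    using graph_hom_in[OF h z] fD(2)[OF z] gD(2)[OF graph_hom_in[OF T_hom[OF A B fD(1)] z]]
      T_comp_apply[OF A B C fD(1) gD(1) z]
    by simp
  then show ?thesis by (simp add: algebra_hom_def graph_hom_comp[OF A fD(1) gD(1)])
qed

lemma algebra_hom_globular: "f \<in> algebra_hom A h B k \<Longrightarrow> f \<in> globular_hom A B"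
  by (rule graph_hom_globular[OF algebra_homD(1)])

lemma category_Prolixe: "category (Prolixe L \<eta> \<epsilon>)"
proof
  fix X Y Z f g
  assume "X \<in> Ob (Prolixe L \<eta> \<epsilon>)" "Y \<in> Ob (Prolixe L \<eta> \<epsilon>)" "Z \<in> Ob (Prolixe L \<eta> \<epsilon>)"
  then have X: "algebra (fst X) (snd X)" and Y: "algebra (fst Y) (snd Y)" and Z: "algebra (fst Z) (snd Z)"
    by simp_all
  assume "f \<in> Hom (Prolixe L \<eta> \<epsilon>) X Y" "g \<in> Hom (Prolixe L \<eta> \<epsilon>) Y Z"
  then show "Comp (Prolixe L \<eta> \<epsilon>) X Y Z g f \<in> Hom (Prolixe L \<eta> \<epsilon>) X Z"
    using algebra_hom_comp[OF algebraD(1)[OF X] algebraD(1)[OF Y] algebraD(1)[OF Z] algebraD(2)[OF X]]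
    by simp
qed (auto intro!: algebra_hom_id fam_comp_id_left fam_comp_id_right fam_comp_assoc
    intro: algebraD algebra_hom_globular)

lemma Pen_Omega_Cat_sel [simp]:
  "X \<in> Ob (Pen_Omega_Cat L \<eta>) \<longleftrightarrow> weak_omega_category X \<and>
    kappa X = omap L (underlying_graph (magma1 X)) \<and> rho X = \<eta> (underlying_graph (magma1 X))"
  "Hom (Pen_Omega_Cat L \<eta>) = Hom Omega_Cat"
  "Ident (Pen_Omega_Cat L \<eta>) = Ident Omega_Cat"
  "Comp (Pen_Omega_Cat L \<eta>) = Comp Omega_Cat"
  by (simp_all add: Pen_Omega_Cat_def full_subcategory_def Omega_Cat_def)

lemma category_Pen_Omega_Cat: "category (Pen_Omega_Cat L \<eta>)"
  unfolding Pen_Omega_Cat_def by (rule category_full_subcategory[OF category_Omega_Cat])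

lemma Omega_Cat_sel:
  "(F1, F2, F3) \<in> Hom Omega_Cat X Y \<longleftrightarrow> F1 \<in> magma_hom (magma1 X) (magma1 Y) \<and>
    F2 \<in> bridge_hom (magma2 X) (magma2 Y) \<and> F3 \<in> magma_hom (magma3 X) (magma3 Y) \<and>
    fam_comp (magma2 X) F1 (lam X) = fam_comp (magma2 X) (lam Y) F2 \<and>
    fam_comp (magma2 X) F3 (pen_map (kappa X)) = fam_comp (magma2 X) (pen_map (kappa Y)) F2 \<and>
    fam_comp (magma1 X) F2 (rho X) = fam_comp (magma1 X) (rho Y) F1"
  "Ident Omega_Cat X = (fam_id (magma1 X), fam_id (magma2 X), fam_id (magma3 X))"
  "Comp Omega_Cat X Y Z G F = (fam_comp (magma1 X) (fst G) (fst F),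
    fam_comp (magma2 X) (fst (snd G)) (fst (snd F)), fam_comp (magma3 X) (snd (snd G)) (snd (snd F)))"
  by (simp_all add: Omega_Cat_def split_beta)

text \<open>Bridges the gap between the two categories: the third component of an omega functor is
  only a magma morphism, whereas \<open>Pen_Mor\<close> demands a bridge morphism. Preservation of
  identities suffices for diagonal relations.\<close>

lemma magma_hom_diagonal:
  assumes F: "F \<in> magma_hom X Y" and "bridge X = diagonal_bridge X" "bridge Y = diagonal_bridge Y"
  shows "F \<in> bridge_hom X Y"
  using F assms(2,3) graph_hom_in[OF magma_hom_graph[OF F]] graph_homD(3)[OF magma_hom_graph[OF F]]
  by (auto simp: bridge_hom_def diagonal_bridge_def)

text \<open>A functor in \<open>Pen_Omega_Cat\<close> is determined by its first component, because the unit generates.\<close>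

lemma Pen_Omega_Cat_hom:
  assumes X: "X \<in> Ob (Pen_Omega_Cat L \<eta>)" and Y: "Y \<in> Ob (Pen_Omega_Cat L \<eta>)"
    and F: "F \<in> Hom (Pen_Omega_Cat L \<eta>) X Y"
  shows "fst F \<in> algebra_hom (underlying_graph (magma1 X)) (lam X) (underlying_graph (magma1 Y)) (lam Y)"
proof -
  let ?A = "underlying_graph (magma1 X)" and ?B = "underlying_graph (magma1 Y)"
  obtain F1 F2 F3 where FF: "F = (F1, F2, F3)" by (cases F)
  interpret X: weak_omega_category X using X by simp
  interpret Y: weak_omega_category Y using Y by simp
  have A: "omega_graph ?A" and B: "omega_graph ?B"
    by (rule underlying_graph_omega_graph X.magma1.omega_graph_axioms Y.magma1.omega_graph_axioms)+
  have h: "F1 \<in> magma_hom (magma1 X) (magma1 Y)" "F2 \<in> bridge_hom (magma2 X) (magma2 Y)"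
    "F3 \<in> magma_hom (magma3 X) (magma3 Y)"
    and sq: "fam_comp (magma2 X) F1 (lam X) = fam_comp (magma2 X) (lam Y) F2"
    "fam_comp (magma2 X) F3 (pen_map (kappa X)) = fam_comp (magma2 X) (pen_map (kappa Y)) F2"
    "fam_comp (magma1 X) F2 (rho X) = fam_comp (magma1 X) (rho Y) F1"
    using F by (simp_all add: FF Omega_Cat_sel)
  have F1: "F1 \<in> graph_hom ?A ?B" using magma_hom_graph[OF h(1)] by simp
  have "(F2, F3) \<in> Hom Pen_Mor (kappa X) (kappa Y)"
    using h(2) sq(2) magma_hom_diagonal[OF h(3) X.kappa.cod_bridge Y.kappa.cod_bridge]
    by (simp add: Hom_Pen_Mor_iff fam_comp_eq_iff)
  \<comment> \<open>On generators both squares are given by \<open>F1\<close>: one by compatibility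
    with \<open>rho\<close>, which is the unit, the other by naturality of the unit.\<close>
  then have eq: "(F2, F3) = amap L ?A ?B F1"
  proof (intro extend_unique[OF A penon_free[OF B]])
    show "amap L ?A ?B F1 \<in> Hom Pen_Mor (omap L ?A) (omap L ?B)"
      using left.amap_in[of ?A ?B F1] A B F1 by simp
    fix i a assume a: "a \<in> cells ?A i"
    show "fst (F2, F3) i (\<eta> ?A i a) = fst (amap L ?A ?B F1) i (\<eta> ?A i a)"
      using sq(3) a \<eta>_natural[OF A B F1 a] X Y by (simp add: fam_comp_eq_iff T_def)
  qed (use X Y in simp)
  \<comment> \<open>With this identification the square for \<open>lam\<close> is exactly the
    condition on an algebra morphism.\<close>
  have "F2 = T ?A ?B F1" using arg_cong[OF eq, of fst] by (simp add: T_def)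
  then show ?thesis
    using F1 sq(1) X by (simp add: FF algebra_hom_def fam_comp_eq_iff)
qed

subsection \<open>From prolixes to weak omega categories\<close>

definition algebra_magma :: "'u omega_graph \<Rightarrow> 'u cell_map \<Rightarrow> 'u omega_magma" where
  "algebra_magma A h = \<lparr>cells = cells A, dm = dm A, cd = cd A, idt = idt A,
    cmp = (\<lambda>i j a b. if composable A i j a b
      then h j (cmp (M A) i j (\<eta> A j a) (\<eta> A j b)) else undefined)\<rparr>"

lemma underlying_algebra_magma [simp]: "underlying_graph (algebra_magma A h) = A"
  by (simp add: underlying_graph_def omega_graph.truncate_def algebra_magma_def)

lemma composable_algebra_magma [simp]: "composable (algebra_magma A h) = composable A"
  using composable_underlying[of "algebra_magma A h"] by simp

lemma algebra_magma_sel [simp]: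
  "cells (algebra_magma A h) = cells A" "dm (algebra_magma A h) = dm A"
  "cd (algebra_magma A h) = cd A" "idt (algebra_magma A h) = idt A"
  "composable A i j a b \<Longrightarrow>
    cmp (algebra_magma A h) i j a b = h j (cmp (M A) i j (\<eta> A j a) (\<eta> A j b))"
  "\<not> composable A i j a b \<Longrightarrow> cmp (algebra_magma A h) i j a b = undefined"
  by (simp_all add: algebra_magma_def)

lemma graph_hom_algebra_magma [simp]:
  "graph_hom X (algebra_magma A h) = graph_hom X A" "graph_hom (algebra_magma A h) X = graph_hom A X"
  by (simp_all add: graph_hom_def globular_hom_def)

lemma fam_algebra_magma [simp]:
  "fam_comp (algebra_magma A h) = fam_comp A" "fam_id (algebra_magma A h) = fam_id A"
  using fam_underlying[of "algebra_magma A h"] by simp_all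

lemma \<eta>_composable:
  assumes "omega_graph A" "composable A i j a b"
  shows "composable (M A) i j (\<eta> A j a) (\<eta> A j b)"
  by (rule hom_composable[OF omega_graph.axioms(1)[OF assms(1)] graph_hom_globular[OF \<eta>_hom[OF assms(1)]] assms(2)])

text \<open>Boundaries of composites are computed in the free magma and transported by the graph
  morphisms \<open>\<eta>\<close> and \<open>h\<close>; in the top dimension, the unit law then
  removes \<open>h\<close> after \<open>\<eta>\<close>.\<close>

lemma omega_magma_algebra_magma:
  assumes alg: "algebra A h" shows "omega_magma (algebra_magma A h)"
proof -
  note A = algebraD(1)[OF alg] and h = algebraD(2)[OF alg]
  interpret A: omega_graph A by (rule A)
  interpret M: bridge_magma "M A" by (rule M_bridge_magma[OF A])
  note hD = graph_homD[OF h] and \<eta>D = graph_homD[OF \<eta>_hom[OF A]]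
  note hin = graph_hom_in[OF h] and c = \<eta>_composable[OF A]
  have "omega_graph (algebra_magma A h)"
    using A by (simp add: omega_graph_def omega_graph_axioms_def globular_set_def)
  then interpret omega_graph "algebra_magma A h" .
  show ?thesis
  proof
    fix i j a b
    show "cmp (algebra_magma A h) i j a b \<in> cells (algebra_magma A h) j"
      if "composable (algebra_magma A h) i j a b"
      using that by (simp add: hin M.cmp_in c)
    show "cmp (algebra_magma A h) i j a b = undefined" if "\<not> composable (algebra_magma A h) i j a b"
      using that by simp
  next
    fix i a b assume "composable (algebra_magma A h) i (Suc i) a b"
    then have ab: "composable A i (Suc i) a b" by simp
    show "dm (algebra_magma A h) i (cmp (algebra_magma A h) i (Suc i) a b) = dm (algebra_magma A h) i a"
      using ab composable_in[OF ab]
      by (simp add: hD(1,2)[symmetric] M.cmp_in c M.dm_cmp_eq \<eta>D(1,2)[symmetric] algebraD(3)[OF alg] A.dm_in)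
    show "cd (algebra_magma A h) i (cmp (algebra_magma A h) i (Suc i) a b) = cd (algebra_magma A h) i b"
      using ab composable_in[OF ab]
      by (simp add: hD(1,2)[symmetric] M.cmp_in c M.cd_cmp_eq \<eta>D(1,2)[symmetric] algebraD(3)[OF alg] A.cd_in)
  next
    fix i j a b assume ij: "i < j" and "composable (algebra_magma A h) i (Suc j) a b"
    then have ab: "composable A i (Suc j) a b" by simp
    note ab' = composable_boundary[OF A.globular_set_axioms ij ab]
    show "dm (algebra_magma A h) j (cmp (algebra_magma A h) i (Suc j) a b)
        = cmp (algebra_magma A h) i j (dm (algebra_magma A h) j a) (dm (algebra_magma A h) j b)"
      using ab ab' composable_in[OF ab]
      by (simp add: hD(1,2)[symmetric] M.cmp_in c M.dm_cmp_less[OF ij] \<eta>D(1,2))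
    show "cd (algebra_magma A h) j (cmp (algebra_magma A h) i (Suc j) a b)
        = cmp (algebra_magma A h) i j (cd (algebra_magma A h) j a) (cd (algebra_magma A h) j b)"
      using ab ab' composable_in[OF ab]
      by (simp add: hD(1,2)[symmetric] M.cmp_in c M.cd_cmp_less[OF ij] \<eta>D(1,2))
  qed
qed

text \<open>Both sides are the image of \<open>\<eta> x \<circ> \<eta> y\<close>, taken in the free algebra on the free algebra, under the
  two composites to \<open>A\<close> which the associativity law of the algebra equates.\<close>

lemma algebra_cmp:
  assumes alg: "algebra A h" and xy: "composable (M A) i j x y"
  shows "h j (cmp (M A) i j x y) = h j (cmp (M A) i j (\<eta> A j (h j x)) (\<eta> A j (h j y)))"
proof -
  note A = algebraD(1)[OF alg] and h = algebraD(2)[OF alg]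
  note TA = TG_graph[OF A]
  have h': "h \<in> graph_hom (TG A) A" using h by simp
  have "composable (TG A) i j x y" using xy by simp
  note c = \<eta>_composable[OF TA this]
  interpret MT: bridge_magma "M (TG A)" by (rule M_bridge_magma[OF TA])
  note xy' = composable_in[OF xy]
  let ?w = "cmp (M (TG A)) i j (\<eta> (TG A) j x) (\<eta> (TG A) j y)"
  have "h j (mult A j ?w) = h j (T (TG A) A h j ?w)"
    by (rule algebraD(4)[OF alg MT.cmp_in[OF c]])
  then show ?thesis
    using xy' \<eta>_natural[OF TA A h']
    by (simp add: bridge_hom_cmp[OF mult_bridge_hom[OF A] c] bridge_hom_cmp[OF T_bridge_hom[OF TA A h'] c]
        mult_\<eta>[OF A])
qed

definition algebra_weak :: "'u omega_graph \<Rightarrow> 'u cell_map \<Rightarrow> 'u weak_omega_category" where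
  "algebra_weak A h = \<lparr>magma1 = algebra_magma A h, lam = h, rho = \<eta> A, kappa = omap L A\<rparr>"

lemma algebra_weak_sel [simp]:
  "magma1 (algebra_weak A h) = algebra_magma A h" "lam (algebra_weak A h) = h"
  "rho (algebra_weak A h) = \<eta> A" "kappa (algebra_weak A h) = omap L A"
  by (simp_all add: algebra_weak_def)

text \<open>The two algebra laws supply the two conditions on \<open>lam\<close>: associativity,
  through \<open>algebra_cmp\<close>, makes it a magma morphism, and the unit law makes it a
  retraction of \<open>rho\<close>.\<close>

lemma algebra_weak_in:
  assumes alg: "algebra A h" shows "algebra_weak A h \<in> Ob (Pen_Omega_Cat L \<eta>)"
proof -
  note A = algebraD(1)[OF alg] and h = algebraD(2)[OF alg]
  interpret m1: omega_magma "magma1 (algebra_weak A h)"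
    using omega_magma_algebra_magma[OF alg] by simp
  interpret k: categorical_penon_morphism "kappa (algebra_weak A h)"
    using penon_free[OF A] by simp
  have "composable A i j (h j x) (h j y)" if "composable (M A) i j x y" for i j x y
    by (rule hom_composable[OF omega_graph.axioms(1)[OF M_graph[OF A]] graph_hom_globular[OF h] that])
  then have "h \<in> magma_hom (M A) (algebra_magma A h)"
    using h algebra_cmp[OF alg] by (simp add: magma_hom_def)
  moreover have "fam_comp A h (\<eta> A) = fam_id A"
    by (rule graph_hom_eqI[OF graph_hom_comp[OF A \<eta>_hom[OF A] h] graph_hom_id[OF A]])
      (simp add: algebraD(3)[OF alg])
  ultimately have "weak_omega_category (algebra_weak A h)"
    by unfold_locales (simp_all add: \<eta>_hom[OF A])
  then show ?thesis by simp
qed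

definition to_weak ::
    "('u omega_graph \<times> 'u cell_map, 'u cell_map,
      'u weak_omega_category, 'u cell_map \<times> 'u cell_map \<times> 'u cell_map) functor_data" where
  "to_weak = \<lparr>omap = (\<lambda>X. algebra_weak (fst X) (snd X)),
    amap = (\<lambda>X Y f. (f, amap L (fst X) (fst Y) f))\<rparr>"

lemma to_weak_sel [simp]:
  "omap to_weak X = algebra_weak (fst X) (snd X)"
  "amap to_weak X Y f = (f, amap L (fst X) (fst Y) f)"
  by (simp_all add: to_weak_def)

text \<open>\<open>T f\<close> is a magma morphism and natural on generators, so it carries the
  formal composite of two generators to that of their images; evaluating gives preservation of
  composites.\<close>

lemma algebra_hom_magma_hom:
  assumes A: "algebra A h" and B: "algebra B k" and f: "f \<in> algebra_hom A h B k"
  shows "f \<in> magma_hom (algebra_magma A h) (algebra_magma B k)"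
proof -
  note gA = algebraD(1)[OF A] and gB = algebraD(1)[OF B] and fD = algebra_homD[OF f]
  have "f j (h j (cmp (M A) i j (\<eta> A j a) (\<eta> A j b)))
      = k j (cmp (M B) i j (\<eta> B j (f j a)) (\<eta> B j (f j b)))"
    if ab: "composable A i j a b" for i j a b
  proof -
    note c = \<eta>_composable[OF gA ab] and ab' = composable_in[OF ab]
    interpret bridge_magma "M A" by (rule M_bridge_magma[OF gA])
    show ?thesis
      using ab' by (simp add: fD(2)[OF cmp_in[OF c]] bridge_hom_cmp[OF T_bridge_hom[OF gA gB fD(1)] c]
          \<eta>_natural[OF gA gB fD(1)])
  qed
  moreover have "composable B i j (f j a) (f j b)" if "composable A i j a b" for i j a b
    by (rule hom_composable[OF omega_graph.axioms(1)[OF gA] graph_hom_globular[OF fD(1)] that])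
  ultimately show ?thesis using fD(1) by (simp add: magma_hom_def)
qed

lemma cat_functor_to_weak: "cat_functor (Prolixe L \<eta> \<epsilon>) (Pen_Omega_Cat L \<eta>) to_weak"
proof -
  interpret P: category "Prolixe L \<eta> \<epsilon>" by (rule category_Prolixe)
  interpret O: category "Pen_Omega_Cat L \<eta>" by (rule category_Pen_Omega_Cat)
  show ?thesis
  proof
    show "omap to_weak X \<in> Ob (Pen_Omega_Cat L \<eta>)" if "X \<in> Ob (Prolixe L \<eta> \<epsilon>)" for X
      using that algebra_weak_in[of "fst X" "snd X"] by (simp del: Pen_Omega_Cat_sel)
  next
    fix X Y f assume X: "X \<in> Ob (Prolixe L \<eta> \<epsilon>)" and Y: "Y \<in> Ob (Prolixe L \<eta> \<epsilon>)"
      and "f \<in> Hom (Prolixe L \<eta> \<epsilon>) X Y"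
    then have f: "f \<in> algebra_hom (fst X) (snd X) (fst Y) (snd Y)"
      and A: "algebra (fst X) (snd X)" and B: "algebra (fst Y) (snd Y)" by simp_all
    note gA = algebraD(1)[OF A] and gB = algebraD(1)[OF B] and fD = algebra_homD[OF f]
    \<comment> \<open>The \<open>rho\<close> square is naturality of the unit, the
      \<open>lam\<close> square the algebra morphism condition, and the \<open>kappa\<close> square
      is part of the value of \<open>L\<close> at \<open>f\<close>.\<close>
    have "(f, T (fst X) (fst Y) f, snd (amap L (fst X) (fst Y) f))
        \<in> Hom Omega_Cat (algebra_weak (fst X) (snd X)) (algebra_weak (fst Y) (snd Y))"
      using free_square[OF gA gB fD(1)] algebra_hom_magma_hom[OF A B f] fD(2) \<eta>_natural[OF gA gB fD(1)]
      by (simp add: Omega_Cat_sel Hom_Pen_Mor_iff fam_comp_eq_iff bridge_hom_magma)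
    then show "amap to_weak X Y f \<in> Hom (Pen_Omega_Cat L \<eta>) (omap to_weak X) (omap to_weak Y)"
      by (simp add: T_def)
  next
    fix X assume "X \<in> Ob (Prolixe L \<eta> \<epsilon>)"
    then show "amap to_weak X X (Ident (Prolixe L \<eta> \<epsilon>) X) = Ident (Pen_Omega_Cat L \<eta>) (omap to_weak X)"
      using left.amap_Id[of "fst X"] algebraD(1)[of "fst X" "snd X"]
      by (simp add: Omega_Cat_sel Ident_Pen_Mor)
  next
    fix X Y Z f g
    assume "X \<in> Ob (Prolixe L \<eta> \<epsilon>)" "Y \<in> Ob (Prolixe L \<eta> \<epsilon>)" "Z \<in> Ob (Prolixe L \<eta> \<epsilon>)"
      "f \<in> Hom (Prolixe L \<eta> \<epsilon>) X Y" "g \<in> Hom (Prolixe L \<eta> \<epsilon>) Y Z"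
    then show "amap to_weak X Z (Comp (Prolixe L \<eta> \<epsilon>) X Y Z g f)
        = Comp (Pen_Omega_Cat L \<eta>) (omap to_weak X) (omap to_weak Y) (omap to_weak Z)
            (amap to_weak Y Z g) (amap to_weak X Y f)"
      using left.amap_Comp[of "fst X" "fst Y" "fst Z" f g] algebraD(1) algebra_homD(1)
      by (simp add: Omega_Cat_sel Comp_Pen_Mor)
  qed
qed

subsection \<open>From weak omega categories to prolixes\<close>

lemma reflection_exists:
  assumes "omega_graph A" "h \<in> graph_hom (M A) A"
  shows "\<exists>B k u. reflection A h B k u"
proof -
  interpret prealgebra L \<eta> \<epsilon> A h
    by (rule prealgebra.intro[OF free_penon_axioms prealgebra_axioms.intro]) (rule assms)+
  show ?thesis using reflection_lim by blast
qed

lemma reflection_id: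
  assumes A: "algebra A h" shows "reflection A h A h (fam_id A)"
  unfolding reflection_def
proof (intro conjI allI ballI impI)
  show "fam_id A \<in> algebra_hom A h A h" by (rule algebra_hom_id[OF algebraD(1,2)[OF A]])
  fix C l f assume f: "f \<in> algebra_hom A h C l"
  show "\<exists>!g. g \<in> algebra_hom A h C l \<and> fam_comp A g (fam_id A) = f"
    using f fam_comp_id_right[OF algebra_hom_globular] by auto
qed (rule A)

text \<open>The choice of the identity on algebras makes \<open>to_weak\<close> a section on the nose.\<close>

definition chosen_reflection :: "'u weak_omega_category \<Rightarrow> ('u omega_graph \<times> 'u cell_map) \<times> 'u cell_map" where
  "chosen_reflection X = (let A = underlying_graph (magma1 X) in if algebra A (lam X) then ((A, lam X), fam_id A)
    else (SOME r. reflection A (lam X) (fst (fst r)) (snd (fst r)) (snd r)))"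

definition reflected_hom ::
    "'u weak_omega_category \<Rightarrow> 'u weak_omega_category \<Rightarrow> 'u cell_map \<Rightarrow> 'u cell_map" where
  "reflected_hom X Y f = (THE g.
    g \<in> algebra_hom (fst (fst (chosen_reflection X))) (snd (fst (chosen_reflection X))) (fst (fst (chosen_reflection Y))) (snd (fst (chosen_reflection Y))) \<and>
    fam_comp (magma1 X) g (snd (chosen_reflection X)) = fam_comp (magma1 X) (snd (chosen_reflection Y)) f)"

definition to_prolixe ::
    "('u weak_omega_category, 'u cell_map \<times> 'u cell_map \<times> 'u cell_map,
      'u omega_graph \<times> 'u cell_map, 'u cell_map) functor_data" where
  "to_prolixe = \<lparr>omap = (\<lambda>X. fst (chosen_reflection X)), amap = (\<lambda>X Y F. reflected_hom X Y (fst F))\<rparr>"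

lemma to_prolixe_sel [simp]:
  "omap to_prolixe X = fst (chosen_reflection X)" "amap to_prolixe X Y F = reflected_hom X Y (fst F)"
  by (simp_all add: to_prolixe_def)

lemma Pen_Omega_Cat_prealgebra:
  assumes "X \<in> Ob (Pen_Omega_Cat L \<eta>)"
  shows "omega_graph (underlying_graph (magma1 X))"
    and "lam X \<in> graph_hom (M (underlying_graph (magma1 X))) (underlying_graph (magma1 X))"
proof -
  interpret weak_omega_category X using assms by simp
  show "omega_graph (underlying_graph (magma1 X))"
    by (rule underlying_graph_omega_graph[OF magma1.omega_graph_axioms])
  show "lam X \<in> graph_hom (M (underlying_graph (magma1 X))) (underlying_graph (magma1 X))"
    using magma_hom_graph[OF lam_hom] assms by simp
qed

lemma reflection_chosen:
  assumes "X \<in> Ob (Pen_Omega_Cat L \<eta>)"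
  shows "reflection (underlying_graph (magma1 X)) (lam X) (fst (fst (chosen_reflection X))) (snd (fst (chosen_reflection X))) (snd (chosen_reflection X))"
proof (cases "algebra (underlying_graph (magma1 X)) (lam X)")
  case True
  then show ?thesis using reflection_id by (simp add: chosen_reflection_def Let_def del: fam_underlying)
next
  case False
  obtain B k u where "reflection (underlying_graph (magma1 X)) (lam X) B k u"
    using reflection_exists[OF Pen_Omega_Cat_prealgebra[OF assms]] by blast
  then have "\<exists>r. reflection (underlying_graph (magma1 X)) (lam X) (fst (fst r)) (snd (fst r)) (snd r)"
    by (intro exI[of _ "((B, k), u)"]) simp
  then show ?thesis unfolding chosen_reflection_def Let_def if_not_P[OF False] by (rule someI_ex)
qed

lemma reflectionD:
  assumes "reflection A h B k u"
  shows "algebra B k" "u \<in> algebra_hom A h B k"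
    and "\<lbrakk>f \<in> algebra_hom A h C l; algebra C l\<rbrakk> \<Longrightarrow> \<exists>!g. g \<in> algebra_hom B k C l \<and> fam_comp A g u = f"
  using assms by (simp_all add: reflection_def)

text \<open>The universal property of the reflection of \<open>X\<close>, applied to
  \<open>f\<close> followed by the reflection unit of \<open>Y\<close>.\<close>

lemma reflected_hom_ex1:
  assumes X: "X \<in> Ob (Pen_Omega_Cat L \<eta>)" and Y: "Y \<in> Ob (Pen_Omega_Cat L \<eta>)"
    and f: "f \<in> algebra_hom (underlying_graph (magma1 X)) (lam X) (underlying_graph (magma1 Y)) (lam Y)"
  shows "\<exists>!g. g \<in> algebra_hom (fst (fst (chosen_reflection X))) (snd (fst (chosen_reflection X))) (fst (fst (chosen_reflection Y))) (snd (fst (chosen_reflection Y))) \<and>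
    fam_comp (magma1 X) g (snd (chosen_reflection X)) = fam_comp (magma1 X) (snd (chosen_reflection Y)) f"
proof -
  note rX = reflectionD[OF reflection_chosen[OF X]] and rY = reflectionD[OF reflection_chosen[OF Y]]
  note aX = Pen_Omega_Cat_prealgebra[OF X] and aY = Pen_Omega_Cat_prealgebra[OF Y]
  have "fam_comp (underlying_graph (magma1 X)) (snd (chosen_reflection Y)) f
      \<in> algebra_hom (underlying_graph (magma1 X)) (lam X) (fst (fst (chosen_reflection Y))) (snd (fst (chosen_reflection Y)))"
    by (rule algebra_hom_comp[OF aX(1) aY(1) algebraD(1)[OF rY(1)] aX(2) f rY(2)])
  from rX(3)[OF this rY(1)] show ?thesis by simp
qed

lemmas reflected_hom_spec = theI'[OF reflected_hom_ex1, folded reflected_hom_def]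

lemma reflected_hom_eqI:
  assumes "X \<in> Ob (Pen_Omega_Cat L \<eta>)" "Y \<in> Ob (Pen_Omega_Cat L \<eta>)"
    and "f \<in> algebra_hom (underlying_graph (magma1 X)) (lam X) (underlying_graph (magma1 Y)) (lam Y)"
    and "g \<in> algebra_hom (fst (fst (chosen_reflection X))) (snd (fst (chosen_reflection X))) (fst (fst (chosen_reflection Y))) (snd (fst (chosen_reflection Y)))"
    and "fam_comp (magma1 X) g (snd (chosen_reflection X)) = fam_comp (magma1 X) (snd (chosen_reflection Y)) f"
  shows "reflected_hom X Y f = g"
  unfolding reflected_hom_def using assms by (intro the1_equality[OF reflected_hom_ex1]) simp_all

text \<open>Identities and composites satisfy the equation that characterises the induced map, so
  functoriality is the uniqueness part of the universal property.\<close>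

lemma cat_functor_to_prolixe: "cat_functor (Pen_Omega_Cat L \<eta>) (Prolixe L \<eta> \<epsilon>) to_prolixe"
proof -
  interpret P: category "Prolixe L \<eta> \<epsilon>" by (rule category_Prolixe)
  interpret O: category "Pen_Omega_Cat L \<eta>" by (rule category_Pen_Omega_Cat)
  show ?thesis
  proof
    fix X assume X: "X \<in> Ob (Pen_Omega_Cat L \<eta>)"
    show "omap to_prolixe X \<in> Ob (Prolixe L \<eta> \<epsilon>)"
      using reflectionD(1)[OF reflection_chosen[OF X]] by simp
  next
    fix X Y F assume X: "X \<in> Ob (Pen_Omega_Cat L \<eta>)" and Y: "Y \<in> Ob (Pen_Omega_Cat L \<eta>)"
      and F: "F \<in> Hom (Pen_Omega_Cat L \<eta>) X Y"
    show "amap to_prolixe X Y F \<in> Hom (Prolixe L \<eta> \<epsilon>) (omap to_prolixe X) (omap to_prolixe Y)"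
      using reflected_hom_spec[OF X Y Pen_Omega_Cat_hom[OF X Y F]] by simp
  next
    fix X assume X: "X \<in> Ob (Pen_Omega_Cat L \<eta>)"
    note r = reflectionD(1,2)[OF reflection_chosen[OF X]]
    note rg = algebra_hom_globular[OF r(2)]
    have "reflected_hom X X (fst (Ident (Pen_Omega_Cat L \<eta>) X)) = fam_id (fst (fst (chosen_reflection X)))"
      using Pen_Omega_Cat_hom[OF X X O.Id_in[OF X]] algebra_hom_id[OF algebraD(1,2)[OF r(1)]]
        fam_comp_id_left[OF rg] fam_comp_id_right[OF rg]
      by (intro reflected_hom_eqI[OF X X]) (simp_all add: Omega_Cat_sel)
    then show "amap to_prolixe X X (Ident (Pen_Omega_Cat L \<eta>) X) = Ident (Prolixe L \<eta> \<epsilon>) (omap to_prolixe X)"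
      by simp
  next
    fix X Y Z F G
    assume X: "X \<in> Ob (Pen_Omega_Cat L \<eta>)" and Y: "Y \<in> Ob (Pen_Omega_Cat L \<eta>)"
      and Z: "Z \<in> Ob (Pen_Omega_Cat L \<eta>)"
      and F: "F \<in> Hom (Pen_Omega_Cat L \<eta>) X Y" and G: "G \<in> Hom (Pen_Omega_Cat L \<eta>) Y Z"
    note r = reflectionD(1,2)[OF reflection_chosen]
    note eF = reflected_hom_spec[OF X Y Pen_Omega_Cat_hom[OF X Y F]]
    note eG = reflected_hom_spec[OF Y Z Pen_Omega_Cat_hom[OF Y Z G]]
    have "reflected_hom X Z (fst (Comp (Pen_Omega_Cat L \<eta>) X Y Z G F))
        = fam_comp (fst (fst (chosen_reflection X))) (reflected_hom Y Z (fst G)) (reflected_hom X Y (fst F))"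
    proof (rule reflected_hom_eqI[OF X Z Pen_Omega_Cat_hom[OF X Z O.Comp_in[OF X Y Z F G]]])
      show "fam_comp (fst (fst (chosen_reflection X))) (reflected_hom Y Z (fst G)) (reflected_hom X Y (fst F))
          \<in> algebra_hom (fst (fst (chosen_reflection X))) (snd (fst (chosen_reflection X))) (fst (fst (chosen_reflection Z))) (snd (fst (chosen_reflection Z)))"
        by (rule algebra_hom_comp[OF algebraD(1)[OF r(1)[OF X]] algebraD(1)[OF r(1)[OF Y]]
              algebraD(1)[OF r(1)[OF Z]] algebraD(2)[OF r(1)[OF X]] eF[THEN conjunct1] eG[THEN conjunct1]])
      have F_in: "fst F i a \<in> cells (magma1 Y) i" if "a \<in> cells (magma1 X) i" for i a
        using graph_hom_in[OF algebra_homD(1)[OF Pen_Omega_Cat_hom[OF X Y F]], of a i] that by simp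
      have u_in: "snd (chosen_reflection X) i a \<in> cells (fst (fst (chosen_reflection X))) i" if "a \<in> cells (magma1 X) i" for i a
        using graph_hom_in[OF algebra_homD(1)[OF r(2)[OF X]], of a i] that by simp
      \<comment> \<open>The two squares relating induced maps to reflection units are pasted, cell
        by cell.\<close>
      show "fam_comp (magma1 X) (fam_comp (fst (fst (chosen_reflection X))) (reflected_hom Y Z (fst G)) (reflected_hom X Y (fst F))) (snd (chosen_reflection X))
          = fam_comp (magma1 X) (snd (chosen_reflection Z)) (fst (Comp (Pen_Omega_Cat L \<eta>) X Y Z G F))"
        using eF[THEN conjunct2] eG[THEN conjunct2]
        by (simp add: fam_comp_eq_iff Omega_Cat_sel F_in u_in)
    qed
    then show "amap to_prolixe X Z (Comp (Pen_Omega_Cat L \<eta>) X Y Z G F)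
        = Comp (Prolixe L \<eta> \<epsilon>) (omap to_prolixe X) (omap to_prolixe Y) (omap to_prolixe Z)
            (amap to_prolixe Y Z G) (amap to_prolixe X Y F)"
      by simp
  qed
qed

lemma chosen_reflection_algebra_weak: "algebra A h \<Longrightarrow> chosen_reflection (algebra_weak A h) = ((A, h), fam_id A)"
  by (simp add: chosen_reflection_def Let_def)

text \<open>For a weak omega category coming from a prolixe the chosen reflection unit is an
  identity, so the equation characterising the induced map is solved by \<open>f\<close>
  itself.\<close>

lemma to_prolixe_to_weak: "functor_eq (Prolixe L \<eta> \<epsilon>) (comp_functor to_prolixe to_weak) id_functor"
  unfolding functor_eq_def
proof (intro conjI ballI)
  fix X assume "X \<in> Ob (Prolixe L \<eta> \<epsilon>)"
  then show "omap (comp_functor to_prolixe to_weak) X = omap id_functor X"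
    by (simp add: comp_functor_def id_functor_def chosen_reflection_algebra_weak)
next
  fix X Y f assume "X \<in> Ob (Prolixe L \<eta> \<epsilon>)" "Y \<in> Ob (Prolixe L \<eta> \<epsilon>)" "f \<in> Hom (Prolixe L \<eta> \<epsilon>) X Y"
  then have X: "algebra (fst X) (snd X)" and Y: "algebra (fst Y) (snd Y)"
    and f: "f \<in> algebra_hom (fst X) (snd X) (fst Y) (snd Y)" by simp_all
  have "reflected_hom (algebra_weak (fst X) (snd X)) (algebra_weak (fst Y) (snd Y)) f = f"
    using f fam_comp_id_left[OF algebra_hom_globular[OF f]] fam_comp_id_right[OF algebra_hom_globular[OF f]]
    by (intro reflected_hom_eqI algebra_weak_in X Y) (simp_all add: chosen_reflection_algebra_weak X Y)
  then show "amap (comp_functor to_prolixe to_weak) X Y f = amap id_functor X Y f"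
    by (simp add: comp_functor_def id_functor_def)
qed

end

theorem mainTheorem7:
  fixes L :: "'u free_penon_functor"
    and \<eta> :: "'u omega_graph \<Rightarrow> 'u cell_map"
    and \<epsilon> :: "'u penon_morphism \<Rightarrow> 'u cell_map \<times> 'u cell_map"
  assumes "adjunction Omega_Graph Pen_Mor L U_GP \<eta> \<epsilon>"
  shows "\<exists>U S. cat_functor (Pen_Omega_Cat L \<eta>) (Prolixe L \<eta> \<epsilon>) U \<and>
               cat_functor (Prolixe L \<eta> \<epsilon>) (Pen_Omega_Cat L \<eta>) S \<and>
               functor_eq (Prolixe L \<eta> \<epsilon>) (comp_functor U S) id_functor"
proof -
  interpret free_penon L \<eta> \<epsilon> by (rule free_penon.intro[OF assms])
  show ?thesis
    using cat_functor_to_prolixe cat_functor_to_weak to_prolixe_to_weak by blast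
qed

end
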